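(* Let $\alpha\in(1,2)$, $d\ge 1$, $Y=[0,1]$, and let $f\colon Y\to Y$ be one of the two intermittent maps (Map I) or (Map II) defined in the context, with absolutely continuous invariant probability measure $\mu$. Let $v\colon Y\to\mathbb{R}^d$ be Hölder with $\int_Y v\,d\mu=0$. Let $\mathbb{P}$ be any probability measure on $Y$ that is absolutely continuous with respect to Lebesgue measure, and let $$W_n(t)=n^{-1/\alpha}\sum_{j=0}^{\lfloor nt\rfloor-1}v\circ f^j,\qquad t\in[0,1].$$ Then for every $p>\alpha$ the family of random variables $\{\|W_n\|_{p\text{-var}}\}_{n\ge1}$ is tight on $(Y,\mathbb{P})$.
   Context: Intermittent maps on $Y=[0,1]$, with parameter $\alpha\in(1,2)$. (Map I): $f(y)=y(1+2^{1/\alpha}y^{1/\alpha})$ for $y\in[0,\frac12)$, and $f(y)=2y-1$ for $y\in[\frac12,1]$. (Map II): $f(y)=y(1+3^{1/\alpha}y^{1/\alpha})$ for $y\in[0,\frac13)$, $f(y)=3y-1$ for $y\in[\frac13,\frac23)$, and $f(y)=1-(1-y)(1+3^{1/\alpha}(1-y)^{1/\alpha})$ for $y\in[\frac23,1]$. Each map has a unique invariant probability measure that is absolutely continuous with respect to Lebesgue measure; it is denoted $\mu$. For $1\le p<\infty$ and $u\colon[0,1]\to\mathbb{R}^d$, $\|u\|_{p\text{-var}}=\sup_{0=t_0<t_1<\dots<t_k=1}\bigl(\sum_{j=1}^k|u(t_j)-u(t_{j-1})|^p\bigr)^{1/p}$, where $|\cdot|$ is the Euclidean norm. *)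

theory Defs
  imports "HOL-Analysis.Analysis" "HOL-Probability.Probability"
begin

text \<open>The two intermittent maps. Only their values on the interval from 0 to 1 are relevant;
  outside of it they take arbitrary values.\<close>

definition map_I :: "real \<Rightarrow> real \<Rightarrow> real" where
  "map_I \<alpha> y =
     (if y < 1/2 then y * (1 + 2 powr (1/\<alpha>) * y powr (1/\<alpha>))
      else 2 * y - 1)"

definition map_II :: "real \<Rightarrow> real \<Rightarrow> real" where
  "map_II \<alpha> y =
     (if y < 1/3 then y * (1 + 3 powr (1/\<alpha>) * y powr (1/\<alpha>))
      else if y < 2/3 then 3 * y - 1
      else 1 - (1 - y) * (1 + 3 powr (1/\<alpha>) * (1 - y) powr (1/\<alpha>)))"

definition abs_cont_prob :: "real measure \<Rightarrow> bool" where
  "abs_cont_prob M \<longleftrightarrow>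
     prob_space M \<and> sets M = sets (restrict_space borel {0..1}) \<and>
     absolutely_continuous (restrict_space lborel {0..1}) M"

definition invariant_measure :: "('a \<Rightarrow> 'a) \<Rightarrow> 'a measure \<Rightarrow> bool" where
  "invariant_measure f M \<longleftrightarrow> f \<in> M \<rightarrow>\<^sub>M M \<and> distr M M f = M"

definition holder_on :: "'a::metric_space set \<Rightarrow> ('a \<Rightarrow> 'b::metric_space) \<Rightarrow> bool" where
  "holder_on S v \<longleftrightarrow>
     (\<exists>\<eta> C. 0 < \<eta> \<and> \<eta> \<le> 1 \<and> 0 \<le> C \<and>
        (\<forall>x\<in>S. \<forall>y\<in>S. dist (v x) (v y) \<le> C * dist x y powr \<eta>))"

text \<open>The supremum is taken in the extended nonnegative reals, so that functions of unbounded
  \<open>p\<close>-variation get the value \<open>\<infinity>\<close>. A partition is a pair of its number of intervals and a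
  sequence of points, of which only those with index at most that number matter.\<close>

definition unit_partitions :: "(nat \<times> (nat \<Rightarrow> real)) set" where
  "unit_partitions = {(k, t). t 0 = 0 \<and> t k = 1 \<and> (\<forall>j<k. t j < t (Suc j))}"

definition p_variation :: "real \<Rightarrow> (real \<Rightarrow> 'a::real_normed_vector) \<Rightarrow> ennreal" where
  "p_variation p u =
     (SUP (k, t)\<in>unit_partitions.
        ennreal ((\<Sum>j=1..k. norm (u (t j) - u (t (j - 1))) powr p) powr (1/p)))"

definition W ::
  "real \<Rightarrow> ('a \<Rightarrow> 'a) \<Rightarrow> ('a \<Rightarrow> 'b::real_vector) \<Rightarrow> nat \<Rightarrow> 'a \<Rightarrow> real \<Rightarrow> 'b" where
  "W \<alpha> f v n y t =
     (real n powr (- 1/\<alpha>)) *\<^sub>R (\<Sum>j<nat \<lfloor>real n * t\<rfloor>. v ((f ^^ j) y))"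

end

theory Submission
  imports Defs
begin

text \<open>Both maps have neutral fixed points, near which orbits spend a long time: the first return time
\<open>rt\<close> to the interval \<open>J\<close> of the expanding affine branch has tail
\<open>P(rt \<ge> n) = O(n powr - \<alpha>)\<close> (\<open>rt_tail\<close>). Summing \<open>v\<close> along an excursion gives an observable of
size at most a constant times \<open>rt\<close> for the first return map \<open>F\<close>, and \<open>F\<close> is uniformly
expanding with full branches. So \<open>W\<close> is, up to a change of time, a normalised sum of weakly
dependent variables with heavy tails of index \<open>\<alpha>\<close>, and such a sum should behave in
\<open>p\<close>-variation like a Levy process of index \<open>\<alpha>\<close>, whose paths have finite \<open>p\<close>-variation
for \<open>p > \<alpha>\<close>.

The probabilistic core is \<open>pvar_heavy_tailed_sums\<close>. The summands are sorted by size: the part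
with return time in \<open>[2^k, 2^(k+1))\<close> is rare, so that about one in \<open>2^(k\<alpha>)\<close> summands belongs to it.
On blocks shorter than \<open>2^(k\<alpha>)\<close> its \<open>p\<close>-variation is bounded by the total
variation; on longer blocks a dyadic decomposition of the time axis
(\<open>pvar_le_dyadic\<close>) needs only second moments of sums over blocks, and the levels sum to a
geometric series because \<open>p < 2\<close>. The result is a contribution of order
\<open>n powr (1/p) * 2 powr (k (1 - \<alpha>/p))\<close>, which is again geometric in \<open>k\<close> because \<open>\<alpha> < p\<close>, and is dominated by
the largest scale \<open>2^k = n powr (1/\<alpha>)\<close>. Larger scales do not occur before time \<open>n\<close>, up to small
probability. All combinatorics of \<open>p\<close>-variation goes through one lemma,
\<open>pvar_le_coarsen\<close>: the variation of a path is at most that of its restriction to the end points of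
blocks plus twice the \<open>l^p\<close> sum of the total variations inside the blocks.

The second moments come from the decay of correlations of \<open>F\<close>
(\<open>variance_birkhoff_le\<close>). Its transfer operator maps a cone of
functions with Hoelder logarithm into a smaller one, so a fixed fraction of every density can be
split off as a constant (\<open>coupling\<close>), and iteration makes any two densities exponentially close
(\<open>Ln_contraction\<close>). The distortion bound behind this rests on the concavity of
\<open>y powr \<gamma>\<close>, which makes the sums along an orbit telescope (\<open>gn_powr_diff_le\<close>).

The lemma \<open>pvar_real_time\<close> returns from \<open>F\<close> to the original map: it applies
\<open>pvar_le_coarsen\<close> to the blocks between consecutive return times. Since \<open>f\<close> maps \<open>J\<close> affinely onto the
unit interval, the bound passes from Lebesgue measure on \<open>J\<close> to Lebesgue measure on \<open>[0,1]\<close>, and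
from there to every absolutely continuous probability. At this point \<open>v\<close> is centred by some
constant. Under the invariant measure \<open>\<mu>\<close> the sums have expectation zero, and fluctuations
of order \<open>n powr (1/\<alpha>)\<close>, which is smaller than \<open>n\<close>, leave no room for a drift: the constant vanishes
(\<open>bounded_fluctuations_imp_zero_drift\<close>).\<close>

section \<open>Inequalities for sums of powers\<close>

lemma powr_convex_combination:
  fixes a b s p :: real
  assumes "1 \<le> p" "0 \<le> a" "0 \<le> b" "0 < s" "s < 1"
  shows "(s * a + (1 - s) * b) powr p \<le> s * a powr p + (1 - s) * b powr p"
proof (cases "a = 0 \<or> b = 0")
  case True
  have *: "(r * c) powr p \<le> r * c powr p" if "0 < r" "r < 1" "0 \<le> c" for r c :: real
  proof -
    have "r powr p \<le> r powr 1" using that assms(1) by (intro powr_mono') auto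
    thus ?thesis using that by (simp add: powr_mult mult_right_mono)
  qed
  show ?thesis using True *[of s a] *[of "1 - s" b] assms by auto
next
  case False
  hence "a \<in> {0<..}" "b \<in> {0<..}" using assms by auto
  from convex_onD[OF powr_convex[OF assms(1)] _ _ this, of "1 - s"] assms
  show ?thesis by (simp add: mult.commute)
qed

lemma powr_add_le:
  fixes x y p :: real
  assumes "1 \<le> p" "0 \<le> x" "0 \<le> y"
  shows "(x + y) powr p \<le> 2 powr (p - 1) * (x powr p + y powr p)"
proof -
  have "(x + y) powr p = 2 powr p * (1/2 * x + (1 - 1/2) * y) powr p"
    using assms by (simp flip: powr_mult add: algebra_simps add_divide_distrib)
  also have "\<dots> \<le> 2 powr p * (1/2 * x powr p + (1 - 1/2) * y powr p)"
    using powr_convex_combination[OF assms, of "1/2"] by (intro mult_left_mono) auto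
  also have "\<dots> = 2 powr (p - 1) * (x powr p + y powr p)"
    by (simp add: powr_diff algebra_simps)
  finally show ?thesis .
qed

text \<open>Convexity of the power is applied with the weights
\<open>X / (X + Y)\<close> and \<open>Y / (X + Y)\<close>, for which the two bounds recombine to \<open>(X + Y) powr p\<close>.\<close>

lemma minkowski_powr_sum:
  fixes x y :: "'i \<Rightarrow> real"
  assumes p: "1 \<le> p" and S: "finite S"
    and x: "\<And>i. i \<in> S \<Longrightarrow> 0 \<le> x i" and y: "\<And>i. i \<in> S \<Longrightarrow> 0 \<le> y i"
    and X: "(\<Sum>i\<in>S. x i powr p) \<le> X powr p" and Y: "(\<Sum>i\<in>S. y i powr p) \<le> Y powr p"
    and nn: "0 \<le> X" "0 \<le> Y"
  shows "(\<Sum>i\<in>S. (x i + y i) powr p) \<le> (X + Y) powr p"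
proof (cases "X = 0 \<or> Y = 0")
  case True
  have zero: "z i = 0" if "(\<Sum>i\<in>S. z i powr p) \<le> Z powr p" "Z = 0" "i \<in> S" for z Z and i :: 'i
  proof -
    have "(\<Sum>i\<in>S. z i powr p) = 0" using that(1,2) p by (intro antisym sum_nonneg) auto
    thus ?thesis using S that(3) by (subst (asm) sum_nonneg_eq_0_iff) auto
  qed
  show ?thesis
  proof (cases "X = 0")
    case True
    thus ?thesis using zero[OF X] Y by simp
  next
    case False
    hence "Y = 0" using \<open>X = 0 \<or> Y = 0\<close> by simp
    thus ?thesis using zero[OF Y] X by simp
  qed
next
  case False
  hence pos: "0 < X" "0 < Y" using nn by auto
  define s where "s = X / (X + Y)"
  have s: "0 < s" "s < 1" "1 - s = Y / (X + Y)" using pos by (auto simp: s_def field_simps)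
  have "(\<Sum>i\<in>S. (x i + y i) powr p) \<le>
    (\<Sum>i\<in>S. (X + Y) powr p * (s * (x i powr p / X powr p) + (1 - s) * (y i powr p / Y powr p)))"
  proof (rule sum_mono)
    fix i assume i: "i \<in> S"
    have "x i + y i = (X + Y) * (s * (x i / X) + (1 - s) * (y i / Y))"
    proof -
      have "(X + Y) * (s * (x i / X)) = x i" "(X + Y) * (Y / (X + Y) * (y i / Y)) = y i"
        using pos by (auto simp: s_def)
      thus ?thesis unfolding s(3) by (simp only: distrib_left)
    qed
    hence "(x i + y i) powr p = (X + Y) powr p * (s * (x i / X) + (1 - s) * (y i / Y)) powr p"
      using pos x[OF i] y[OF i] s by (simp add: powr_mult)
    also have "\<dots> \<le> (X + Y) powr p * (s * (x i / X) powr p + (1 - s) * (y i / Y) powr p)"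
      using x[OF i] y[OF i] pos s p by (intro mult_left_mono powr_convex_combination) auto
    finally show "(x i + y i) powr p \<le> (X + Y) powr p * (s * (x i powr p / X powr p) + (1 - s) * (y i powr p / Y powr p))"
      using x[OF i] y[OF i] pos by (simp add: powr_divide)
  qed
  also have "\<dots> = (X + Y) powr p * (s * ((\<Sum>i\<in>S. x i powr p) / X powr p) + (1 - s) * ((\<Sum>i\<in>S. y i powr p) / Y powr p))"
    by (simp add: sum_distrib_left sum.distrib sum_divide_distrib algebra_simps)
  also have "\<dots> \<le> (X + Y) powr p * (s * 1 + (1 - s) * 1)"
    using s X Y pos by (intro mult_left_mono add_mono) (auto simp: divide_le_eq)
  finally show ?thesis by simp
qed

lemma sum_powr_le_powr_sum:
  fixes z :: "'i \<Rightarrow> real"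
  assumes "1 \<le> p" "finite S" "\<And>i. i \<in> S \<Longrightarrow> 0 \<le> z i"
  shows "(\<Sum>i\<in>S. z i powr p) \<le> (\<Sum>i\<in>S. z i) powr p"
proof -
  define Z where "Z = (\<Sum>i\<in>S. z i)"
  have "(\<Sum>i\<in>S. z i powr p) \<le> (\<Sum>i\<in>S. z i * Z powr (p - 1))"
  proof (rule sum_mono)
    fix i assume i: "i \<in> S"
    have "z i \<le> Z" unfolding Z_def using assms i by (intro member_le_sum) auto
    hence "z i * z i powr (p - 1) \<le> z i * Z powr (p - 1)"
      using assms i by (intro mult_left_mono powr_mono2) auto
    thus "z i powr p \<le> z i * Z powr (p - 1)"
      using assms(3)[OF i] by (cases "z i = 0") (auto simp: powr_diff)
  qed
  also have "\<dots> = Z * Z powr (p - 1)" by (simp add: Z_def sum_distrib_right)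
  also have "\<dots> = Z powr p" using assms sum_nonneg[of S z]
    by (cases "Z = 0") (auto simp: powr_diff Z_def)
  finally show ?thesis by (simp add: Z_def)
qed

text \<open>This turns second moments into
bounds of \<open>p\<close>-variation at the price of a power of the number of summands. Jensen's inequality
for the power \<open>2/p\<close> needs positive arguments, hence the limit of small positive shifts.\<close>

lemma sum_powr_le_power_mean:
  fixes x :: "'i \<Rightarrow> real"
  assumes p: "0 < p" "p \<le> 2" and S: "finite S" "S \<noteq> {}" 
  shows "(\<Sum>i\<in>S. \<bar>x i\<bar> powr p) \<le> (real (card S) powr (1/p - 1/2) * sqrt (\<Sum>i\<in>S. (x i)\<^sup>2)) powr p"
proof -
  define n where "n = real (card S)"
  have n: "n > 0" using S by (simp add: n_def card_gt_0_iff)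
  have jensen: "(\<Sum>i\<in>S. 1/n * a i) powr (2/p) \<le> (\<Sum>i\<in>S. 1/n * (a i) powr (2/p))"
    if "\<And>i. i \<in> S \<Longrightarrow> a i > 0" for a :: "'i \<Rightarrow> real"
    using convex_on_sum[OF S powr_convex[of "2/p"], of "\<lambda>_. 1/n" a] that p n by (simp add: n_def)
  have *: "(\<Sum>i\<in>S. 1/n * (\<bar>x i\<bar> powr p + e)) powr (2/p) \<le> (\<Sum>i\<in>S. 1/n * (\<bar>x i\<bar> powr p + e) powr (2/p))" if "e > 0" for e
    using that by (intro jensen) (auto intro: add_nonneg_pos)
  have "((\<lambda>e. (\<Sum>i\<in>S. 1/n * (\<bar>x i\<bar> powr p + e)) powr (2/p)) \<longlongrightarrow> (\<Sum>i\<in>S. 1/n * (\<bar>x i\<bar> powr p + 0)) powr (2/p)) (at_right 0)"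
    using p n by (intro tendsto_intros tendsto_powr' ) (auto intro!: sum_nonneg eventually_at_rightI[of 0 1])
  moreover have "((\<lambda>e. (\<Sum>i\<in>S. 1/n * (\<bar>x i\<bar> powr p + e) powr (2/p))) \<longlongrightarrow> (\<Sum>i\<in>S. 1/n * (\<bar>x i\<bar> powr p + 0) powr (2/p))) (at_right 0)"
    using p n by (intro tendsto_intros tendsto_powr' ) (auto intro!: sum_nonneg eventually_at_rightI[of 0 1])
  ultimately have "(\<Sum>i\<in>S. 1/n * (\<bar>x i\<bar> powr p + 0)) powr (2/p) \<le> (\<Sum>i\<in>S. 1/n * (\<bar>x i\<bar> powr p + 0) powr (2/p))"
    using * by (intro tendsto_le[rotated 1, rotated 1]) (auto intro!: eventually_at_rightI[of 0 1])
  hence "(1/n * (\<Sum>i\<in>S. \<bar>x i\<bar> powr p)) powr (2/p) \<le> 1/n * (\<Sum>i\<in>S. (x i)\<^sup>2)"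
    using p by (simp add: powr_powr sum_distrib_left)
  hence "((1/n * (\<Sum>i\<in>S. \<bar>x i\<bar> powr p)) powr (2/p)) powr (p/2) \<le> (1/n * (\<Sum>i\<in>S. (x i)\<^sup>2)) powr (p/2)"
    using p by (intro powr_mono2) auto
  hence "1/n * (\<Sum>i\<in>S. \<bar>x i\<bar> powr p) \<le> (1/n * (\<Sum>i\<in>S. (x i)\<^sup>2)) powr (p/2)"
    using p n sum_nonneg[of S "\<lambda>i. \<bar>x i\<bar> powr p"] by (simp add: powr_powr)
  hence "(\<Sum>i\<in>S. \<bar>x i\<bar> powr p) \<le> n * (1/n * (\<Sum>i\<in>S. (x i)\<^sup>2)) powr (p/2)"
    using n by (simp add: field_simps)
  also have "\<dots> = n powr (1 - p/2) * (\<Sum>i\<in>S. (x i)\<^sup>2) powr (p/2)"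
    using n p sum_nonneg[of S "\<lambda>i. (x i)\<^sup>2"] by (simp add: powr_divide powr_diff)
  also have "1 - p/2 = (1/p - 1/2) * p" using p by (simp add: field_simps)
  also have "n powr ((1/p - 1/2) * p) * (\<Sum>i\<in>S. (x i)\<^sup>2) powr (p/2) = (n powr (1/p - 1/2) * sqrt (\<Sum>i\<in>S. (x i)\<^sup>2)) powr p"
    using n p sum_nonneg[of S "\<lambda>i. (x i)\<^sup>2"]
    by (simp add: powr_mult powr_powr powr_half_sqrt[symmetric])
  finally show ?thesis by (simp add: n_def)
qed

section \<open>The variation of sequences\<close>

text \<open>Gaps between consecutive intervals are permitted. This does not change the \<open>p\<close>-variation, but
the intervals that remain when the ends of a partition are rounded to end points of blocks do have gaps.\<close>

definition interval_chain :: "nat \<Rightarrow> nat \<Rightarrow> (nat \<Rightarrow> nat) \<Rightarrow> (nat \<Rightarrow> nat) \<Rightarrow> bool" where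
  "interval_chain n k s t \<longleftrightarrow>
     (\<forall>i<k. s i \<le> t i \<and> t i \<le> n) \<and> (\<forall>i. Suc i < k \<longrightarrow> t i \<le> s (Suc i))"

text \<open>The \<open>p\<close>-variation of the first \<open>n\<close> steps is at most \<open>R\<close>. A predicate for upper bounds
avoids suprema, and the measurability of the \<open>p\<close>-variation as a function of a parameter.\<close>

definition pvar_le :: "real \<Rightarrow> (nat \<Rightarrow> real) \<Rightarrow> nat \<Rightarrow> real \<Rightarrow> bool" where
  "pvar_le p u n R \<longleftrightarrow>
     (\<forall>k s t. interval_chain n k s t \<longrightarrow> (\<Sum>i<k. \<bar>u (t i) - u (s i)\<bar> powr p) \<le> R powr p)"

lemma pvar_leI:
  "(\<And>k s t. interval_chain n k s t \<Longrightarrow> (\<Sum>i<k. \<bar>u (t i) - u (s i)\<bar> powr p) \<le> R powr p) \<Longrightarrow> pvar_le p u n R"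
  by (auto simp: pvar_le_def)

lemma pvar_leD:
  "pvar_le p u n R \<Longrightarrow> interval_chain n k s t \<Longrightarrow> (\<Sum>i<k. \<bar>u (t i) - u (s i)\<bar> powr p) \<le> R powr p"
  by (auto simp: pvar_le_def)

lemma interval_chain_mono: "interval_chain n k s t \<Longrightarrow> n \<le> n' \<Longrightarrow> interval_chain n' k s t"
  by (force simp: interval_chain_def)

lemma pvar_le_mono:
  assumes "pvar_le p u n R" "n' \<le> n" "0 \<le> R" "R \<le> R'" "0 \<le> p"
  shows "pvar_le p u n' R'"
proof (rule pvar_leI)
  fix k s t assume "interval_chain n' k s t"
  hence "(\<Sum>i<k. \<bar>u (t i) - u (s i)\<bar> powr p) \<le> R powr p"
    using assms(1,2) by (auto intro: pvar_leD interval_chain_mono)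
  also have "\<dots> \<le> R' powr p" using assms by (intro powr_mono2) auto
  finally show "(\<Sum>i<k. \<bar>u (t i) - u (s i)\<bar> powr p) \<le> R' powr p" .
qed

lemma pvar_le_cong:
  assumes "\<And>l. l \<le> n \<Longrightarrow> u l = w l" 
  shows "pvar_le p u n R \<longleftrightarrow> pvar_le p w n R"
proof -
  have "(\<Sum>i<k. \<bar>u (t i) - u (s i)\<bar> powr p) = (\<Sum>i<k. \<bar>w (t i) - w (s i)\<bar> powr p)"
    if "interval_chain n k s t" for k s t
    using that assms by (intro sum.cong) (auto simp: interval_chain_def dest: le_trans)
  thus ?thesis by (auto simp: pvar_le_def)
qed

lemma pvar_le_add:
  assumes "1 \<le> p" "pvar_le p u n R" "pvar_le p w n S" "0 \<le> R" "0 \<le> S"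
  shows "pvar_le p (\<lambda>l. u l + w l) n (R + S)"
proof (rule pvar_leI)
  fix k s t assume c: "interval_chain n k s t"
  have "(\<Sum>i<k. \<bar>u (t i) + w (t i) - (u (s i) + w (s i))\<bar> powr p) 
    \<le> (\<Sum>i<k. (\<bar>u (t i) - u (s i)\<bar> + \<bar>w (t i) - w (s i)\<bar>) powr p)"
    using assms by (intro sum_mono powr_mono2) auto
  also have "\<dots> \<le> (R + S) powr p"
    using assms c by (intro minkowski_powr_sum) (auto intro: pvar_leD)
  finally show "(\<Sum>i<k. \<bar>u (t i) + w (t i) - (u (s i) + w (s i))\<bar> powr p) \<le> (R + S) powr p" .
qed

lemma pvar_le_zero: "0 < p \<Longrightarrow> pvar_le p (\<lambda>_. c) n 0"
  by (simp add: pvar_le_def)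

lemma pvar_le_sum:
  assumes "1 \<le> p" "finite I" "\<And>i. i \<in> I \<Longrightarrow> pvar_le p (u i) n (R i)" "\<And>i. i \<in> I \<Longrightarrow> 0 \<le> R i"
  shows "pvar_le p (\<lambda>l. \<Sum>i\<in>I. u i l) n (\<Sum>i\<in>I. R i)"
  using assms(2,3,4)
proof (induction I rule: finite_induct)
  case empty
  thus ?case using assms(1) pvar_le_zero[of p 0] by simp
next
  case (insert x F)
  thus ?case using assms(1) by (auto intro!: pvar_le_add sum_nonneg)
qed

lemma pvar_le_scale:
  assumes "0 \<le> R" "pvar_le p u n R"
  shows "pvar_le p (\<lambda>l. c * u l) n (\<bar>c\<bar> * R)"
proof (rule pvar_leI)
  fix k s t assume "interval_chain n k s t"
  have "(\<Sum>i<k. \<bar>c * u (t i) - c * u (s i)\<bar> powr p) = \<bar>c\<bar> powr p * (\<Sum>i<k. \<bar>u (t i) - u (s i)\<bar> powr p)"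
    by (simp add: sum_distrib_left abs_mult powr_mult flip: right_diff_distrib)
  also have "\<dots> \<le> \<bar>c\<bar> powr p * R powr p"
    using pvar_leD[OF assms(2) \<open>interval_chain n k s t\<close>] by (intro mult_left_mono) auto
  finally show "(\<Sum>i<k. \<bar>c * u (t i) - c * u (s i)\<bar> powr p) \<le> (\<bar>c\<bar> * R) powr p"
    using assms(1) by (simp add: powr_mult)
qed

lemma abs_diff_le_sum_increments:
  fixes u :: "nat \<Rightarrow> real"
  assumes "a \<le> b"
  shows "\<bar>u b - u a\<bar> \<le> (\<Sum>l=a..<b. \<bar>u (Suc l) - u l\<bar>)"
proof -
  have "u b - u a = (\<Sum>l=a..<b. u (Suc l) - u l)" using assms by (simp add: sum_Suc_diff')
  thus ?thesis by (metis sum_abs)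
qed

lemma interval_chain_le:
  assumes "interval_chain n k s t" "i < j" "j < k"
  shows "t i \<le> s j"
  using assms(2,3)
proof (induction j)
  case 0
  then show ?case by simp
next
  case (Suc j)
  have "t j \<le> s (Suc j)" using assms(1) Suc.prems by (auto simp: interval_chain_def)
  moreover have "i = j \<or> t i \<le> s j" using Suc by (cases "i = j") auto
  moreover have "s j \<le> t j" using assms(1) Suc.prems by (auto simp: interval_chain_def)
  ultimately show ?case by auto
qed

lemma sum_chain_le:
  fixes d :: "nat \<Rightarrow> real"
  assumes c: "interval_chain n k s t" and d: "\<And>l. 0 \<le> d l" and B: "finite B"
  shows "(\<Sum>i<k. \<Sum>l\<in>{s i..<t i} \<inter> B. d l) \<le> (\<Sum>l\<in>B. d l)"
proof -
  have "(\<Sum>i<k. \<Sum>l\<in>{s i..<t i} \<inter> B. d l) = (\<Sum>l\<in>(\<Union>i<k. {s i..<t i} \<inter> B). d l)"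
  proof (intro sum.UNION_disjoint[symmetric] ballI impI)
    fix i j assume "i \<in> {..<k}" "j \<in> {..<k}" "i \<noteq> j"
    hence "t i \<le> s j \<or> t j \<le> s i" using interval_chain_le[OF c] by (metis lessThan_iff linorder_neqE_nat)
    thus "({s i..<t i} \<inter> B) \<inter> ({s j..<t j} \<inter> B) = {}" by auto
  qed auto
  also have "\<dots> \<le> (\<Sum>l\<in>B. d l)" using B d by (intro sum_mono2) auto
  finally show ?thesis .
qed

lemma pvar_le_total_variation:
  assumes "1 \<le> p"
  shows "pvar_le p u n (\<Sum>l<n. \<bar>u (Suc l) - u l\<bar>)"
proof (rule pvar_leI)
  fix k s t assume c: "interval_chain n k s t"
  have "(\<Sum>i<k. \<bar>u (t i) - u (s i)\<bar> powr p) \<le> (\<Sum>i<k. \<bar>u (t i) - u (s i)\<bar>) powr p"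
    using assms by (intro sum_powr_le_powr_sum) auto
  also have "\<dots> \<le> (\<Sum>l<n. \<bar>u (Suc l) - u l\<bar>) powr p"
  proof (intro powr_mono2 sum_nonneg)
    have "(\<Sum>i<k. \<bar>u (t i) - u (s i)\<bar>) \<le> (\<Sum>i<k. \<Sum>l=s i..<t i. \<bar>u (Suc l) - u l\<bar>)"
      using c by (intro sum_mono abs_diff_le_sum_increments) (auto simp: interval_chain_def)
    also have "\<dots> = (\<Sum>i<k. \<Sum>l\<in>{s i..<t i} \<inter> {..<n}. \<bar>u (Suc l) - u l\<bar>)"
      using c by (intro sum.cong) (fastforce simp: interval_chain_def)+
    also have "\<dots> \<le> (\<Sum>l<n. \<bar>u (Suc l) - u l\<bar>)" using c by (intro sum_chain_le) auto
    finally show "(\<Sum>i<k. \<bar>u (t i) - u (s i)\<bar>) \<le> (\<Sum>l<n. \<bar>u (Suc l) - u l\<bar>)" .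
  qed (use assms in auto)
  finally show "(\<Sum>i<k. \<bar>u (t i) - u (s i)\<bar> powr p) \<le> (\<Sum>l<n. \<bar>u (Suc l) - u l\<bar>) powr p" .
qed

lemma pvar_le_exponent_mono:
  assumes "pvar_le q u n R" "0 < q" "q \<le> p" "0 \<le> R"
  shows "pvar_le p u n R"
proof (rule pvar_leI)
  fix k s t assume c: "interval_chain n k s t"
  have "(\<Sum>i<k. \<bar>u (t i) - u (s i)\<bar> powr p) = (\<Sum>i<k. (\<bar>u (t i) - u (s i)\<bar> powr q) powr (p/q))"
    using assms by (simp add: powr_powr)
  also have "\<dots> \<le> (\<Sum>i<k. \<bar>u (t i) - u (s i)\<bar> powr q) powr (p/q)"
    using assms by (intro sum_powr_le_powr_sum) auto
  also have "\<dots> \<le> (R powr q) powr (p/q)"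
    using pvar_leD[OF assms(1) c] assms by (intro powr_mono2 sum_nonneg) auto
  finally show "(\<Sum>i<k. \<bar>u (t i) - u (s i)\<bar> powr p) \<le> R powr p"
    using assms by (simp add: powr_powr)
qed

definition block_of :: "(nat \<Rightarrow> nat) \<Rightarrow> nat \<Rightarrow> nat" where
  "block_of e a = (LEAST j. a < e (Suc j))"

lemma
  assumes "strict_mono e" "e 0 = 0"
  shows block_of_upper: "a < e (Suc (block_of e a))"
    and block_of_lower: "e (block_of e a) \<le> a"
    and block_of_mono: "a \<le> b \<Longrightarrow> block_of e a \<le> block_of e b"
    and block_of_le: "a < e (Suc M) \<Longrightarrow> block_of e a \<le> M"
proof -
  have up: "a < e (Suc (block_of e a))" for a
    unfolding block_of_def
    by (rule LeastI[of _ a]) (metis assms(1) strict_mono_imp_increasing Suc_le_eq)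
  have least: "a < e (Suc M) \<Longrightarrow> block_of e a \<le> M" for a M
    unfolding block_of_def by (rule Least_le)
  show "a < e (Suc (block_of e a))" by (rule up)
  show "a < e (Suc M) \<Longrightarrow> block_of e a \<le> M" by (rule least)
  show "a \<le> b \<Longrightarrow> block_of e a \<le> block_of e b" using up[of b] by (intro least) auto
  show "e (block_of e a) \<le> a"
  proof (cases "block_of e a")
    case 0
    thus ?thesis using assms(2) by simp
  next
    case (Suc j)
    hence "\<not> a < e (Suc j)" using least[of a j] by auto
    thus ?thesis using Suc by simp
  qed
qed

text \<open>An interval that meets several blocks consists of a piece at the end of its first block, a
piece at the beginning of its last block, and a middle part between end points of blocks. The
middle parts form a chain for the coarse path. The other pieces are disjoint, and since powers are superadditive
those in one block contribute at most the power of its total variation.\<close>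

lemma pvar_le_coarsen:
  fixes u :: "nat \<Rightarrow> real"
  assumes p: "1 \<le> p" and e: "strict_mono e" "e 0 = 0" and n: "n < e (Suc M)"
    and coarse: "pvar_le p (\<lambda>j. u (e j)) M R"
    and fine: "(\<Sum>j\<le>M. (\<Sum>l=e j..<e (Suc j). \<bar>u (Suc l) - u l\<bar>) powr p) \<le> S powr p"
    and nn: "0 \<le> R" "0 \<le> S"
  shows "pvar_le p u n (R + 2 * S)"
proof (rule pvar_leI)
  fix k s t assume c: "interval_chain n k s t"
  have st: "s i \<le> t i" "t i \<le> n" "s i \<le> n" if "i < k" for i
    using c that by (auto simp: interval_chain_def dest: le_trans)
  define b where "b = block_of e"
  define d where "d l = \<bar>u (Suc l) - u l\<bar>" for l
  have d: "0 \<le> d l" for l by (simp add: d_def)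
  have diff: "\<bar>u y - u x\<bar> \<le> (\<Sum>l=x..<y. d l)" if "x \<le> y" for x y
    using abs_diff_le_sum_increments[OF that] by (simp add: d_def)
  have bu: "a < e (Suc (b a))" and bl: "e (b a) \<le> a" for a
    using block_of_upper[OF e] block_of_lower[OF e] by (auto simp: b_def)
  have bm: "b x \<le> b y" if "x \<le> y" for x y using block_of_mono[OF e that] by (simp add: b_def)
  have bM: "b x \<le> M" if "x \<le> n" for x using block_of_le[OF e] n that by (auto simp: b_def)
  define s' where "s' i = min (Suc (b (s i))) (b (t i))" for i
  define t' where "t' i = b (t i)" for i
  have c': "interval_chain M k s' t'"
    unfolding interval_chain_def
  proof (intro conjI allI impI)
    fix i assume "i < k"
    thus "s' i \<le> t' i" "t' i \<le> M" using st bM by (auto simp: s'_def t'_def)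
  next
    fix i assume i: "Suc i < k"
    hence "t i \<le> s (Suc i)" using c by (auto simp: interval_chain_def)
    hence "b (t i) \<le> b (s (Suc i))" "b (t i) \<le> b (t (Suc i))" using st[OF i] by (auto intro!: bm)
    thus "t' i \<le> s' (Suc i)" by (auto simp: s'_def t'_def)
  qed
  define z where "z i j = (\<Sum>l\<in>{s i..<t i} \<inter> {e j..<e (Suc j)}. d l)" for i j
  have z: "0 \<le> z i j" for i j by (auto simp: z_def d intro: sum_nonneg)
  define x where "x i = z i (b (s i)) + (if b (s i) = b (t i) then 0 else z i (b (t i)))" for i
  have x: "0 \<le> x i" for i using z by (auto simp: x_def)
  have incr: "\<bar>u (t i) - u (s i)\<bar> \<le> \<bar>u (e (t' i)) - u (e (s' i))\<bar> + x i" if i: "i < k" for i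
  proof (cases "b (s i) = b (t i)")
    case True
    have "{s i..<t i} \<inter> {e (b (s i))..<e (Suc (b (s i)))} = {s i..<t i}"
      using bl[of "s i"] bu[of "t i"] True by auto
    thus ?thesis using diff[OF st(1)[OF i]] True by (auto simp: x_def z_def s'_def t'_def)
  next
    case False
    hence less: "b (s i) < b (t i)" using bm[OF st(1)[OF i]] by auto
    have e_le: "e (Suc (b (s i))) \<le> e (b (t i))" using less e(1) by (simp add: strict_mono_less_eq)
    have 1: "{s i..<t i} \<inter> {e (b (s i))..<e (Suc (b (s i)))} = {s i..<e (Suc (b (s i)))}"
      using bl[of "s i"] bl[of "t i"] e_le by auto
    have 2: "{s i..<t i} \<inter> {e (b (t i))..<e (Suc (b (t i)))} = {e (b (t i))..<t i}"
      using bu[of "s i"] bu[of "t i"] e_le by auto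
    have "\<bar>u (e (Suc (b (s i)))) - u (s i)\<bar> \<le> z i (b (s i))"
      using diff[of "s i" "e (Suc (b (s i)))"] bu[of "s i"] by (simp only: z_def 1 less_imp_le)
    moreover have "\<bar>u (t i) - u (e (b (t i)))\<bar> \<le> z i (b (t i))"
      using diff[of "e (b (t i))" "t i"] bl[of "t i"] by (simp only: z_def 2)
    ultimately show ?thesis using False less by (auto simp: x_def s'_def t'_def min_def)
  qed
  have "(\<Sum>i<k. x i powr p) \<le> (2 * S) powr p"
  proof -
    have "(\<Sum>i<k. x i powr p) \<le> (\<Sum>i<k. 2 powr (p - 1) * (\<Sum>j\<le>M. z i j powr p))"
    proof (rule sum_mono)
      fix i assume i: "i \<in> {..<k}"
      have "x i powr p \<le> 2 powr (p - 1) * (z i (b (s i)) powr p + (if b (s i) = b (t i) then 0 else z i (b (t i))) powr p)"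
        unfolding x_def using p z by (intro powr_add_le) auto
      also have "z i (b (s i)) powr p + (if b (s i) = b (t i) then 0 else z i (b (t i))) powr p
          = (\<Sum>j\<in>{b (s i), b (t i)}. z i j powr p)"
        by auto
      also have "\<dots> \<le> (\<Sum>j\<le>M. z i j powr p)" using i st bM by (intro sum_mono2) auto
      finally show "x i powr p \<le> 2 powr (p - 1) * (\<Sum>j\<le>M. z i j powr p)" by simp
    qed
    also have "\<dots> = 2 powr (p - 1) * (\<Sum>j\<le>M. \<Sum>i<k. z i j powr p)"
      by (subst sum.swap) (simp add: sum_distrib_left)
    also have "\<dots> \<le> 2 powr (p - 1) * (\<Sum>j\<le>M. (\<Sum>l=e j..<e (Suc j). d l) powr p)"
    proof (intro mult_left_mono sum_mono)
      fix j
      have "(\<Sum>i<k. z i j powr p) \<le> (\<Sum>i<k. z i j) powr p"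
        using p z by (intro sum_powr_le_powr_sum) auto
      also have "\<dots> \<le> (\<Sum>l=e j..<e (Suc j). d l) powr p"
        using p z sum_chain_le[OF c d, of "{e j..<e (Suc j)}"] by (intro powr_mono2) (auto simp: z_def intro!: sum_nonneg d)
      finally show "(\<Sum>i<k. z i j powr p) \<le> (\<Sum>l=e j..<e (Suc j). d l) powr p" .
    qed auto
    also have "\<dots> \<le> 2 powr (p - 1) * S powr p" using fine by (simp add: d_def)
    also have "\<dots> \<le> 2 powr p * S powr p" by (intro mult_right_mono powr_mono) auto
    finally show ?thesis using nn by (simp add: powr_mult)
  qed
  hence "(\<Sum>i<k. (\<bar>u (e (t' i)) - u (e (s' i))\<bar> + x i) powr p) \<le> (R + 2 * S) powr p"
    using p x nn pvar_leD[OF coarse c'] by (intro minkowski_powr_sum) auto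
  moreover have "(\<Sum>i<k. \<bar>u (t i) - u (s i)\<bar> powr p) \<le> (\<Sum>i<k. (\<bar>u (e (t' i)) - u (e (s' i))\<bar> + x i) powr p)"
    using incr p by (intro sum_mono powr_mono2) auto
  ultimately show "(\<Sum>i<k. \<bar>u (t i) - u (s i)\<bar> powr p) \<le> (R + 2 * S) powr p" by linarith
qed

text \<open>Coarsening into blocks of length two, repeatedly, until one block covers all of the first \<open>n\<close> steps.\<close>

lemma pvar_le_dyadic:
  fixes u :: "nat \<Rightarrow> real"
  assumes p: "1 \<le> p" and "n < 2 ^ M"
  shows "pvar_le p u n (4 * (\<Sum>m<M. (\<Sum>i\<le>Suc (n div 2 ^ m). \<bar>u (2 ^ m * Suc i) - u (2 ^ m * i)\<bar> powr p) powr (1/p)))"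
  using assms(2)
proof (induction M arbitrary: u n)
  case 0
  have "(\<Sum>i<k. \<bar>u (t i) - u (s i)\<bar> powr p) = 0" if "interval_chain n k s t" for k s t
    using that 0 by (intro sum.neutral) (auto simp: interval_chain_def)
  thus ?case by (simp add: pvar_le_def)
next
  case (Suc M)
  define E where "E m = (\<Sum>i\<le>Suc (n div 2 ^ m). \<bar>u (2 ^ m * Suc i) - u (2 ^ m * i)\<bar> powr p) powr (1/p)" for m
  have E: "0 \<le> E m" for m by (simp add: E_def)
  define N where "N = n div 2"
  have "N < 2 ^ M" using Suc.prems by (simp add: N_def)
  from Suc.IH[OF this, of "\<lambda>j. u (2 * j)"]
  have "pvar_le p (\<lambda>j. u (2 * j)) N (4 * (\<Sum>m<M. E (Suc m)))"
    by (simp add: E_def N_def mult.assoc div_mult2_eq)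
  moreover have "(\<Sum>j\<le>N. (\<Sum>l=2 * j..<2 * Suc j. \<bar>u (Suc l) - u l\<bar>) powr p) \<le> (2 * E 0) powr p"
  proof -
    define d where "d l = \<bar>u (Suc l) - u l\<bar> powr p" for l
    have "(\<Sum>j\<le>N. (\<Sum>l=2 * j..<2 * Suc j. \<bar>u (Suc l) - u l\<bar>) powr p) \<le> (\<Sum>j\<le>N. 2 powr (p - 1) * (d (2 * j) + d (Suc (2 * j))))"
    proof (rule sum_mono)
      fix j
      have "{2 * j..<2 * Suc j} = {2 * j, Suc (2 * j)}" by auto
      thus "(\<Sum>l=2 * j..<2 * Suc j. \<bar>u (Suc l) - u l\<bar>) powr p \<le> 2 powr (p - 1) * (d (2 * j) + d (Suc (2 * j)))"
        using powr_add_le[OF p] by (simp add: d_def)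
    qed
    also have "\<dots> = 2 powr (p - 1) * (\<Sum>l\<le>Suc (2 * N). d l)"
    proof -
      have "(\<Sum>j\<le>N. d (2 * j) + d (Suc (2 * j))) = (\<Sum>l\<le>Suc (2 * N). d l)"
        by (induction N) (auto simp: algebra_simps)
      thus ?thesis by (simp flip: sum_distrib_left)
    qed
    also have "\<dots> \<le> 2 powr p * (\<Sum>l\<le>Suc n. d l)"
      by (intro mult_mono powr_mono sum_mono2) (auto simp: N_def d_def intro!: sum_nonneg add_nonneg_nonneg)
    also have "\<dots> = (2 * E 0) powr p"
      using p sum_nonneg[of "{..Suc n}" d] by (simp add: E_def d_def powr_mult powr_powr)
    finally show ?thesis .
  qed
  ultimately have "pvar_le p u n (4 * (\<Sum>m<M. E (Suc m)) + 2 * (2 * E 0))"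
    using p E by (intro pvar_le_coarsen[where e = "\<lambda>j. 2 * j" and M = N])
      (auto simp: strict_mono_def N_def intro!: sum_nonneg)
  also have "4 * (\<Sum>m<M. E (Suc m)) + 2 * (2 * E 0) = 4 * (\<Sum>m<Suc M. E m)"
    by (subst sum.lessThan_Suc_shift) simp
  finally show ?case by (simp add: E_def)
qed

lemma pvar_le_shift:
  assumes "pvar_le p u (Suc n) R"
  shows "pvar_le p (\<lambda>l. u (Suc l) - d) n R"
proof (rule pvar_leI)
  fix k s t assume "interval_chain n k s t"
  hence "interval_chain (Suc n) k (\<lambda>i. Suc (s i)) (\<lambda>i. Suc (t i))" by (auto simp: interval_chain_def)
  from pvar_leD[OF assms this]
  show "(\<Sum>i<k. \<bar>u (Suc (t i)) - d - (u (Suc (s i)) - d)\<bar> powr p) \<le> R powr p" by simp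
qed

lemma pvar_le_single:
  assumes "pvar_le p u n R" "s \<le> t" "t \<le> n" "0 < p" "0 \<le> R"
  shows "\<bar>u t - u s\<bar> \<le> R"
proof -
  have "interval_chain n 1 (\<lambda>_. s) (\<lambda>_. t)" using assms by (auto simp: interval_chain_def)
  from pvar_leD[OF assms(1) this] have "\<bar>u t - u s\<bar> powr p \<le> R powr p" by simp
  thus ?thesis using assms(4,5) powr_less_mono2[of p R "\<bar>u t - u s\<bar>"] by linarith
qed

lemma pvar_le_unit_steps:
  assumes "pvar_le p u (Suc n) R"
  shows "(\<Sum>j\<le>n. \<bar>u (Suc j) - u j\<bar> powr p) \<le> R powr p"
proof -
  have "interval_chain (Suc n) (Suc n) (\<lambda>j. j) Suc" by (auto simp: interval_chain_def)
  from pvar_leD[OF assms this] show ?thesis by (simp add: lessThan_Suc_atMost)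
qed

section \<open>Boundedness in probability\<close>

lemma sum_powr_geometric_le:
  fixes \<delta> :: real
  assumes "0 < \<delta>"
  shows "(\<Sum>k\<le>K. 2 powr (real k * \<delta>)) \<le> 2 powr (real K * \<delta>) / (1 - 2 powr (- \<delta>))"
proof -
  have lt: "2 powr (- \<delta>) < 1" using assms by (simp add: powr_less_one)
  have "(\<Sum>k\<le>K. 2 powr (real k * \<delta>)) * (1 - 2 powr (- \<delta>)) \<le> 2 powr (real K * \<delta>)"
  proof (induction K)
    case 0
    show ?case by simp
  next
    case (Suc K)
    have "2 powr (real (Suc K) * \<delta>) * 2 powr (- \<delta>) = 2 powr (real K * \<delta>)"
      by (simp add: powr_add[symmetric] algebra_simps)
    with Suc show ?case by (simp add: algebra_simps)
  qed
  thus ?thesis using lt by (simp add: pos_le_divide_eq)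
qed

lemma suminf_tail_geometric_le:
  fixes \<delta> C :: real
  assumes "0 < \<delta>" "\<And>k. 0 \<le> m k" "\<And>k. m k \<le> C * 2 powr (- (real k * \<delta>))"
  shows "summable m" "suminf m - (\<Sum>k\<le>K. m k) \<le> C * 2 powr (- (real (Suc K) * \<delta>)) / (1 - 2 powr (- \<delta>))"
    "(\<Sum>k\<le>K. m k) \<le> suminf m"
proof -
  define r where "r = 2 powr (- \<delta>)"
  have r: "0 < r" "r < 1" using assms by (auto simp: r_def powr_less_one)
  have rk: "2 powr (- (real k * \<delta>)) = r ^ k" for k
    by (simp add: r_def powr_powr mult.commute flip: powr_realpow)
  have geo: "summable (\<lambda>k. C * r ^ k)" using r by (intro summable_mult summable_geometric) auto
  show sm: "summable m" using assms rk by (intro summable_comparison_test'[OF geo, of 0]) auto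
  have split: "suminf m = (\<Sum>k. m (k + Suc K)) + (\<Sum>k\<le>K. m k)"
    using suminf_split_initial_segment[OF sm, of "Suc K"] by (simp add: lessThan_Suc_atMost)
  have "(\<Sum>k. m (k + Suc K)) \<le> (\<Sum>k. C * r ^ Suc K * r ^ k)"
  proof (rule suminf_le)
    show "m (n + Suc K) \<le> C * r ^ Suc K * r ^ n" for n
      using assms(3)[of "n + Suc K"] by (simp only: rk) (simp add: power_add mult_ac)
    show "summable (\<lambda>k. m (k + Suc K))" using sm by (rule summable_ignore_initial_segment)
    show "summable (\<lambda>k. C * r ^ Suc K * r ^ k)" using r by (intro summable_mult summable_geometric) auto
  qed
  also have "\<dots> = C * r ^ Suc K / (1 - r)" using r by (subst suminf_mult) (auto simp: suminf_geometric summable_geometric)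
  finally show "suminf m - (\<Sum>k\<le>K. m k) \<le> C * 2 powr (- (real (Suc K) * \<delta>)) / (1 - 2 powr (- \<delta>))"
    using split unfolding rk r_def[symmetric] by linarith
  have "0 \<le> (\<Sum>k. m (k + Suc K))" 
    using summable_ignore_initial_segment[OF sm, of "Suc K"] assms by (intro suminf_nonneg) auto
  thus "(\<Sum>k\<le>K. m k) \<le> suminf m" using split by linarith
qed

text \<open>The random quantities of which \<open>R\<close> is an upper bound in the sense of \<open>\<Phi>\<close> are bounded in
probability, uniformly in \<open>n\<close>. Exceptional sets are used because \<open>\<Phi>\<close> need not be measurable.\<close>

definition bounded_in_prob :: "'a measure \<Rightarrow> (nat \<Rightarrow> 'a \<Rightarrow> real \<Rightarrow> bool) \<Rightarrow> bool" where
  "bounded_in_prob M \<Phi> \<longleftrightarrow>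
     (\<forall>\<epsilon>>0. \<exists>R>0. \<forall>n\<ge>1. \<exists>A\<in>sets M. measure M A \<le> \<epsilon> \<and> (\<forall>y\<in>space M - A. \<Phi> n y R))"

text \<open>If it failed, there would be sets of summable \<open>M\<close>-measure with \<open>P\<close>-measure above
\<open>\<epsilon>\<close>. By Borel and Cantelli their upper limit is a null set of \<open>M\<close>, but it has \<open>P\<close>-measure at least \<open>\<epsilon>\<close>.\<close>

lemma abs_cont_small:
  assumes M: "finite_measure M" and P: "finite_measure P" and sets: "sets P = sets M"
    and ac: "absolutely_continuous M P" and e: "0 < (\<epsilon>::real)"
  obtains \<delta> where "0 < \<delta>" "\<And>A. A \<in> sets M \<Longrightarrow> measure M A \<le> \<delta> \<Longrightarrow> measure P A \<le> \<epsilon>"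
proof (rule ccontr)
  interpret M: finite_measure M by fact
  interpret P: finite_measure P by fact
  assume "\<not> thesis"
  have ex: "\<exists>A. A \<in> sets M \<and> measure M A \<le> (1/2) ^ n \<and> \<epsilon> < measure P A" for n
  proof (rule ccontr)
    assume "\<not> ?thesis"
    hence "measure P A \<le> \<epsilon>" if "A \<in> sets M" "measure M A \<le> (1/2) ^ n" for A
      using that by (simp add: not_less)
    moreover have "0 < (1/2 :: real) ^ n" by (rule zero_less_power) simp
    ultimately have thesis by (rule that[rotated])
    thus False using \<open>\<not> thesis\<close> by contradiction
  qed
  have "\<forall>n. \<exists>A. A \<in> sets M \<and> measure M A \<le> (1/2) ^ n \<and> \<epsilon> < measure P A" using ex by (rule allI)
  from choice[OF this] obtain A where "\<forall>n. A n \<in> sets M \<and> measure M (A n) \<le> (1/2) ^ n \<and> \<epsilon> < measure P (A n)" ..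
  hence A: "\<And>n. A n \<in> sets M" "\<And>n. measure M (A n) \<le> (1/2) ^ n" "\<And>n. \<epsilon> < measure P (A n)"
    by simp_all
  have "summable (\<lambda>n. measure M (A n))"
    using A(2) by (intro summable_comparison_test'[OF summable_geometric[of "1/2"], of 0]) auto
  hence "limsup A \<in> null_sets M"
    using A(1) by (intro borel_cantelli_limsup1) (auto simp: M.emeasure_eq_measure)
  hence null: "limsup A \<in> null_sets P" using ac by (auto simp: absolutely_continuous_def)
  define B where "B n = (\<Union>k\<in>{n..}. A k)" for n
  have B: "B n \<in> sets P" for n using A(1) sets by (auto simp: B_def)
  have "decseq B" unfolding decseq_def B_def by (intro allI impI UN_mono) auto
  hence lim: "(\<lambda>n. measure P (B n)) \<longlonglongrightarrow> measure P (\<Inter>n. B n)"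
    using B by (intro P.finite_Lim_measure_decseq) auto
  have "\<epsilon> \<le> measure P (B n)" for n
  proof -
    have "measure P (A n) \<le> measure P (B n)" using B by (intro P.finite_measure_mono) (auto simp: B_def)
    thus ?thesis using A(3)[of n] by linarith
  qed
  hence "\<epsilon> \<le> measure P (\<Inter>n. B n)" by (intro LIMSEQ_le_const[OF lim]) auto
  moreover have "(\<Inter>n. B n) = limsup A" by (simp add: limsup_INF_SUP B_def)
  ultimately show False using null e by (simp add: measure_eq_0_null_sets)
qed

lemma bounded_in_prob_abs_cont:
  assumes "finite_measure M" "finite_measure P" and sets: "sets P = sets M"
    and "absolutely_continuous M P" and b: "bounded_in_prob M \<Phi>"
  shows "bounded_in_prob P \<Phi>"
  unfolding bounded_in_prob_def
proof (intro allI impI)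
  fix \<epsilon> :: real assume "0 < \<epsilon>"
  obtain \<delta> where \<delta>: "0 < \<delta>" "\<And>A. A \<in> sets M \<Longrightarrow> measure M A \<le> \<delta> \<Longrightarrow> measure P A \<le> \<epsilon>"
    using abs_cont_small[OF assms(1-4) \<open>0 < \<epsilon>\<close>] by blast
  show "\<exists>R>0. \<forall>n\<ge>1. \<exists>A\<in>sets P. measure P A \<le> \<epsilon> \<and> (\<forall>y\<in>space P - A. \<Phi> n y R)"
  proof -
    obtain R where R: "R > 0" "\<And>n. n \<ge> 1 \<Longrightarrow> \<exists>A\<in>sets M. measure M A \<le> \<delta> \<and> (\<forall>y\<in>space M - A. \<Phi> n y R)"
      using b \<delta>(1) unfolding bounded_in_prob_def by blast
    show ?thesis
    proof (intro exI[of _ R] conjI allI impI R(1))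
      fix n :: nat assume "1 \<le> n"
      then obtain A where A: "A \<in> sets M" "measure M A \<le> \<delta>" "\<forall>y\<in>space M - A. \<Phi> n y R"
        using R(2) by blast
      thus "\<exists>A\<in>sets P. measure P A \<le> \<epsilon> \<and> (\<forall>y\<in>space P - A. \<Phi> n y R)"
        using \<delta>(2)[OF A(1,2)] unfolding sets sets_eq_imp_space_eq[OF sets] by blast
    qed
  qed
qed

section \<open>The variation of heavy-tailed sums\<close>

context prob_space begin

lemma expectation_sqrt_le:
  fixes Z :: "'a \<Rightarrow> real"
  assumes Z: "integrable M Z" and nn: "\<And>y. 0 \<le> Z y"
  shows "integrable M (\<lambda>y. sqrt (Z y))" "expectation (\<lambda>y. sqrt (Z y)) \<le> sqrt (expectation Z)"
proof -
  have [measurable]: "Z \<in> borel_measurable M" using Z by simp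
  have "sqrt x \<le> 1 + x" if "0 \<le> x" for x :: real
    using that by (intro real_le_lsqrt) (auto simp: power2_eq_square algebra_simps)
  thus int: "integrable M (\<lambda>y. sqrt (Z y))"
    using nn Z by (intro Bochner_Integration.integrable_bound[of M "\<lambda>y. 1 + Z y" "\<lambda>y. sqrt (Z y)"]) auto
  have sq: "(\<lambda>y. (sqrt (Z y))\<^sup>2) = Z" using nn by auto
  have "0 \<le> variance (\<lambda>y. sqrt (Z y))" by (rule variance_positive)
  also have "variance (\<lambda>y. sqrt (Z y)) = expectation Z - (expectation (\<lambda>y. sqrt (Z y)))\<^sup>2"
    using variance_eq[of "\<lambda>y. sqrt (Z y)"] int Z by (simp add: sq)
  finally show "expectation (\<lambda>y. sqrt (Z y)) \<le> sqrt (expectation Z)"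
    by (intro real_le_rsqrt) simp
qed

lemma expectation_power_mean_le:
  fixes D :: "'i \<Rightarrow> 'a \<Rightarrow> real"
  assumes S: "finite S" and int: "\<And>i. i \<in> S \<Longrightarrow> integrable M (\<lambda>y. (D i y)\<^sup>2)"
    and le: "\<And>i. i \<in> S \<Longrightarrow> expectation (\<lambda>y. (D i y)\<^sup>2) \<le> \<sigma>\<^sup>2" and \<sigma>: "0 \<le> \<sigma>"
    and p: "0 < p"
  defines "Y \<equiv> (\<lambda>y. real (card S) powr (1/p - 1/2) * sqrt (\<Sum>i\<in>S. (D i y)\<^sup>2))"
  shows "integrable M Y" "expectation Y \<le> real (card S) powr (1/p) * \<sigma>"
proof -
  have i: "integrable M (\<lambda>y. \<Sum>i\<in>S. (D i y)\<^sup>2)" using int by auto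
  note * = expectation_sqrt_le[OF i sum_nonneg[OF zero_le_power2]]
  show "integrable M Y" unfolding Y_def using * by (auto intro!: sum_nonneg)
  have "expectation Y = real (card S) powr (1/p - 1/2) * expectation (\<lambda>y. sqrt (\<Sum>i\<in>S. (D i y)\<^sup>2))"
    by (simp add: Y_def)
  also have "\<dots> \<le> real (card S) powr (1/p - 1/2) * sqrt (expectation (\<lambda>y. \<Sum>i\<in>S. (D i y)\<^sup>2))"
    using *(2) by (intro mult_left_mono) (auto intro!: sum_nonneg)
  also have "\<dots> \<le> real (card S) powr (1/p - 1/2) * sqrt (real (card S) * \<sigma>\<^sup>2)"
  proof -
    have "expectation (\<lambda>y. \<Sum>i\<in>S. (D i y)\<^sup>2) = (\<Sum>i\<in>S. expectation (\<lambda>y. (D i y)\<^sup>2))"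
      using int by (intro Bochner_Integration.integral_sum) auto
    also have "\<dots> \<le> real (card S) * \<sigma>\<^sup>2" using sum_bounded_above[of S "\<lambda>i. expectation (\<lambda>y. (D i y)\<^sup>2)", OF le] by simp
    finally show ?thesis by (intro mult_left_mono) auto
  qed
  also have "\<dots> = real (card S) powr (1/p) * \<sigma>"
    using \<sigma> by (cases "card S = 0") (auto simp: real_sqrt_mult powr_diff powr_half_sqrt)
  finally show "expectation Y \<le> real (card S) powr (1/p) * \<sigma>" .
qed

text \<open>Blocks of length
\<open>N0\<close> are treated by total variation. This is efficient if \<open>N0\<close> is the typical time between two
nonzero summands, when the two terms \<open>sqrt (N0 * B)\<close> and \<open>N0 * m\<close> are both
comparable to the size of one summand. Above that length the dyadic levels have expectations that
decay like \<open>(2 powr (1/2 - 1/p)) ^ i\<close>.\<close>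

lemma pvar_expectation_one_scale:
  fixes X :: "nat \<Rightarrow> 'a \<Rightarrow> real"
  assumes p: "1 \<le> p" "p < 2"
    and X_meas [measurable]: "\<And>j. X j \<in> borel_measurable M"
    and X0: "\<And>j y. 0 \<le> X j y"
    and m: "0 \<le> m" and B: "0 \<le> B"
    and int: "\<And>s N. integrable M (\<lambda>y. ((\<Sum>j=s..<s+N. X j y) - real N * m)\<^sup>2)"
    and var: "\<And>s N. expectation (\<lambda>y. ((\<Sum>j=s..<s+N. X j y) - real N * m)\<^sup>2) \<le> real N * B"
    and N0: "1 \<le> N0" "N0 \<le> n"
  shows "\<exists>Y. integrable M Y \<and> (\<forall>y. 0 \<le> Y y) \<and>
      expectation Y \<le> (12 + 12 / (1 - 2 powr (1/2 - 1/p))) * (real n / real N0) powr (1/p) * (sqrt (real N0 * B) + real N0 * m) \<and>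
      (\<forall>y. pvar_le p (\<lambda>l. (\<Sum>j<l. X j y) - real l * m) n (Y y))"
proof -
  define u where "u y l = (\<Sum>j<l. X j y) - real l * m" for y l
  define s0 where "s0 = sqrt (real N0 * B) + real N0 * m"
  have s0: "0 \<le> s0" using m B by (simp add: s0_def)
  define n' where "n' = n div N0"
  have n': "1 \<le> n'" using N0 by (simp add: n'_def div_greater_zero_iff Suc_le_eq)
  have n'_le: "real n' \<le> real n / real N0" unfolding n'_def by (rule of_nat_div_le_of_nat)
  obtain M0 where M0: "2 ^ M0 \<le> n'" "n' < 2 ^ (M0 + 1)"
    using ex_power_ivl1[of 2 n'] n' by auto
  have u_incr: "u y (a + N) - u y a = (\<Sum>j=a..<a+N. X j y) - real N * m" for y a N
  proof -
    have "(\<Sum>j<a + N. X j y) = (\<Sum>j<a. X j y) + (\<Sum>j=a..<a+N. X j y)"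
      using sum.atLeastLessThan_concat[of 0 a "a+N" "\<lambda>j. X j y"] by (simp add: lessThan_atLeast0)
    thus ?thesis by (simp add: u_def algebra_simps)
  qed
  \<comment> \<open>level \<open>i\<close> has blocks of length \<open>N0 * 2 ^ i\<close>\<close>
  define S where "S i = {..Suc (n' div 2 ^ i)}" for i
  define D where "D i a y = u y (N0 * (2 ^ i * Suc a)) - u y (N0 * (2 ^ i * a))" for i a y
  define Y1 where "Y1 i y = real (card (S i)) powr (1/p - 1/2) * sqrt (\<Sum>a\<in>S i. (D i a y)\<^sup>2)" for i y
  have D_eq: "D i a y = (\<Sum>j=N0 * (2 ^ i * a)..<N0 * (2 ^ i * a) + N0 * 2 ^ i. X j y) - real (N0 * 2 ^ i) * m" for i a y
    using u_incr[of y "N0 * (2 ^ i * a)" "N0 * 2 ^ i"] by (simp add: D_def algebra_simps)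
  have Y1: "integrable M (Y1 i)" "expectation (Y1 i) \<le> real (card (S i)) powr (1/p) * sqrt (real (N0 * 2 ^ i) * B)" for i
  proof -
    have le: "expectation (\<lambda>y. (D i a y)\<^sup>2) \<le> (sqrt (real (N0 * 2 ^ i) * B))\<^sup>2" for a
      using var[of "N0 * (2 ^ i * a)" "N0 * 2 ^ i"] B by (simp add: D_eq)
    have "integrable M (\<lambda>y. (D i a y)\<^sup>2)" for a
      using int[of "N0 * (2 ^ i * a)" "N0 * 2 ^ i"] by (simp add: D_eq)
    note * = expectation_power_mean_le[of "S i" "D i", OF _ this le]
    show "integrable M (Y1 i)" "expectation (Y1 i) \<le> real (card (S i)) powr (1/p) * sqrt (real (N0 * 2 ^ i) * B)"
      unfolding Y1_def using B p by (intro *; simp add: S_def)+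
  qed
  have Y1_bound: "expectation (Y1 i) \<le> 3 * (real n / real N0) powr (1/p) * s0 * (2 powr (1/2 - 1/p)) ^ i" if i: "i \<le> M0" for i
  proof -
    have "(2::nat) ^ i \<le> n'" using i M0(1) by (meson le_trans one_le_numeral power_increasing)
    hence ge1: "1 \<le> real n' / 2 ^ i" by simp
    have "real (card (S i)) = real (n' div 2 ^ i) + 2" by (simp add: S_def)
    also have "real (n' div 2 ^ i) \<le> real n' / 2 ^ i" using of_nat_div_le_of_nat[of n' "2 ^ i"] by simp
    also have "real n' / 2 ^ i + 2 \<le> 3 * (real n' / 2 ^ i)" using ge1 by linarith
    also have "\<dots> \<le> 3 * (real n / real N0 / 2 ^ i)" by (intro mult_left_mono divide_right_mono n'_le) auto
    finally have "real (card (S i)) powr (1/p) \<le> (3 * (real n / real N0 / 2 ^ i)) powr (1/p)"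
      using p by (intro powr_mono2) auto
    also have "\<dots> = 3 powr (1/p) * ((real n / real N0) powr (1/p) * 2 powr (- (1/p) * real i))"
      by (simp add: powr_mult powr_divide powr_minus powr_powr divide_simps mult.commute flip: powr_realpow)
    also have "\<dots> \<le> 3 powr 1 * ((real n / real N0) powr (1/p) * 2 powr (- (1/p) * real i))"
      using p by (intro mult_right_mono powr_mono) auto
    finally have c: "real (card (S i)) powr (1/p) \<le> 3 * ((real n / real N0) powr (1/p) * 2 powr (- (1/p) * real i))"
      by simp
    have "sqrt (real (N0 * 2 ^ i) * B) = sqrt (real N0 * B) * 2 powr (1/2 * real i)"
      by (simp add: real_sqrt_mult powr_half_sqrt[symmetric] powr_powr mult.commute flip: powr_realpow)
    also have "\<dots> \<le> s0 * 2 powr (1/2 * real i)" using m by (intro mult_right_mono) (auto simp: s0_def)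
    finally have d: "sqrt (real (N0 * 2 ^ i) * B) \<le> s0 * 2 powr (1/2 * real i)" .
    have "expectation (Y1 i) \<le> (3 * ((real n / real N0) powr (1/p) * 2 powr (- (1/p) * real i))) * (s0 * 2 powr (1/2 * real i))"
      using Y1(2)[of i] mult_mono[OF c d] B by simp
    also have "\<dots> = 3 * (real n / real N0) powr (1/p) * s0 * (2 powr (- (1/p) * real i) * 2 powr (1/2 * real i))"
      by simp
    also have "2 powr (- (1/p) * real i) * 2 powr (1/2 * real i) = (2 powr (1/2 - 1/p)) ^ i"
      by (simp add: powr_add[symmetric] powr_powr algebra_simps flip: powr_realpow)
    finally show ?thesis .
  qed
  have Y1_ge: "(\<Sum>a\<in>S i. \<bar>D i a y\<bar> powr p) powr (1/p) \<le> Y1 i y" for i y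
  proof -
    have "(\<Sum>a\<in>S i. \<bar>D i a y\<bar> powr p) \<le> Y1 i y powr p"
      unfolding Y1_def using p by (intro sum_powr_le_power_mean) (auto simp: S_def)
    hence "(\<Sum>a\<in>S i. \<bar>D i a y\<bar> powr p) powr (1/p) \<le> (Y1 i y powr p) powr (1/p)"
      using p by (intro powr_mono2 sum_nonneg) auto
    also have "\<dots> = Y1 i y" using p by (simp add: powr_powr Y1_def sum_nonneg)
    finally show ?thesis .
  qed
  have Y1_0: "0 \<le> Y1 i y" for i y by (simp add: Y1_def sum_nonneg)
  have coarse: "pvar_le p (\<lambda>j. u y (N0 * j)) n' (4 * (\<Sum>i<Suc M0. Y1 i y))" for y
  proof -
    have 1: "pvar_le p (\<lambda>j. u y (N0 * j)) n' (4 * (\<Sum>i<Suc M0. (\<Sum>a\<in>S i. \<bar>D i a y\<bar> powr p) powr (1/p)))"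
      using pvar_le_dyadic[of p n' "Suc M0" "\<lambda>j. u y (N0 * j)"] p M0 unfolding S_def D_def by simp
    have 2: "(\<Sum>i<Suc M0. (\<Sum>a\<in>S i. \<bar>D i a y\<bar> powr p) powr (1/p)) \<le> (\<Sum>i<Suc M0. Y1 i y)"
      by (intro sum_mono Y1_ge)
    show ?thesis
    proof (rule pvar_le_mono[OF 1])
      show "0 \<le> 4 * (\<Sum>i<Suc M0. (\<Sum>a\<in>S i. \<bar>D i a y\<bar> powr p) powr (1/p))"
        by (intro mult_nonneg_nonneg sum_nonneg) auto
    qed (use 2 p in auto)
  qed
  define w where "w a y = (\<Sum>j=N0 * a..<N0 * a + N0. X j y) + real N0 * m" for a y
  define Y2 where "Y2 y = real (card {..n'}) powr (1/p - 1/2) * sqrt (\<Sum>a\<le>n'. (w a y)\<^sup>2)" for y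
  have w_le: "(w a y)\<^sup>2 \<le> 2 * ((\<Sum>j=N0 * a..<N0 * a + N0. X j y) - real N0 * m)\<^sup>2 + 8 * (real N0 * m)\<^sup>2" for a y
  proof -
    have "(x + t)\<^sup>2 \<le> 2 * (x - t)\<^sup>2 + 8 * t\<^sup>2" for x t :: real
      using zero_le_power2[of "x - 3 * t"] by (simp add: power2_eq_square algebra_simps)
    thus ?thesis by (simp add: w_def)
  qed
  have w_int: "integrable M (\<lambda>y. (w a y)\<^sup>2)" for a
  proof -
    have "(\<lambda>y. (w a y)\<^sup>2) = (\<lambda>y. ((\<Sum>j=N0 * a..<N0 * a + N0. X j y) - real N0 * m)\<^sup>2
        + 4 * (real N0 * m) * ((\<Sum>j=N0 * a..<N0 * a + N0. X j y) - real N0 * m) + 4 * (real N0 * m)\<^sup>2)"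
      by (auto simp: w_def power2_eq_square algebra_simps)
    moreover have "integrable M (\<lambda>y. (\<Sum>j=N0 * a..<N0 * a + N0. X j y) - real N0 * m)"
      using square_integrable_imp_integrable[OF _ int[of "N0 * a" N0]] X_meas by simp
    ultimately show ?thesis using int[of "N0 * a" N0] by simp
  qed
  have w_exp: "expectation (\<lambda>y. (w a y)\<^sup>2) \<le> (3 * s0)\<^sup>2" for a
  proof -
    have "expectation (\<lambda>y. (w a y)\<^sup>2) \<le> expectation (\<lambda>y. 2 * ((\<Sum>j=N0 * a..<N0 * a + N0. X j y) - real N0 * m)\<^sup>2 + 8 * (real N0 * m)\<^sup>2)"
      using w_int int[of "N0 * a" N0] w_le by (intro integral_mono) auto
    also have "\<dots> = 2 * expectation (\<lambda>y. ((\<Sum>j=N0 * a..<N0 * a + N0. X j y) - real N0 * m)\<^sup>2) + 8 * (real N0 * m)\<^sup>2"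
      using int[of "N0 * a" N0] by (simp add: prob_space)
    also have "\<dots> \<le> 2 * (real N0 * B) + 8 * (real N0 * m)\<^sup>2" using var[of "N0 * a" N0] by simp
    also have "\<dots> \<le> 9 * ((sqrt (real N0 * B))\<^sup>2 + (real N0 * m)\<^sup>2)"
      using B by simp
    also have "\<dots> \<le> (3 * s0)\<^sup>2" using B m by (simp add: s0_def power2_eq_square algebra_simps)
    finally show ?thesis .
  qed
  have Y2_0: "0 \<le> Y2 y" for y by (simp add: Y2_def sum_nonneg)
  have Y2: "integrable M Y2" "expectation Y2 \<le> 6 * (real n / real N0) powr (1/p) * s0"
  proof -
    note * = expectation_power_mean_le[of "{..n'}" w, OF _ w_int w_exp]
    show "integrable M Y2" unfolding Y2_def using s0 p by (intro *(1)) auto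
    have "real (card {..n'}) \<le> 2 * real n'" using n' by simp
    also have "\<dots> \<le> 2 * (real n / real N0)" using n'_le by simp
    finally have "real (card {..n'}) powr (1/p) \<le> (2 * (real n / real N0)) powr (1/p)"
      using p by (intro powr_mono2) auto
    also have "\<dots> = 2 powr (1/p) * (real n / real N0) powr (1/p)" by (subst powr_mult) auto
    also have "\<dots> \<le> 2 powr 1 * (real n / real N0) powr (1/p)"
      using p by (intro mult_right_mono powr_mono) auto
    finally have c: "real (card {..n'}) powr (1/p) \<le> 2 * (real n / real N0) powr (1/p)" by simp
    have "expectation Y2 \<le> real (card {..n'}) powr (1/p) * (3 * s0)"
      unfolding Y2_def using s0 p by (intro *(2)) auto
    also have "\<dots> \<le> 2 * (real n / real N0) powr (1/p) * (3 * s0)"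
      using s0 by (intro mult_right_mono c) auto
    finally show "expectation Y2 \<le> 6 * (real n / real N0) powr (1/p) * s0" by simp
  qed
  have pvar: "pvar_le p (u y) n (4 * (\<Sum>i<Suc M0. Y1 i y) + 2 * Y2 y)" for y
  proof (rule pvar_le_coarsen[where e = "\<lambda>j. N0 * j" and M = n'])
    show "strict_mono (\<lambda>j. N0 * j)" using N0 by (auto simp: strict_mono_def)
    show "n < N0 * Suc n'" using dividend_less_times_div[of N0 n] N0 by (simp add: n'_def)
    have "(\<Sum>j\<le>n'. (\<Sum>l=N0 * j..<N0 * Suc j. \<bar>u y (Suc l) - u y l\<bar>) powr p) \<le> (\<Sum>j\<le>n'. \<bar>w j y\<bar> powr p)"
    proof (intro sum_mono powr_mono2)
      fix j
      have "\<bar>u y (Suc l) - u y l\<bar> \<le> X l y + m" for l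
        using X0[of l y] m by (simp add: u_def algebra_simps abs_le_iff)
      hence "(\<Sum>l=N0 * j..<N0 * Suc j. \<bar>u y (Suc l) - u y l\<bar>) \<le> (\<Sum>l=N0 * j..<N0 * Suc j. X l y + m)"
        by (intro sum_mono)
      also have "\<dots> = w j y" by (simp add: w_def sum.distrib add.commute)
      finally show "(\<Sum>l=N0 * j..<N0 * Suc j. \<bar>u y (Suc l) - u y l\<bar>) \<le> \<bar>w j y\<bar>" by simp
    qed (use p in \<open>auto intro!: sum_nonneg\<close>)
    also have "\<dots> \<le> Y2 y powr p"
      unfolding Y2_def using p by (intro sum_powr_le_power_mean) auto
    finally show "(\<Sum>j\<le>n'. (\<Sum>l=N0 * j..<N0 * Suc j. \<bar>u y (Suc l) - u y l\<bar>) powr p) \<le> Y2 y powr p" .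
  qed (use coarse p Y1_0 Y2_0 in \<open>auto intro!: sum_nonneg add_nonneg_nonneg\<close>)
  define r where "r = 2 powr (1/2 - 1/p)"
  have r: "0 < r" "r < 1" using p by (auto simp: r_def powr_less_one field_simps)
  define A where "A = (real n / real N0) powr (1/p) * s0"
  have A: "0 \<le> A" using s0 by (simp add: A_def)
  have "expectation (\<lambda>y. 4 * (\<Sum>i<Suc M0. Y1 i y) + 2 * Y2 y) = 4 * (\<Sum>i<Suc M0. expectation (Y1 i)) + 2 * expectation Y2"
    using Y1(1) Y2(1) by (simp add: Bochner_Integration.integral_sum)
  also have "\<dots> \<le> 4 * (\<Sum>i<Suc M0. 3 * A * r ^ i) + 2 * (6 * A)"
    using Y2(2) Y1_bound by (intro add_mono mult_left_mono sum_mono) (auto simp: A_def r_def mult.assoc)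
  also have "(\<Sum>i<Suc M0. 3 * A * r ^ i) = 3 * A * (\<Sum>i<Suc M0. r ^ i)" by (simp only: sum_distrib_left)
  also have "\<dots> \<le> 3 * A * (1 / (1 - r))"
  proof (intro mult_left_mono)
    have "(\<Sum>i<Suc M0. r ^ i) = (1 - r ^ Suc M0) / (1 - r)" using r by (subst sum_gp_strict) auto
    also have "\<dots> \<le> 1 / (1 - r)" using r by (intro divide_right_mono) auto
    finally show "(\<Sum>i<Suc M0. r ^ i) \<le> 1 / (1 - r)" .
  qed (use A in auto)
  finally have E: "expectation (\<lambda>y. 4 * (\<Sum>i<Suc M0. Y1 i y) + 2 * Y2 y) \<le> (12 + 12 / (1 - r)) * A"
    by (simp add: algebra_simps)
  show ?thesis
    using Y1(1) Y2(1) Y1_0 Y2_0 E pvar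
    by (intro exI[of _ "\<lambda>y. 4 * (\<Sum>i<Suc M0. Y1 i y) + 2 * Y2 y"])
      (auto simp: A_def r_def s0_def u_def[abs_def] mult.assoc intro!: add_nonneg_nonneg sum_nonneg)
qed

text \<open>The sum is split according to \<open>2^k \<le> rt < 2^(k+1)\<close>, and each part is treated with blocks
of length about \<open>2 powr (k \<alpha>)\<close>. The scales with \<open>2 powr (k \<alpha>)\<close> above a large multiple \<open>n'\<close> of \<open>n\<close> do not occur up to time
\<open>n\<close> with high probability. Their means still occur in the drift, where they contribute at
most a multiple of \<open>n' powr (1/\<alpha>)\<close> because \<open>\<alpha> > 1\<close>.\<close>

lemma pvar_heavy_tailed_sums:
  fixes Q :: "nat \<Rightarrow> 'a \<Rightarrow> real" and rt :: "nat \<Rightarrow> 'a \<Rightarrow> nat" and m :: "nat \<Rightarrow> real" and \<alpha> p C :: real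
  assumes \<alpha>: "1 < \<alpha>" "\<alpha> < p" "p < 2" and C: "0 < C"
    and Q_meas [measurable]: "\<And>j. Q j \<in> borel_measurable M"
    and rt_meas [measurable]: "\<And>j. rt j \<in> measurable M (count_space UNIV)"
    and Q0: "\<And>j y. 0 \<le> Q j y" and rt1: "\<And>j y. 1 \<le> rt j y"
  defines "X \<equiv> (\<lambda>k j y. if 2 ^ k \<le> rt j y \<and> rt j y < 2 ^ (k + 1) then Q j y else 0)"
  assumes int: "\<And>k s N. integrable M (\<lambda>y. ((\<Sum>j=s..<s+N. X k j y) - real N * m k)\<^sup>2)"
    and var: "\<And>k s N. expectation (\<lambda>y. ((\<Sum>j=s..<s+N. X k j y) - real N * m k)\<^sup>2)
         \<le> real N * (C * 2 powr (real k * (2 - \<alpha>)))"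
    and m: "\<And>k. 0 \<le> m k" "\<And>k. m k \<le> C * 2 powr (- (real k * (\<alpha> - 1)))"
    and tail: "\<And>j N. 1 \<le> N \<Longrightarrow> prob {y\<in>space M. N \<le> rt j y} \<le> C * real N powr (- \<alpha>)"
  shows "bounded_in_prob M (\<lambda>n y R. pvar_le p (\<lambda>l. (\<Sum>j<l. Q j y) - real l * suminf m) n (R * real n powr (1/\<alpha>)))"
proof -
  define \<delta> where "\<delta> = 1 - \<alpha> / p"
  have \<delta>: "0 < \<delta>" using \<alpha> by (simp add: \<delta>_def)
  define c1 where "c1 = (12 + 12 / (1 - 2 powr (1/2 - 1/p))) * 2 * (sqrt C + C)"
  define c2 where "c2 = c1 / (1 - 2 powr (- \<delta>))"
  define c3 where "c3 = C / (1 - 2 powr (- (\<alpha> - 1)))"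
  have "2 powr (1/2 - 1/p) < 1" using \<alpha> by (intro powr_less_one) (auto simp: field_simps)
  hence c0: "0 < 12 + 12 / (1 - 2 powr (1/2 - 1/p))" by (intro add_pos_pos) auto
  have "0 < sqrt C + C" using C by (simp add: add_pos_pos)
  hence c1: "0 < c1" using c0 unfolding c1_def by (intro mult_pos_pos) simp_all
  have c2: "0 < c2" using c1 \<delta> by (simp add: c2_def powr_less_one)
  have c3: "0 < c3" using \<alpha> C by (simp add: c3_def powr_less_one)
  have X_meas [measurable]: "X k j \<in> borel_measurable M" for k j unfolding X_def by measurable
  have X0: "0 \<le> X k j y" for k j y using Q0 by (simp add: X_def)
  have scale: "\<exists>Y. integrable M Y \<and> (\<forall>y. 0 \<le> Y y) \<and>
      expectation Y \<le> c1 * real n powr (1/p) * 2 powr (real k * \<delta>) \<and>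
      (\<forall>y. pvar_le p (\<lambda>l. (\<Sum>j<l. X k j y) - real l * m k) n (Y y))"
    if n: "2 powr (real k * \<alpha>) \<le> real n" for k n
  proof -
    define \<kappa> where "\<kappa> = nat \<lfloor>real k * \<alpha>\<rfloor>"
    \<comment> \<open>the power of two next below \<open>2 powr (k \<alpha>)\<close>\<close>
    define N0 where "N0 = (2::nat) ^ \<kappa>"
    have k\<alpha>: "0 \<le> real k * \<alpha>" using \<alpha> by simp
    have \<kappa>: "real \<kappa> \<le> real k * \<alpha>" "real k * \<alpha> \<le> real \<kappa> + 1" using k\<alpha> unfolding \<kappa>_def by linarith+
    have N0: "real N0 = 2 powr (real \<kappa>)" by (simp add: N0_def powr_realpow)
    have N0_le: "real N0 \<le> 2 powr (real k * \<alpha>)" using \<kappa> by (simp add: N0)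
    have N0_ge: "2 powr (real k * \<alpha>) \<le> 2 * real N0"
    proof -
      have "2 powr (real k * \<alpha>) \<le> 2 powr (real \<kappa> + 1)" using \<kappa> by simp
      thus ?thesis by (simp add: N0 powr_add)
    qed
    have "1 \<le> N0" by (simp add: N0_def)
    have "N0 \<le> n" using N0_le n by linarith
    define B where "B = C * 2 powr (real k * (2 - \<alpha>))"
    have B: "0 \<le> B" using C by (simp add: B_def)
    obtain Y where Y: "integrable M Y" "\<forall>y. 0 \<le> Y y"
      "expectation Y \<le> (12 + 12 / (1 - 2 powr (1/2 - 1/p))) * (real n / real N0) powr (1/p) * (sqrt (real N0 * B) + real N0 * m k)"
      "\<forall>y. pvar_le p (\<lambda>l. (\<Sum>j<l. X k j y) - real l * m k) n (Y y)"
      using pvar_expectation_one_scale[of p "X k" "m k" B N0 n] \<alpha> X_meas X0 m B int var \<open>1 \<le> N0\<close> \<open>N0 \<le> n\<close>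
      unfolding B_def by auto
    have "sqrt (real N0 * B) + real N0 * m k \<le> (sqrt C + C) * 2 ^ k"
    proof -
      have "real N0 * B \<le> 2 powr (real k * \<alpha>) * (C * 2 powr (real k * (2 - \<alpha>)))"
        unfolding B_def using N0_le C by (intro mult_right_mono) auto
      also have "\<dots> = C * 2 powr (2 * real k)" by (simp add: powr_add[symmetric] algebra_simps)
      also have "2 powr (2 * real k) = 2 powr (real k) * 2 powr (real k)" by (simp add: powr_add[symmetric])
      also have "\<dots> = (2 ^ k)\<^sup>2" by (simp add: powr_realpow power2_eq_square)
      finally have "sqrt (real N0 * B) \<le> sqrt C * 2 ^ k"
        using real_sqrt_le_mono[of "real N0 * B" "C * (2 ^ k)\<^sup>2"] by (simp add: real_sqrt_mult)
      hence 1: "sqrt (real N0 * B) \<le> sqrt C * 2 ^ k" .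
      have 2: "real N0 * m k \<le> 2 powr (real k * \<alpha>) * (C * 2 powr (- (real k * (\<alpha> - 1))))"
        using N0_le m by (intro mult_mono) auto
      have 3: "2 powr (real k * \<alpha>) * (C * 2 powr (- (real k * (\<alpha> - 1)))) = C * 2 powr (real k)"
        by (simp add: powr_add[symmetric] algebra_simps)
      have "real N0 * m k \<le> C * 2 ^ k" using 2 unfolding 3 by (simp add: powr_realpow)
      with 1 show ?thesis unfolding distrib_right by (rule add_mono)
    qed
    moreover have "(real n / real N0) powr (1/p) \<le> 2 * real n powr (1/p) * 2 powr (- (real k * \<alpha> / p))"
    proof -
      have "real n / real N0 \<le> 2 * (real n / 2 powr (real k * \<alpha>))"
        using mult_left_mono[OF N0_ge, of "real n"] \<open>1 \<le> N0\<close> by (simp add: field_simps)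
      hence "(real n / real N0) powr (1/p) \<le> (2 * (real n / 2 powr (real k * \<alpha>))) powr (1/p)"
        using \<alpha> by (intro powr_mono2) auto
      also have "\<dots> = 2 powr (1/p) * (real n powr (1/p) * 2 powr (- (real k * \<alpha> / p)))"
        by (simp add: powr_mult powr_divide powr_powr powr_minus divide_inverse inverse_powr)
      also have "\<dots> \<le> 2 powr 1 * (real n powr (1/p) * 2 powr (- (real k * \<alpha> / p)))"
        using \<alpha> by (intro mult_right_mono powr_mono) auto
      finally show ?thesis by simp
    qed
    ultimately have "(real n / real N0) powr (1/p) * (sqrt (real N0 * B) + real N0 * m k) \<le>
       (2 * real n powr (1/p) * 2 powr (- (real k * \<alpha> / p))) * ((sqrt C + C) * 2 ^ k)"
      using B m by (intro mult_mono) auto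
    also have "\<dots> = 2 * (sqrt C + C) * (real n powr (1/p) * (2 powr (- (real k * \<alpha> / p)) * 2 powr (real k)))"
      by (simp add: powr_realpow)
    also have "2 powr (- (real k * \<alpha> / p)) * 2 powr (real k) = 2 powr (real k * \<delta>)"
      by (simp add: powr_add[symmetric] \<delta>_def algebra_simps)
    finally have "(12 + 12 / (1 - 2 powr (1/2 - 1/p))) * ((real n / real N0) powr (1/p) * (sqrt (real N0 * B) + real N0 * m k))
        \<le> (12 + 12 / (1 - 2 powr (1/2 - 1/p))) * (2 * (sqrt C + C) * (real n powr (1/p) * 2 powr (real k * \<delta>)))"
      using c0 by (intro mult_left_mono) auto
    hence "expectation Y \<le> (12 + 12 / (1 - 2 powr (1/2 - 1/p))) * (2 * (sqrt C + C) * (real n powr (1/p) * 2 powr (real k * \<delta>)))"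
      using Y(3) by (simp only: mult.assoc order_trans[of "expectation Y"])
    hence "expectation Y \<le> c1 * real n powr (1/p) * 2 powr (real k * \<delta>)" by (simp only: c1_def mult.assoc)
    thus ?thesis using Y(1,2,4) by blast
  qed
  show ?thesis
    unfolding bounded_in_prob_def
  proof (intro allI impI)
    fix \<epsilon> :: real assume \<epsilon>: "0 < \<epsilon>"
    \<comment> \<open>return times of order \<open>(K0 * n) powr (1/\<alpha>)\<close> occur before time \<open>n\<close> with probability at most \<open>C / K0\<close>\<close>
    define K0 where "K0 = nat \<lceil>2 * C / \<epsilon>\<rceil>"
    have K0: "2 * C / \<epsilon> \<le> real K0" unfolding K0_def by linarith
    have K0_pos: "1 \<le> K0" using C \<epsilon> unfolding K0_def by (simp add: Suc_le_eq)
    define \<Lambda> where "\<Lambda> = 2 * c2 / \<epsilon>"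
    have \<Lambda>: "0 < \<Lambda>" using c2 \<epsilon> by (simp add: \<Lambda>_def)
    define R where "R = (\<Lambda> + c3) * real K0 powr (1/\<alpha>)"
    have R: "0 < R" using \<Lambda> c3 K0_pos by (simp add: R_def)
    show "\<exists>R>0. \<forall>n\<ge>1. \<exists>A\<in>sets M. prob A \<le> \<epsilon> \<and> (\<forall>y\<in>space M - A.
        pvar_le p (\<lambda>l. (\<Sum>j<l. Q j y) - real l * suminf m) n (R * real n powr (1/\<alpha>)))"
    proof (intro exI[of _ R] conjI allI impI R)
      fix n :: nat assume n: "1 \<le> n"
      define n' where "n' = K0 * n"
      have n': "1 \<le> n'" "n \<le> n'" using n K0_pos by (auto simp: n'_def Suc_le_eq)
      \<comment> \<open>the largest scale with \<open>2 powr (K \<alpha>) \<le> n'\<close>\<close>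
      define K where "K = nat \<lfloor>log 2 (real n') / \<alpha>\<rfloor>"
      have lg: "0 \<le> log 2 (real n') / \<alpha>" using n' \<alpha> by simp
      have "real K \<le> log 2 (real n') / \<alpha>" "log 2 (real n') / \<alpha> < real K + 1" using lg unfolding K_def by linarith+
      hence K': "real K * \<alpha> \<le> log 2 (real n')" "log 2 (real n') < real (Suc K) * \<alpha>" using \<alpha> by (auto simp: field_simps)
      have K: "2 powr (real K * \<alpha>) \<le> real n'" "real n' < 2 powr (real (Suc K) * \<alpha>)"
        using K' n' by (auto simp: le_log_iff log_less_iff)
      have Kk: "2 powr (real k * \<alpha>) \<le> real n'" if "k \<le> K" for k
        using K(1) that \<alpha> by (intro order_trans[OF powr_mono K(1)]) (auto intro: mult_right_mono)
      have "\<forall>k\<in>{..K}. \<exists>Y. integrable M Y \<and> (\<forall>y. 0 \<le> Y y) \<and>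
          expectation Y \<le> c1 * real n' powr (1/p) * 2 powr (real k * \<delta>) \<and>
          (\<forall>y. pvar_le p (\<lambda>l. (\<Sum>j<l. X k j y) - real l * m k) n' (Y y))"
        using scale[OF Kk] by blast
      from bchoice[OF this] obtain Y where Y': "\<forall>k\<in>{..K}. integrable M (Y k) \<and> (\<forall>y. 0 \<le> Y k y) \<and>
          expectation (Y k) \<le> c1 * real n' powr (1/p) * 2 powr (real k * \<delta>) \<and>
          (\<forall>y. pvar_le p (\<lambda>l. (\<Sum>j<l. X k j y) - real l * m k) n' (Y k y))" ..
      hence Y: "\<And>k. k \<le> K \<Longrightarrow> integrable M (Y k)" "\<And>k y. k \<le> K \<Longrightarrow> 0 \<le> Y k y"
         "\<And>k. k \<le> K \<Longrightarrow> expectation (Y k) \<le> c1 * real n' powr (1/p) * 2 powr (real k * \<delta>)"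
         "\<And>k y. k \<le> K \<Longrightarrow> pvar_le p (\<lambda>l. (\<Sum>j<l. X k j y) - real l * m k) n' (Y k y)"
        by auto
      define Z where "Z y = (\<Sum>k\<le>K. Y k y)" for y
      have Z: "integrable M Z" "\<And>y. 0 \<le> Z y" unfolding Z_def using Y by (auto intro!: sum_nonneg)
      have EZ: "expectation Z \<le> c2 * real n' powr (1/\<alpha>)"
      proof -
        have "expectation Z = (\<Sum>k\<le>K. expectation (Y k))" unfolding Z_def using Y by (intro Bochner_Integration.integral_sum) auto
        also have "\<dots> \<le> (\<Sum>k\<le>K. c1 * real n' powr (1/p) * 2 powr (real k * \<delta>))" using Y by (intro sum_mono) auto
        also have "\<dots> = c1 * real n' powr (1/p) * (\<Sum>k\<le>K. 2 powr (real k * \<delta>))" by (simp add: sum_distrib_left)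
        also have "\<dots> \<le> c1 * real n' powr (1/p) * (2 powr (real K * \<delta>) / (1 - 2 powr (- \<delta>)))"
          using c1 by (intro mult_left_mono sum_powr_geometric_le \<delta>) auto
        also have "\<dots> = c2 * real n' powr (1/p) * 2 powr (real K * \<delta>)" by (simp add: c2_def)
        also have "\<dots> \<le> c2 * real n' powr (1/p) * real n' powr (\<delta> / \<alpha>)"
        proof (intro mult_left_mono)
          have "2 powr (real K * \<delta>) = (2 powr (real K * \<alpha>)) powr (\<delta> / \<alpha>)" using \<alpha> by (simp add: powr_powr)
          also have "\<dots> \<le> real n' powr (\<delta> / \<alpha>)" using K \<delta> \<alpha> by (intro powr_mono2) auto
          finally show "2 powr (real K * \<delta>) \<le> real n' powr (\<delta> / \<alpha>)" .
        qed (use c2 in auto)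
        also have "\<dots> = c2 * real n' powr (1/\<alpha>)"
          using \<alpha> by (simp add: powr_add[symmetric] \<delta>_def field_simps)
        finally show ?thesis .
      qed
      define A1 where "A1 = {y\<in>space M. \<Lambda> * real n' powr (1/\<alpha>) \<le> Z y}"
      define A2 where "A2 = (\<Union>j<n. {y\<in>space M. 2 ^ Suc K \<le> rt j y})"
      have Zm [measurable]: "Z \<in> borel_measurable M" using Z by simp
      have meas: "A1 \<in> sets M" "A2 \<in> sets M" unfolding A1_def A2_def by measurable
      have n'pos: "0 < real n' powr (1/\<alpha>)" using n' by simp
      have "prob A1 \<le> expectation Z / (\<Lambda> * real n' powr (1/\<alpha>))"
        unfolding A1_def using Z \<Lambda> n'pos by (intro integral_Markov_inequality_measure[where A="{}"]) auto
      also have "\<dots> \<le> c2 * real n' powr (1/\<alpha>) / (\<Lambda> * real n' powr (1/\<alpha>))"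
        using EZ \<Lambda> n'pos by (intro divide_right_mono) auto
      also have "\<dots> = \<epsilon> / 2" using c2 \<epsilon> n'pos by (simp add: \<Lambda>_def)
      finally have A1: "prob A1 \<le> \<epsilon> / 2" .
      have "prob A2 \<le> (\<Sum>j<n. prob {y\<in>space M. 2 ^ Suc K \<le> rt j y})"
        unfolding A2_def by (intro finite_measure_subadditive_finite) auto
      also have "\<dots> \<le> (\<Sum>j<n. C * real (2 ^ Suc K) powr (- \<alpha>))" by (intro sum_mono tail) simp
      also have "real (2 ^ Suc K) powr (- \<alpha>) = inverse (2 powr (real (Suc K) * \<alpha>))"
        by (subst powr_minus[symmetric]) (simp add: powr_powr powr_realpow[symmetric] del: power_Suc)
      also have "(\<Sum>j<n. C * inverse (2 powr (real (Suc K) * \<alpha>))) \<le> (\<Sum>j<n. C * inverse (real n'))"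
        using K(2) C n' by (intro sum_mono mult_left_mono le_imp_inverse_le) auto
      also have "\<dots> = C / real K0" using n by (simp add: n'_def field_simps)
      also have "\<dots> \<le> \<epsilon> / 2" using K0 K0_pos \<epsilon> by (simp add: field_simps)
      finally have A2: "prob A2 \<le> \<epsilon> / 2" .
      have "prob (A1 \<union> A2) \<le> \<epsilon>"
        using A1 A2 measure_Un_le[OF meas] by linarith
      moreover have "pvar_le p (\<lambda>l. (\<Sum>j<l. Q j y) - real l * suminf m) n (R * real n powr (1/\<alpha>))"
        if y: "y \<in> space M - (A1 \<union> A2)" for y
      proof -
        have Zy: "Z y \<le> \<Lambda> * real n' powr (1/\<alpha>)" using y by (auto simp: A1_def)
        have rt: "rt j y < 2 ^ Suc K" if "j < n" for j using y that by (auto simp: A2_def not_le)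
        have Q_eq: "Q j y = (\<Sum>k\<le>K. X k j y)" if j: "j < n" for j
        proof -
          obtain k0 where k0: "2 ^ k0 \<le> rt j y" "rt j y < 2 ^ (k0 + 1)"
            using ex_power_ivl1[of 2 "rt j y"] rt1[of j y] by auto
          have "(2::nat) ^ k0 < 2 ^ Suc K" using k0(1) rt[OF j] by (rule le_less_trans)
          hence k0K: "k0 \<le> K" by (simp del: power_Suc)
          have "X k j y = (if k = k0 then Q j y else 0)" for k
          proof (cases "k = k0")
            case False
            have "\<not> (2 ^ k \<le> rt j y \<and> rt j y < 2 ^ (k + 1))"
            proof
              assume *: "2 ^ k \<le> rt j y \<and> rt j y < 2 ^ (k + 1)"
              have "(2::nat) ^ k < 2 ^ (k0 + 1)" "(2::nat) ^ k0 < 2 ^ (k + 1)"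
                using * k0 by (auto intro: le_less_trans)
              hence "k < k0 + 1" "k0 < k + 1"
                by (auto simp only: power_strict_increasing_iff one_less_numeral_iff semiring_norm)
              thus False using False by simp
            qed
            thus ?thesis using False by (auto simp: X_def)
          qed (use k0 in \<open>simp add: X_def\<close>)
          thus ?thesis using k0K by simp
        qed
        define \<tau> where "\<tau> = suminf m - (\<Sum>k\<le>K. m k)"
        have m': "m k \<le> C * 2 powr (- (real k * (\<alpha> - 1)))" for k by (rule m)
        have \<alpha>1: "0 < \<alpha> - 1" using \<alpha> by simp
        note tl = suminf_tail_geometric_le(2,3)[OF \<alpha>1 m(1) m', of K]
        have \<tau>0: "0 \<le> \<tau>" using tl(2) by (simp add: \<tau>_def)
        have \<tau>_le: "real n' * \<tau> \<le> c3 * real n' powr (1/\<alpha>)"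
        proof -
          have "\<tau> \<le> c3 * 2 powr (- (real (Suc K) * (\<alpha> - 1)))" using tl(1) by (simp add: \<tau>_def c3_def)
          also have "2 powr (- (real (Suc K) * (\<alpha> - 1))) = (2 powr (real (Suc K) * \<alpha>)) powr (- ((\<alpha> - 1) / \<alpha>))"
            using \<alpha> by (simp add: powr_powr)
          also have "\<dots> \<le> real n' powr (- ((\<alpha> - 1) / \<alpha>))"
            using K(2) n' \<alpha> by (intro powr_mono2') auto
          finally have "real n' * \<tau> \<le> real n' powr 1 * (c3 * real n' powr (- ((\<alpha> - 1) / \<alpha>)))"
            using c3 n' by (simp add: mult_left_mono)
          also have "\<dots> = c3 * real n' powr (1/\<alpha>)"
            using \<alpha> by (simp add: powr_add[symmetric] mult.left_commute field_simps del: powr_one powr_one')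
          finally show ?thesis .
        qed
        have 0: "pvar_le p (\<lambda>l. \<Sum>k\<le>K. ((\<Sum>j<l. X k j y) - real l * m k)) n' (Z y)"
          unfolding Z_def using \<alpha> Y by (intro pvar_le_sum) auto
        have 1: "pvar_le p (\<lambda>l. \<Sum>k\<le>K. ((\<Sum>j<l. X k j y) - real l * m k)) n (Z y)"
          using n' Z \<alpha> by (intro pvar_le_mono[OF 0]) auto
        have 2: "pvar_le p (\<lambda>l. - (real l * \<tau>)) n (real n * \<tau>)"
          using pvar_le_total_variation[of p "\<lambda>l. - (real l * \<tau>)" n] \<alpha> \<tau>0 by (simp add: algebra_simps)
        have "pvar_le p (\<lambda>l. (\<Sum>k\<le>K. ((\<Sum>j<l. X k j y) - real l * m k)) + - (real l * \<tau>)) n (Z y + real n * \<tau>)"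
          using \<alpha> Z \<tau>0 by (intro pvar_le_add[OF _ 1 2]) auto
        also have "?this \<longleftrightarrow> pvar_le p (\<lambda>l. (\<Sum>j<l. Q j y) - real l * suminf m) n (Z y + real n * \<tau>)"
        proof (intro pvar_le_cong)
          fix l assume "l \<le> n"
          hence "(\<Sum>j<l. Q j y) = (\<Sum>j<l. \<Sum>k\<le>K. X k j y)" by (intro sum.cong Q_eq) auto
          also have "\<dots> = (\<Sum>k\<le>K. \<Sum>j<l. X k j y)" by (rule sum.swap)
          finally show "(\<Sum>k\<le>K. ((\<Sum>j<l. X k j y) - real l * m k)) + - (real l * \<tau>) = (\<Sum>j<l. Q j y) - real l * suminf m"
            by (simp add: sum_subtractf sum_distrib_left[symmetric] \<tau>_def algebra_simps)
        qed
        finally have 3: "pvar_le p (\<lambda>l. (\<Sum>j<l. Q j y) - real l * suminf m) n (Z y + real n * \<tau>)" .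
        have "Z y + real n * \<tau> \<le> Z y + real n' * \<tau>"
          using n' \<tau>0 by (auto intro: mult_right_mono)
        also have "\<dots> \<le> (\<Lambda> + c3) * real n' powr (1/\<alpha>)"
          using Zy \<tau>_le by (simp add: algebra_simps)
        also have "\<dots> = R * real n powr (1/\<alpha>)" by (simp add: R_def n'_def powr_mult)
        finally show ?thesis using 3 Z \<tau>0 \<alpha> by (intro pvar_le_mono[OF 3]) auto
      qed
      ultimately show "\<exists>A\<in>sets M. prob A \<le> \<epsilon> \<and> (\<forall>y\<in>space M - A.
        pvar_le p (\<lambda>l. (\<Sum>j<l. Q j y) - real l * suminf m) n (R * real n powr (1/\<alpha>)))"
        using meas by (intro bexI[of _ "A1 \<union> A2"]) auto
    qed
  qed
qed

end

section \<open>Full-branch maps and their transfer operators\<close>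

text \<open>A uniformly expanding map with countably many full branches, given by its inverse branches \<open>H i\<close>
with derivatives \<open>H' i\<close>. The exponent \<open>\<eta>\<close> is the one for which observables are Hoelder on each branch.\<close>

locale full_branch_map =
  fixes a b D \<eta> :: real and H H' :: "nat \<Rightarrow> real \<Rightarrow> real" and F :: "real \<Rightarrow> real"
  assumes ab: "a < b" "b \<le> a + 1" and D: "0 \<le> D" and \<eta>: "0 < \<eta>" "\<eta> \<le> 1"
    and H_deriv: "\<And>i x. x \<in> {a..b} \<Longrightarrow> (H i has_real_derivative H' i x) (at x)"
    and H'_cont: "\<And>i. continuous_on {a..b} (H' i)"
    and H'_pos: "\<And>i x. x \<in> {a..b} \<Longrightarrow> 0 < H' i x"
    and H'_le: "\<And>i x. x \<in> {a..b} \<Longrightarrow> H' i x \<le> 1/2"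
    and distortion: "\<And>i x y. x \<in> {a..b} \<Longrightarrow> y \<in> {a..b} \<Longrightarrow> H' i x \<le> exp (D * \<bar>x - y\<bar>) * H' i y"
    and H_range: "\<And>i x. x \<in> {a<..<b} \<Longrightarrow> H i x \<in> {a<..<b}"
    and F_H: "\<And>i x. x \<in> {a<..<b} \<Longrightarrow> F (H i x) = x"
    and disjoint: "\<And>i j. i \<noteq> j \<Longrightarrow> H i ` {a<..<b} \<inter> H j ` {a<..<b} = {}"
    and cover: "AE x in lborel. x \<in> {a<..<b} \<longrightarrow> (\<exists>i. x \<in> H i ` {a<..<b})"
    and F_meas [measurable]: "F \<in> restrict_space lborel {a<..<b} \<rightarrow>\<^sub>M restrict_space lborel {a<..<b}"
begin

abbreviation "J \<equiv> {a<..<b}"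

definition "LJ = restrict_space lborel J"

definition "w = b - a"

lemma w: "0 < w" "w \<le> 1" using ab by (auto simp: w_def)

lemma sets_LJ [measurable_cong]: "sets LJ = sets (restrict_space borel J)"
  unfolding LJ_def by (rule sets_restrict_space_cong) simp

lemma space_LJ [simp]: "space LJ = J" by (simp add: LJ_def space_restrict_space)

lemma F_LJ [measurable]: "F \<in> LJ \<rightarrow>\<^sub>M LJ" using F_meas by (simp add: LJ_def)

lemma F_in: "x \<in> J \<Longrightarrow> F x \<in> J" using measurable_space[OF F_LJ, of x] by simp

lemma F_iter_in: "x \<in> J \<Longrightarrow> (F ^^ n) x \<in> J" by (induction n) (simp_all only: funpow.simps comp_def id_apply F_in)

lemma F_iter_LJ [measurable]: "(F ^^ n) \<in> LJ \<rightarrow>\<^sub>M LJ"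
  by (induction n) (auto simp: comp_def intro: measurable_compose[OF _ F_LJ])

lemma emeasure_LJ: "emeasure LJ (space LJ) = ennreal w"
  using ab by (simp add: LJ_def emeasure_restrict_space space_restrict_space w_def)

sublocale LJ: finite_measure LJ by standard (simp only: emeasure_LJ ennreal_neq_top infinity_ennreal_def not_False_eq_True simp_thms)

lemma measure_LJ: "measure LJ J = w"
  using emeasure_LJ w by (simp add: measure_def)

lemma H_cont: "continuous_on {a..b} (H i)"
  using H_deriv by (intro DERIV_continuous_on) (auto intro: has_field_derivative_at_within)

lemma H_strict: assumes "x \<in> {a..b}" "y \<in> {a..b}" "x < y" shows "H i x < H i y"
proof (rule DERIV_pos_imp_increasing_open[OF \<open>x < y\<close>])
  fix z assume "x < z" "z < y"
  thus "\<exists>d. (H i has_real_derivative d) (at z) \<and> 0 < d" using assms H_deriv[of z i] H'_pos[of z i] by auto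
qed (rule continuous_on_subset[OF H_cont], use assms in auto)

lemma H_image: "H i ` J = {H i a<..<H i b}"
proof
  show "H i ` J \<subseteq> {H i a<..<H i b}" using H_strict[of a _ i] H_strict[of _ b i] ab by auto
  show "{H i a<..<H i b} \<subseteq> H i ` J"
  proof
    fix y assume y: "y \<in> {H i a<..<H i b}"
    then obtain x where x: "a \<le> x" "x \<le> b" "H i x = y"
      using IVT'[of "H i" a y b] H_cont ab by auto
    moreover have "x \<noteq> a" "x \<noteq> b" using x y by auto
    ultimately show "y \<in> H i ` J" by auto
  qed
qed

lemma H_LJ [measurable]: "H i \<in> LJ \<rightarrow>\<^sub>M LJ"
proof -
  have "continuous_on J (H i)" by (rule continuous_on_subset[OF H_cont]) auto
  hence "H i \<in> borel_measurable (restrict_space borel J)" by (rule borel_measurable_continuous_on_restrict)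
  thus ?thesis unfolding LJ_def using H_range
    by (intro measurable_restrict_space2) (auto simp: space_restrict_space cong: measurable_cong_sets)
qed

lemma H'_LJ [measurable]: "H' i \<in> borel_measurable LJ"
proof -
  have "continuous_on J (H' i)" by (rule continuous_on_subset[OF H'_cont]) auto
  hence "H' i \<in> borel_measurable (restrict_space borel J)" by (rule borel_measurable_continuous_on_restrict)
  thus ?thesis by (simp cong: measurable_cong_sets add: sets_LJ)
qed

lemma H_diff: assumes "x \<in> {a..b}" "y \<in> {a..b}" "x < y"
  obtains z where "x < z" "z < y" "H i y - H i x = (y - x) * H' i z"
  using MVT2[OF assms(3), of "H i" "H' i"] assms H_deriv by force

lemma H_contract: assumes "x \<in> J" "y \<in> J" shows "\<bar>H i x - H i y\<bar> \<le> \<bar>x - y\<bar> / 2"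
proof -
  have *: "\<bar>H i x - H i y\<bar> \<le> \<bar>x - y\<bar> / 2" if less: "x < y" and in_J: "x \<in> J" "y \<in> J" for x y
  proof -
    obtain z where z: "x < z" "z < y" "H i y - H i x = (y - x) * H' i z"
      using H_diff[of x y i] less in_J by auto
    have "z \<in> {a..b}" using z in_J by auto
    hence "\<bar>H' i z\<bar> \<le> 1/2" using H'_le[of z i] H'_pos[of z i] by auto
    hence "\<bar>y - x\<bar> * \<bar>H' i z\<bar> \<le> \<bar>y - x\<bar> * (1/2)" by (intro mult_left_mono) auto
    moreover have "\<bar>H i x - H i y\<bar> = \<bar>y - x\<bar> * \<bar>H' i z\<bar>"
      by (subst abs_minus_commute) (simp only: z(3) abs_mult)
    ultimately show ?thesis by (simp add: abs_minus_commute)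
  qed
  show ?thesis using *[of x y] *[of y x] assms by (cases x y rule: linorder_cases) (auto simp: abs_minus_commute)
qed

lemma nn_integral_branch:
  fixes g :: "real \<Rightarrow> ennreal"
  assumes [measurable]: "g \<in> borel_measurable borel"
  shows "(\<integral>\<^sup>+x. g x * indicator (H i ` J) x \<partial>lborel) = (\<integral>\<^sup>+x. g (H i x) * ennreal (H' i x) * indicator J x \<partial>lborel)"
proof -
  have ae: "AE x in lborel. x \<noteq> (c::real)" for c by (rule AE_lborel_singleton)
  have "(\<integral>\<^sup>+x. g x * indicator (H i ` J) x \<partial>lborel) = (\<integral>\<^sup>+x. g x * indicator {H i a..H i b} x \<partial>lborel)"
    using ae[of "H i a"] ae[of "H i b"] by (intro nn_integral_cong_AE) (auto simp: H_image split: split_indicator)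
  also have "\<dots> = (\<integral>\<^sup>+x. g (H i x) * ennreal (H' i x) * indicator {a..b} x \<partial>lborel)"
    using H_deriv H'_cont H'_pos ab by (intro nn_integral_substitution_aux) (auto intro: less_imp_le)
  also have "\<dots> = (\<integral>\<^sup>+x. g (H i x) * ennreal (H' i x) * indicator J x \<partial>lborel)"
    using ae[of a] ae[of b] by (intro nn_integral_cong_AE) (auto split: split_indicator)
  finally show ?thesis .
qed

text \<open>The change of variables on each branch, summed over the branches, which cover \<open>J\<close> up to a null set.\<close>

lemma nn_transfer_duality:
  fixes \<phi> \<psi> :: "real \<Rightarrow> ennreal"
  assumes [measurable]: "\<phi> \<in> borel_measurable LJ" "\<psi> \<in> borel_measurable LJ"
  shows "(\<integral>\<^sup>+x. \<phi> x * \<psi> (F x) \<partial>LJ) = (\<integral>\<^sup>+x. (\<Sum>i. ennreal (H' i x) * \<phi> (H i x)) * \<psi> x \<partial>LJ)"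
proof -
  define g where "g x = \<phi> x * \<psi> (F x) * indicator J x" for x
  have g_LJ: "(\<lambda>x. \<phi> x * \<psi> (F x)) \<in> borel_measurable LJ" by measurable
  have [measurable]: "g \<in> borel_measurable borel"
    using g_LJ unfolding g_def LJ_def by (subst (asm) borel_measurable_restrict_space_iff_ennreal) auto
  have [measurable]: "H i ` J \<in> sets borel" for i unfolding H_image by simp
  have "(\<integral>\<^sup>+x. \<phi> x * \<psi> (F x) \<partial>LJ) = (\<integral>\<^sup>+x. g x \<partial>lborel)"
    unfolding LJ_def g_def by (subst nn_integral_restrict_space) auto
  also have "\<dots> = (\<integral>\<^sup>+x. (\<Sum>i. g x * indicator (H i ` J) x) \<partial>lborel)"
  proof (rule nn_integral_cong_AE)
    show "AE x in lborel. g x = (\<Sum>i. g x * indicator (H i ` J) x)"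
      using cover
    proof eventually_elim
      case (elim x)
      show ?case
      proof (cases "x \<in> J")
        case True
        then obtain i where i: "x \<in> H i ` J" using elim by auto
        have "(\<Sum>j. g x * indicator (H j ` J) x) = (\<Sum>j\<in>{i}. g x * indicator (H j ` J) x)"
          using i disjoint by (intro suminf_finite) (auto simp: indicator_def)
        thus ?thesis using i by simp
      qed (simp add: g_def)
    qed
  qed
  also have "\<dots> = (\<Sum>i. \<integral>\<^sup>+x. g x * indicator (H i ` J) x \<partial>lborel)" by (intro nn_integral_suminf) measurable
  also have "\<dots> = (\<Sum>i. \<integral>\<^sup>+x. g (H i x) * ennreal (H' i x) * indicator J x \<partial>lborel)"
    by (simp add: nn_integral_branch)
  also have "\<dots> = (\<Sum>i. \<integral>\<^sup>+x. ennreal (H' i x) * \<phi> (H i x) * \<psi> x \<partial>LJ)"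
    unfolding LJ_def
    by (subst nn_integral_restrict_space) (auto intro!: suminf_cong nn_integral_cong simp: g_def F_H H_range[simplified] mult_ac split: split_indicator)
  also have "\<dots> = (\<integral>\<^sup>+x. (\<Sum>i. ennreal (H' i x) * \<phi> (H i x) * \<psi> x) \<partial>LJ)"
    by (intro nn_integral_suminf[symmetric]) measurable
  also have "\<dots> = (\<integral>\<^sup>+x. (\<Sum>i. ennreal (H' i x) * \<phi> (H i x)) * \<psi> x \<partial>LJ)" by simp
  finally show ?thesis .
qed

lemma summable_H': assumes "x \<in> J" shows "summable (\<lambda>i. H' i x)"
proof (rule summableI_nonneg_bounded)
  fix n
  have le: "H' i x \<le> exp D / w * (H i b - H i a)" for i
  proof -
    obtain z where z: "a < z" "z < b" "H i b - H i a = (b - a) * H' i z" using H_diff[of a b i] ab by auto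
    have "H' i x \<le> exp (D * \<bar>x - z\<bar>) * H' i z" using z assms by (intro distortion) auto
    also have "\<dots> \<le> exp (D * 1) * H' i z"
      using z assms ab D H'_pos[of z i] by (intro mult_right_mono iffD2[OF exp_le_cancel_iff] mult_left_mono) auto
    finally show ?thesis using z w by (simp add: w_def)
  qed
  have "(\<Sum>i<n. H i b - H i a) = (\<Sum>i<n. measure lborel (H i ` J))"
    unfolding H_image using H_strict[of a b] ab by (auto intro!: sum.cong simp: less_imp_le)
  also have "\<dots> = measure lborel (\<Union>i<n. H i ` J)"
    using disjoint H_strict[of a b] ab by (intro measure_finite_Union[symmetric]) (auto simp: disjoint_family_on_def H_image less_imp_le)
  also have "\<dots> \<le> measure lborel J"
  proof (rule measure_mono_fmeasurable)
    show "(\<Union>i<n. H i ` J) \<subseteq> J" using H_range by blast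
    show "(\<Union>i<n. H i ` J) \<in> sets lborel" by (simp add: H_image)
    show "J \<in> fmeasurable lborel" using ab by (intro fmeasurableI) auto
  qed
  also have "\<dots> = w" using ab by (simp add: w_def)
  finally have "(\<Sum>i<n. H i b - H i a) \<le> w" .
  hence "exp D / w * (\<Sum>i<n. H i b - H i a) \<le> exp D / w * w" using w by (intro mult_left_mono) auto
  moreover have "(\<Sum>i<n. H' i x) \<le> exp D / w * (\<Sum>i<n. H i b - H i a)"
    unfolding sum_distrib_left by (intro sum_mono le)
  ultimately show "(\<Sum>i<n. H' i x) \<le> exp D" using w by simp
qed (use H'_pos assms in \<open>auto intro: less_imp_le\<close>)

text \<open>The transfer operator of \<open>F\<close> for Lebesgue measure.\<close>

definition L :: "(real \<Rightarrow> real) \<Rightarrow> real \<Rightarrow> real" where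
  "L \<phi> x = (\<Sum>i. H' i x * \<phi> (H i x))"

definition bounded_nonneg :: "(real \<Rightarrow> real) \<Rightarrow> bool" where
  "bounded_nonneg \<phi> \<longleftrightarrow> \<phi> \<in> borel_measurable LJ \<and> (\<exists>B. \<forall>x\<in>J. 0 \<le> \<phi> x \<and> \<phi> x \<le> B)"

lemma bounded_nonnegI: "\<phi> \<in> borel_measurable LJ \<Longrightarrow> (\<And>x. x \<in> J \<Longrightarrow> 0 \<le> \<phi> x) \<Longrightarrow> (\<And>x. x \<in> J \<Longrightarrow> \<phi> x \<le> B) \<Longrightarrow> bounded_nonneg \<phi>"
  unfolding bounded_nonneg_def by blast

lemma bounded_nonneg_meas: "bounded_nonneg \<phi> \<Longrightarrow> \<phi> \<in> borel_measurable LJ" by (simp add: bounded_nonneg_def)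

lemma bounded_nonneg_nonneg: "bounded_nonneg \<phi> \<Longrightarrow> x \<in> J \<Longrightarrow> 0 \<le> \<phi> x" unfolding bounded_nonneg_def by blast

lemma bounded_nonnegE: assumes "bounded_nonneg \<phi>" obtains B where "0 \<le> B" "\<And>x. x \<in> J \<Longrightarrow> \<phi> x \<le> B"
proof -
  obtain B where "\<forall>x\<in>J. 0 \<le> \<phi> x \<and> \<phi> x \<le> B" using assms unfolding bounded_nonneg_def by blast
  hence "\<And>x. x \<in> J \<Longrightarrow> \<phi> x \<le> max 0 B" by fastforce
  thus ?thesis using that[of "max 0 B"] by simp
qed

lemma bounded_nonneg_integrable: assumes "bounded_nonneg \<phi>" shows "integrable LJ \<phi>"
proof -
  obtain B where "0 \<le> B" "\<And>x. x \<in> J \<Longrightarrow> \<phi> x \<le> B" using bounded_nonnegE[OF assms] by blast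
  thus ?thesis using bounded_nonneg_meas[OF assms] bounded_nonneg_nonneg[OF assms]
    by (intro LJ.integrable_const_bound[of \<phi> B]) (auto simp: space_LJ)
qed

lemma bounded_nonneg_integral_eq: assumes "bounded_nonneg \<phi>" shows "(\<integral>x. \<phi> x \<partial>LJ) = enn2real (\<integral>\<^sup>+x. ennreal (\<phi> x) \<partial>LJ)"
  using bounded_nonneg_meas[OF assms] bounded_nonneg_nonneg[OF assms] by (intro integral_eq_nn_integral AE_I2) auto

lemma bounded_nonneg_mult: assumes "bounded_nonneg \<phi>" "bounded_nonneg \<psi>" shows "bounded_nonneg (\<lambda>x. \<phi> x * \<psi> x)"
proof -
  obtain B where B: "0 \<le> B" "\<And>x. x \<in> J \<Longrightarrow> \<phi> x \<le> B" using bounded_nonnegE[OF assms(1)] by blast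
  obtain C where C: "0 \<le> C" "\<And>x. x \<in> J \<Longrightarrow> \<psi> x \<le> C" using bounded_nonnegE[OF assms(2)] by blast
  note [measurable] = bounded_nonneg_meas[OF assms(1)] bounded_nonneg_meas[OF assms(2)]
  show ?thesis
  proof (rule bounded_nonnegI)
    fix x assume x: "x \<in> J"
    show "0 \<le> \<phi> x * \<psi> x" "\<phi> x * \<psi> x \<le> B * C"
      using B C bounded_nonneg_nonneg[OF assms(1) x] bounded_nonneg_nonneg[OF assms(2) x] x
      by (simp_all only: mult_nonneg_nonneg mult_mono)
  qed measurable
qed

lemma bounded_nonneg_const: "0 \<le> c \<Longrightarrow> bounded_nonneg (\<lambda>_. c)"
  by (rule bounded_nonnegI[of _ c]) auto

lemma bounded_nonneg_cmult: assumes "bounded_nonneg \<phi>" "0 \<le> c" shows "bounded_nonneg (\<lambda>x. c * \<phi> x)"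
  using bounded_nonneg_mult[OF bounded_nonneg_const[OF assms(2)] assms(1)] .

lemma bounded_nonneg_comp: assumes "bounded_nonneg \<phi>" shows "bounded_nonneg (\<lambda>x. \<phi> ((F ^^ n) x))"
proof -
  obtain B where B: "\<And>x. x \<in> J \<Longrightarrow> \<phi> x \<le> B" using bounded_nonnegE[OF assms] by blast
  note [measurable] = bounded_nonneg_meas[OF assms]
  show ?thesis
  proof (rule bounded_nonnegI)
    fix x assume x: "x \<in> J"
    show "0 \<le> \<phi> ((F ^^ n) x)" "\<phi> ((F ^^ n) x) \<le> B"
      using B bounded_nonneg_nonneg[OF assms] F_iter_in[OF x] by blast+
  qed measurable
qed

lemma summable_L: assumes "bounded_nonneg \<phi>" "x \<in> J" shows "summable (\<lambda>i. H' i x * \<phi> (H i x))"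
proof -
  obtain B where B: "0 \<le> B" "\<And>x. x \<in> J \<Longrightarrow> \<phi> x \<le> B" using bounded_nonnegE[OF assms(1)] by blast
  have "summable (\<lambda>i. H' i x * B)" by (intro summable_mult2 summable_H' assms)
  moreover have "norm (H' i x * \<phi> (H i x)) \<le> H' i x * B" for i
  proof -
    have "0 < H' i x" using assms by (intro H'_pos) auto
    thus ?thesis using B(2)[OF H_range[OF assms(2)], of i] bounded_nonneg_nonneg[OF assms(1) H_range[OF assms(2)], of i]
      by (simp add: abs_mult)
  qed
  ultimately show ?thesis by (rule summable_comparison_test'[where N = 0])
qed

lemma L_term_nonneg: assumes "bounded_nonneg \<phi>" "x \<in> J" shows "0 \<le> H' i x * \<phi> (H i x)"
proof -
  have "0 < H' i x" using assms by (intro H'_pos) auto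
  thus ?thesis using bounded_nonneg_nonneg[OF assms(1) H_range[OF assms(2)]] by simp
qed

lemma L_add_scale:
  assumes "bounded_nonneg \<phi>" "bounded_nonneg \<psi>" "x \<in> J"
  shows "L (\<lambda>x. c * \<phi> x + d * \<psi> x) x = c * L \<phi> x + d * L \<psi> x"
proof -
  note s = summable_L[OF assms(1,3)] summable_L[OF assms(2,3)]
  have "(\<Sum>i. H' i x * (c * \<phi> (H i x) + d * \<psi> (H i x))) = (\<Sum>i. c * (H' i x * \<phi> (H i x)) + d * (H' i x * \<psi> (H i x)))"
    by (simp add: algebra_simps)
  also have "\<dots> = (\<Sum>i. c * (H' i x * \<phi> (H i x))) + (\<Sum>i. d * (H' i x * \<psi> (H i x)))"
    by (intro suminf_add[symmetric] summable_mult s)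
  also have "\<dots> = c * L \<phi> x + d * L \<psi> x" unfolding L_def by (simp only: suminf_mult[OF s(1)] suminf_mult[OF s(2)])
  finally show ?thesis by (simp add: L_def)
qed

lemma L_cong: "(\<And>x. x \<in> J \<Longrightarrow> \<phi> x = \<psi> x) \<Longrightarrow> x \<in> J \<Longrightarrow> L \<phi> x = L \<psi> x"
  unfolding L_def using H_range by (intro suminf_cong) simp

lemma L_mono:
  assumes "bounded_nonneg \<phi>" "bounded_nonneg \<psi>" "x \<in> J" "\<And>x. x \<in> J \<Longrightarrow> \<phi> x \<le> \<psi> x"
  shows "L \<phi> x \<le> L \<psi> x"
  unfolding L_def
proof (rule suminf_le[OF _ summable_L[OF assms(1,3)] summable_L[OF assms(2,3)]])
  fix i
  have "0 < H' i x" using assms by (intro H'_pos) auto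
  thus "H' i x * \<phi> (H i x) \<le> H' i x * \<psi> (H i x)" using assms(4)[OF H_range[OF assms(3)]] by simp
qed

lemma L_meas [measurable]: assumes [measurable]: "\<phi> \<in> borel_measurable LJ" shows "L \<phi> \<in> borel_measurable LJ"
  unfolding L_def[abs_def] by measurable

lemma L_cone_ineq:
  assumes "bounded_nonneg \<phi>" "x \<in> J" "y \<in> J" "\<And>i. \<phi> (H i x) \<le> exp B * \<phi> (H i y)"
  shows "L \<phi> x \<le> exp (B + D * \<bar>x - y\<bar>) * L \<phi> y"
proof -
  have "L \<phi> x \<le> (\<Sum>i. exp (B + D * \<bar>x - y\<bar>) * (H' i y * \<phi> (H i y)))"
    unfolding L_def
  proof (intro suminf_le summable_L summable_mult assms)
    fix i
    have "H' i x * \<phi> (H i x) \<le> (exp (D * \<bar>x - y\<bar>) * H' i y) * (exp B * \<phi> (H i y))"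
    proof (rule mult_mono)
      show "H' i x \<le> exp (D * \<bar>x - y\<bar>) * H' i y" using assms by (intro distortion) auto
      show "0 \<le> exp (D * \<bar>x - y\<bar>) * H' i y" using H'_pos[of y i] assms by simp
      show "0 \<le> \<phi> (H i x)" by (rule bounded_nonneg_nonneg[OF assms(1) H_range[OF assms(2)]])
    qed (rule assms(4))
    thus "H' i x * \<phi> (H i x) \<le> exp (B + D * \<bar>x - y\<bar>) * (H' i y * \<phi> (H i y))"
      by (simp add: exp_add mult_ac)
  qed
  also have "\<dots> = exp (B + D * \<bar>x - y\<bar>) * L \<phi> y"
    unfolding L_def by (rule suminf_mult[OF summable_L[OF assms(1,3)]])
  finally show ?thesis .
qed

lemma L_bnn: assumes "bounded_nonneg \<phi>" shows "bounded_nonneg (L \<phi>)"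
proof -
  obtain B where B: "0 \<le> B" "\<And>x. x \<in> J \<Longrightarrow> \<phi> x \<le> B" using bounded_nonnegE[OF assms] by blast
  define c where "c = (a + b) / 2"
  have c: "c \<in> J" using ab by (simp add: c_def)
  show ?thesis
  proof (rule bounded_nonnegI[where B = "exp D * L (\<lambda>_. B) c"])
    fix x assume x: "x \<in> J"
    show "0 \<le> L \<phi> x" unfolding L_def by (intro suminf_nonneg summable_L L_term_nonneg assms x)
    have "L \<phi> x \<le> L (\<lambda>_. B) x" by (intro L_mono assms bounded_nonneg_const B x)
    also have "\<dots> \<le> exp (0 + D * \<bar>x - c\<bar>) * L (\<lambda>_. B) c"
      by (intro L_cone_ineq bounded_nonneg_const B x c) simp
    also have "\<dots> \<le> exp D * L (\<lambda>_. B) c"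
    proof (intro mult_right_mono)
      have "D * \<bar>x - c\<bar> \<le> D * 1" using x c ab D by (intro mult_left_mono) auto
      thus "exp (0 + D * \<bar>x - c\<bar>) \<le> exp D" by simp
      show "0 \<le> L (\<lambda>_. B) c" unfolding L_def by (intro suminf_nonneg summable_L L_term_nonneg bounded_nonneg_const B c)
    qed
    finally show "L \<phi> x \<le> exp D * L (\<lambda>_. B) c" .
  qed (use bounded_nonneg_meas[OF assms] in simp)
qed

lemma transfer_duality:
  assumes \<phi>: "bounded_nonneg \<phi>" and \<psi>: "bounded_nonneg \<psi>"
  shows "(\<integral>x. \<phi> x * \<psi> (F x) \<partial>LJ) = (\<integral>x. L \<phi> x * \<psi> x \<partial>LJ)"
proof -
  note [measurable] = bounded_nonneg_meas[OF \<phi>] bounded_nonneg_meas[OF \<psi>]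
  have eq: "(\<integral>\<^sup>+x. ennreal (\<phi> x * \<psi> (F x)) \<partial>LJ) = (\<integral>\<^sup>+x. ennreal (L \<phi> x * \<psi> x) \<partial>LJ)"
  proof -
    have "(\<integral>\<^sup>+x. ennreal (\<phi> x * \<psi> (F x)) \<partial>LJ) = (\<integral>\<^sup>+x. ennreal (\<phi> x) * ennreal (\<psi> (F x)) \<partial>LJ)"
      using bounded_nonneg_nonneg[OF \<phi>] by (intro nn_integral_cong) (simp add: ennreal_mult')
    also have "\<dots> = (\<integral>\<^sup>+x. (\<Sum>i. ennreal (H' i x) * ennreal (\<phi> (H i x))) * ennreal (\<psi> x) \<partial>LJ)"
      by (rule nn_transfer_duality) measurable
    also have "\<dots> = (\<integral>\<^sup>+x. ennreal (L \<phi> x * \<psi> x) \<partial>LJ)"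
    proof (rule nn_integral_cong)
      fix x assume "x \<in> space LJ"
      hence x: "x \<in> J" by simp
      have "(\<Sum>i. ennreal (H' i x) * ennreal (\<phi> (H i x))) = (\<Sum>i. ennreal (H' i x * \<phi> (H i x)))"
        using H'_pos[of x] x by (intro suminf_cong ennreal_mult'[symmetric]) (auto intro: less_imp_le)
      also have "\<dots> = ennreal (L \<phi> x)"
        unfolding L_def by (intro suminf_ennreal2 L_term_nonneg summable_L \<phi> x)
      finally show "(\<Sum>i. ennreal (H' i x) * ennreal (\<phi> (H i x))) * ennreal (\<psi> x) = ennreal (L \<phi> x * \<psi> x)"
        using bounded_nonneg_nonneg[OF L_bnn[OF \<phi>] x] by (simp add: ennreal_mult')
    qed
    finally show ?thesis .
  qed
  have "bounded_nonneg (\<lambda>x. \<psi> (F x))" using bounded_nonneg_comp[OF \<psi>, of 1] by simp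
  thus ?thesis
    using bounded_nonneg_integral_eq[OF bounded_nonneg_mult[OF \<phi>], of "\<lambda>x. \<psi> (F x)"] bounded_nonneg_integral_eq[OF bounded_nonneg_mult[OF L_bnn[OF \<phi>] \<psi>]] eq
    by simp
qed

lemma Ln_bnn: "bounded_nonneg \<phi> \<Longrightarrow> bounded_nonneg ((L ^^ n) \<phi>)"
  by (induction n) (auto intro: L_bnn)

lemma transfer_duality_iterate:
  assumes "bounded_nonneg \<phi>" "bounded_nonneg \<psi>"
  shows "(\<integral>x. \<phi> x * \<psi> ((F ^^ n) x) \<partial>LJ) = (\<integral>x. (L ^^ n) \<phi> x * \<psi> x \<partial>LJ)"
  using assms(1)
proof (induction n arbitrary: \<phi>)
  case (Suc n)
  have "(\<integral>x. \<phi> x * \<psi> ((F ^^ Suc n) x) \<partial>LJ) = (\<integral>x. \<phi> x * \<psi> ((F ^^ n) (F x)) \<partial>LJ)"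
    by (simp add: funpow_swap1)
  also have "\<dots> = (\<integral>x. L \<phi> x * \<psi> ((F ^^ n) x) \<partial>LJ)"
    by (rule transfer_duality[OF Suc.prems bounded_nonneg_comp[OF assms(2)]])
  also have "\<dots> = (\<integral>x. (L ^^ n) (L \<phi>) x * \<psi> x \<partial>LJ)" by (rule Suc.IH[OF L_bnn[OF Suc.prems]])
  finally show ?case by (simp add: funpow_swap1)
qed simp

lemma integral_L: "bounded_nonneg \<phi> \<Longrightarrow> (\<integral>x. L \<phi> x \<partial>LJ) = (\<integral>x. \<phi> x \<partial>LJ)"
  using transfer_duality[of \<phi> "\<lambda>_. 1"] bounded_nonneg_const[of 1] by simp

lemma integral_Ln: "bounded_nonneg \<phi> \<Longrightarrow> (\<integral>x. (L ^^ n) \<phi> x \<partial>LJ) = (\<integral>x. \<phi> x \<partial>LJ)"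
  using transfer_duality_iterate[of \<phi> "\<lambda>_. 1" n] bounded_nonneg_const[of 1] by simp

lemma Ln_cong: "(\<And>x. x \<in> J \<Longrightarrow> \<phi> x = \<psi> x) \<Longrightarrow> x \<in> J \<Longrightarrow> (L ^^ n) \<phi> x = (L ^^ n) \<psi> x"
  by (induction n arbitrary: x) (auto intro: L_cong)

lemma Ln_add_scale:
  assumes "bounded_nonneg \<phi>" "bounded_nonneg \<psi>" "x \<in> J"
  shows "(L ^^ n) (\<lambda>x. c * \<phi> x + d * \<psi> x) x = c * (L ^^ n) \<phi> x + d * (L ^^ n) \<psi> x"
  using assms(3)
proof (induction n arbitrary: x)
  case (Suc n)
  have "(L ^^ Suc n) (\<lambda>x. c * \<phi> x + d * \<psi> x) x = L (\<lambda>x. c * (L ^^ n) \<phi> x + d * (L ^^ n) \<psi> x) x"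
    using Suc by (auto intro: L_cong)
  also have "\<dots> = c * L ((L ^^ n) \<phi>) x + d * L ((L ^^ n) \<psi>) x"
    by (intro L_add_scale Ln_bnn assms Suc.prems)
  finally show ?case by simp
qed simp

section \<open>Contraction of a cone of functions\<close>

definition hdist :: "real \<Rightarrow> real \<Rightarrow> real" where "hdist x y = \<bar>x - y\<bar> powr \<eta>"

definition \<theta> :: real where "\<theta> = (1/2) powr \<eta>"

text \<open>Large enough for \<open>L\<close> to improve the regularity of the cone \<open>\<A>\<close> by one, even after
multiplication by an observable whose branches have regularity one (\<open>L_cone_branchwise\<close>).\<close>

definition \<A> :: real where "\<A> = (D + 2) / (1 - \<theta>)"

lemma \<theta>: "0 < \<theta>" "\<theta> < 1"
  using \<eta> powr_less_mono2[of \<eta> "1/2" 1] by (auto simp: \<theta>_def)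

lemma \<A>: "2 \<le> \<A>" "\<theta> * \<A> + D + 2 = \<A>"
proof -
  have "2 * (1 - \<theta>) \<le> D + 2" using \<theta> D by (simp add: algebra_simps)
  thus "2 \<le> \<A>" using \<theta> by (simp add: \<A>_def pos_le_divide_eq)
  have "\<A> * (1 - \<theta>) = D + 2" using \<theta> by (simp add: \<A>_def)
  thus "\<theta> * \<A> + D + 2 = \<A>" by (simp add: algebra_simps)
qed

lemma hdist: assumes "x \<in> J" "y \<in> J"
  shows "0 \<le> hdist x y" "hdist x y \<le> 1" "\<bar>x - y\<bar> \<le> hdist x y" "hdist (H i x) (H i y) \<le> \<theta> * hdist x y"
proof -
  have 1: "\<bar>x - y\<bar> \<le> 1" using assms ab by auto
  show "0 \<le> hdist x y" by (simp add: hdist_def)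
  show "hdist x y \<le> 1" using 1 \<eta> powr_mono2[of \<eta> "\<bar>x - y\<bar>" 1] by (simp add: hdist_def)
  show "\<bar>x - y\<bar> \<le> hdist x y" using 1 \<eta> powr_mono'[of \<eta> 1 "\<bar>x - y\<bar>"] by (simp add: hdist_def)
  have "hdist (H i x) (H i y) \<le> (1/2 * \<bar>x - y\<bar>) powr \<eta>"
    unfolding hdist_def using H_contract[OF assms, of i] \<eta> by (intro powr_mono2) auto
  thus "hdist (H i x) (H i y) \<le> \<theta> * hdist x y" by (simp add: hdist_def \<theta>_def powr_mult powr_divide)
qed

text \<open>Functions whose logarithm is Hoelder with constant \<open>A\<close>, written multiplicatively to include zero.\<close>

definition cone :: "real \<Rightarrow> (real \<Rightarrow> real) \<Rightarrow> bool" where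
  "cone A \<phi> \<longleftrightarrow> bounded_nonneg \<phi> \<and> (\<forall>x\<in>J. \<forall>y\<in>J. \<phi> x \<le> exp (A * hdist x y) * \<phi> y)"

lemma cone_bnn: "cone A \<phi> \<Longrightarrow> bounded_nonneg \<phi>" by (simp add: cone_def)

lemma coneD: "cone A \<phi> \<Longrightarrow> x \<in> J \<Longrightarrow> y \<in> J \<Longrightarrow> \<phi> x \<le> exp (A * hdist x y) * \<phi> y" by (simp add: cone_def)

lemma coneI: "bounded_nonneg \<phi> \<Longrightarrow> (\<And>x y. x \<in> J \<Longrightarrow> y \<in> J \<Longrightarrow> \<phi> x \<le> exp (A * hdist x y) * \<phi> y) \<Longrightarrow> cone A \<phi>"
  by (simp add: cone_def)

lemma cone_mono: assumes "cone A \<phi>" "A \<le> B" shows "cone B \<phi>"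
proof (rule coneI[OF cone_bnn[OF assms(1)]])
  fix x y assume xy: "x \<in> J" "y \<in> J"
  have "\<phi> x \<le> exp (A * hdist x y) * \<phi> y" by (rule coneD[OF assms(1) xy])
  also have "\<dots> \<le> exp (B * hdist x y) * \<phi> y"
    using bounded_nonneg_nonneg[OF cone_bnn[OF assms(1)] xy(2)] assms(2) hdist(1)[OF xy]
    by (intro mult_right_mono) (auto intro: mult_right_mono)
  finally show "\<phi> x \<le> exp (B * hdist x y) * \<phi> y" .
qed

lemma cone_const: "0 \<le> c \<Longrightarrow> 0 \<le> A \<Longrightarrow> cone A (\<lambda>_. c)"
proof (rule coneI[OF bounded_nonneg_const])
  fix x y assume *: "0 \<le> c" "0 \<le> A" "x \<in> J" "y \<in> J"
  have "0 \<le> A * hdist x y" using * hdist(1) by simp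
  hence "1 \<le> exp (A * hdist x y)" by simp
  thus "c \<le> exp (A * hdist x y) * c" using mult_right_mono[of 1 "exp (A * hdist x y)" c] *(1) by simp
qed

lemma cone_scale: assumes "cone A \<phi>" "0 \<le> c" shows "cone A (\<lambda>x. c * \<phi> x)"
proof (rule coneI[OF bounded_nonneg_cmult[OF cone_bnn[OF assms(1)] assms(2)]])
  fix x y assume xy: "x \<in> J" "y \<in> J"
  show "c * \<phi> x \<le> exp (A * hdist x y) * (c * \<phi> y)"
    using mult_left_mono[OF coneD[OF assms(1) xy] assms(2)] by (simp add: mult_ac)
qed

lemma cone_sup: assumes "cone A \<phi>" "0 \<le> A" "x \<in> J" "y \<in> J" shows "\<phi> x \<le> exp A * \<phi> y"
proof -
  have "\<phi> x \<le> exp (A * hdist x y) * \<phi> y" by (rule coneD[OF assms(1,3,4)])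
  also have "\<dots> \<le> exp A * \<phi> y"
    using bounded_nonneg_nonneg[OF cone_bnn[OF assms(1)] assms(4)] assms(2) hdist(2)[OF assms(3,4)]
    by (intro mult_right_mono) (auto intro: mult_left_le)
  finally show ?thesis .
qed

lemma integral_const_LJ: "(\<integral>x. c \<partial>LJ) = c * w"
  by (simp add: measure_LJ)

lemma cone_lower: assumes "cone A \<phi>" "0 \<le> A" "x \<in> J" shows "(\<integral>x. \<phi> x \<partial>LJ) \<le> exp A * \<phi> x * w"
proof -
  have "(\<integral>x. \<phi> x \<partial>LJ) \<le> (\<integral>_. exp A * \<phi> x \<partial>LJ)"
    using cone_sup[OF assms(1,2)] assms(3) bounded_nonneg_integrable[OF cone_bnn[OF assms(1)]] by (intro integral_mono) auto
  thus ?thesis by (simp only: integral_const_LJ)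
qed

lemma cone_upper: assumes "cone A \<phi>" "0 \<le> A" "x \<in> J" shows "\<phi> x * w \<le> exp A * (\<integral>x. \<phi> x \<partial>LJ)"
proof -
  have "(\<integral>_. \<phi> x \<partial>LJ) \<le> (\<integral>y. exp A * \<phi> y \<partial>LJ)"
    using cone_sup[OF assms(1,2)] assms(3) bounded_nonneg_integrable[OF cone_bnn[OF assms(1)]] by (intro integral_mono) auto
  thus ?thesis by (simp only: integral_const_LJ integral_mult_right_zero)
qed

text \<open>The regularity on branches adds to the distortion \<open>D\<close> of the branches. The regularity of the
factor in the cone is reduced to \<open>\<theta> * \<A>\<close> because inverse branches contract.\<close>

lemma L_cone_branchwise:
  assumes "bounded_nonneg \<phi>" "\<And>i x y. x \<in> J \<Longrightarrow> y \<in> J \<Longrightarrow> \<phi> (H i x) \<le> exp ((\<theta> * \<A> + 1) * hdist x y) * \<phi> (H i y)"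
  shows "cone (\<A> - 1) (L \<phi>)"
proof (rule coneI[OF L_bnn[OF assms(1)]])
  fix x y assume xy: "x \<in> J" "y \<in> J"
  have "L \<phi> x \<le> exp ((\<theta> * \<A> + 1) * hdist x y + D * \<bar>x - y\<bar>) * L \<phi> y"
    using assms xy by (intro L_cone_ineq) auto
  also have "\<dots> \<le> exp ((\<A> - 1) * hdist x y) * L \<phi> y"
  proof (rule mult_right_mono)
    have "(\<theta> * \<A> + 1) * hdist x y + D * \<bar>x - y\<bar> \<le> (\<theta> * \<A> + 1) * hdist x y + D * hdist x y"
      using hdist(3)[OF xy] D by (intro add_left_mono mult_left_mono) auto
    also have "\<dots> = (\<A> - 1) * hdist x y" using \<A>(2) by (simp flip: distrib_right)
    finally show "exp ((\<theta> * \<A> + 1) * hdist x y + D * \<bar>x - y\<bar>) \<le> exp ((\<A> - 1) * hdist x y)" by simp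
    show "0 \<le> L \<phi> y" by (rule bounded_nonneg_nonneg[OF L_bnn[OF assms(1)] xy(2)])
  qed
  finally show "L \<phi> x \<le> exp ((\<A> - 1) * hdist x y) * L \<phi> y" .
qed

lemma cone_branch:
  assumes "cone \<A> \<phi>" "x \<in> J" "y \<in> J"
  shows "\<phi> (H i x) \<le> exp (\<theta> * \<A> * hdist x y) * \<phi> (H i y)"
proof -
  have "\<phi> (H i x) \<le> exp (\<A> * hdist (H i x) (H i y)) * \<phi> (H i y)"
    by (rule coneD[OF assms(1) H_range[OF assms(2)] H_range[OF assms(3)]])
  also have "\<dots> \<le> exp (\<theta> * \<A> * hdist x y) * \<phi> (H i y)"
  proof (rule mult_right_mono)
    have "\<A> * hdist (H i x) (H i y) \<le> \<A> * (\<theta> * hdist x y)" using \<A> hdist(4)[OF assms(2,3)] by (intro mult_left_mono) auto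
    thus "exp (\<A> * hdist (H i x) (H i y)) \<le> exp (\<theta> * \<A> * hdist x y)" by (simp add: mult_ac)
  qed (rule bounded_nonneg_nonneg[OF cone_bnn[OF assms(1)] H_range[OF assms(3)]])
  finally show ?thesis .
qed

lemma L_cone: assumes "cone \<A> \<phi>" shows "cone (\<A> - 1) (L \<phi>)"
proof (rule L_cone_branchwise[OF cone_bnn[OF assms]])
  fix i x y assume xy: "x \<in> J" "y \<in> J"
  have "\<phi> (H i x) \<le> exp (\<theta> * \<A> * hdist x y) * \<phi> (H i y)" by (rule cone_branch[OF assms xy])
  also have "\<dots> \<le> exp ((\<theta> * \<A> + 1) * hdist x y) * \<phi> (H i y)"
    using bounded_nonneg_nonneg[OF cone_bnn[OF assms] H_range[OF xy(2)]] hdist(1)[OF xy] by (intro mult_right_mono) (auto simp: distrib_right)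
  finally show "\<phi> (H i x) \<le> exp ((\<theta> * \<A> + 1) * hdist x y) * \<phi> (H i y)" .
qed

lemma L_cone': "cone \<A> \<phi> \<Longrightarrow> cone \<A> (L \<phi>)"
  using cone_mono[OF L_cone, of \<phi> \<A>] by simp

lemma Ln_cone: "cone \<A> \<phi> \<Longrightarrow> cone \<A> ((L ^^ n) \<phi>)"
  by (induction n) (auto intro: L_cone')

text \<open>The fraction of mass that can be coupled at each step; \<open>exp_gap\<close> is the inequality that determines it.\<close>

definition \<epsilon> :: real where "\<epsilon> = exp (- 2 * \<A>) / \<A>"

lemma \<epsilon>: "0 < \<epsilon>" "\<epsilon> < 1"
proof -
  show "0 < \<epsilon>" using \<A> by (simp add: \<epsilon>_def)
  have "exp (- 2 * \<A>) < 1" using \<A> by simp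
  hence "exp (- 2 * \<A>) < \<A>" using \<A>(1) by linarith
  thus "\<epsilon> < 1" using \<A> by (simp add: \<epsilon>_def)
qed

lemma exp_gap: assumes "0 \<le> d" "d \<le> 1"
  shows "\<epsilon> * (exp (\<A> * d) - 1) \<le> exp (- \<A>) * (exp (\<A> * d) - exp ((\<A> - 1) * d))"
proof -
  have g: "1 - exp (- (\<A> * d)) \<le> \<A> * d"
    using exp_ge_add_one_self[of "- (\<A> * d)"] by linarith
  have "exp (\<A> * d) - 1 = exp (\<A> * d) * (1 - exp (- (\<A> * d)))"
    by (simp add: right_diff_distrib exp_minus)
  also have "\<dots> \<le> exp (\<A> * d) * (\<A> * d)" by (rule mult_left_mono[OF g]) simp
  also have "\<dots> \<le> exp \<A> * (\<A> * d)"
    using assms \<A> by (intro mult_right_mono) (auto intro: mult_left_le)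
  finally have "\<epsilon> * (exp (\<A> * d) - 1) \<le> \<epsilon> * (exp \<A> * (\<A> * d))" using \<epsilon> by (intro mult_left_mono) auto
  also have "\<epsilon> * (exp \<A> * (\<A> * d)) = (exp (- 2 * \<A>) * exp \<A>) * d" using \<A> by (simp add: \<epsilon>_def)
  also have "exp (- 2 * \<A>) * exp \<A> = exp (- \<A>)" by (simp flip: exp_add)
  also have "exp (- \<A>) * d \<le> exp (- \<A>) * (exp (\<A> * d) - exp ((\<A> - 1) * d))"
  proof (rule mult_left_mono)
    have "d \<le> exp d - 1" using exp_ge_add_one_self[of d] by linarith
    hence "1 * d \<le> exp ((\<A> - 1) * d) * (exp d - 1)"
      using assms \<A> by (intro mult_mono) auto
    also have "\<dots> = exp (\<A> * d) - exp ((\<A> - 1) * d)" by (simp add: algebra_simps flip: exp_add)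
    finally show "d \<le> exp (\<A> * d) - exp ((\<A> - 1) * d)" by simp
  qed simp
  finally show ?thesis .
qed

text \<open>After one step the function has regularity \<open>\<A> - 1\<close> and is bounded below by a multiple of its
mean. The gap between \<open>\<A> - 1\<close> and \<open>\<A>\<close> leaves room to subtract the constant without leaving the cone \<open>\<A>\<close>.\<close>

lemma coupling:
  assumes "cone \<A> \<phi>"
  obtains \<phi>' where "cone \<A> \<phi>'" "(\<integral>x. \<phi>' x \<partial>LJ) = (\<integral>x. \<phi> x \<partial>LJ)"
    "\<And>x. x \<in> J \<Longrightarrow> L \<phi> x = \<epsilon> * ((\<integral>x. \<phi> x \<partial>LJ) / w) * 1 + (1 - \<epsilon>) * \<phi>' x"
proof -
  define I where "I = (\<integral>x. \<phi> x \<partial>LJ)"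
  have I: "0 \<le> I" unfolding I_def using bounded_nonneg_nonneg[OF cone_bnn[OF assms]] by (intro Bochner_Integration.integral_nonneg) auto
  have IL: "(\<integral>x. L \<phi> x \<partial>LJ) = I" unfolding I_def by (rule integral_L[OF cone_bnn[OF assms]])
  have c: "cone (\<A> - 1) (L \<phi>)" by (rule L_cone[OF assms])
  note b = cone_bnn[OF c]
  note [measurable] = bounded_nonneg_meas[OF b]
  \<comment> \<open>the constant to be split off has integral \<open>\<epsilon> * I\<close>\<close>
  define e where "e = \<epsilon> * (I / w)"
  have e: "0 \<le> e" using \<epsilon> I w by (simp add: e_def)
  have lower: "exp (- \<A>) * (I / w) \<le> L \<phi> x" if "x \<in> J" for x
  proof -
    have "I \<le> exp \<A> * L \<phi> x * w"
      using cone_lower[OF L_cone'[OF assms] _ that] \<A> by (simp add: IL)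
    hence "I / w \<le> exp \<A> * L \<phi> x" using w by (simp add: pos_divide_le_eq)
    thus ?thesis using mult_left_mono[of "I / w" "exp \<A> * L \<phi> x" "exp (- \<A>)"] by (simp add: mult.assoc[symmetric] exp_minus)
  qed
  have "\<epsilon> \<le> exp (- \<A>)"
  proof -
    have "\<epsilon> \<le> exp (- 2 * \<A>)" using \<A> by (simp add: \<epsilon>_def pos_divide_le_eq)
    also have "\<dots> \<le> exp (- \<A>)" using \<A> by simp
    finally show ?thesis .
  qed
  hence e_le: "e \<le> L \<phi> x" if "x \<in> J" for x
    using order_trans[OF mult_right_mono lower[OF that], of \<epsilon>] I w by (simp add: e_def)
  obtain B where B: "\<And>x. x \<in> J \<Longrightarrow> L \<phi> x \<le> B" using bounded_nonnegE[OF b] by blast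
  define \<phi>' where "\<phi>' x = (L \<phi> x - e) / (1 - \<epsilon>)" for x
  have b': "bounded_nonneg \<phi>'"
  proof (rule bounded_nonnegI)
    fix x assume x: "x \<in> J"
    show "0 \<le> \<phi>' x" "\<phi>' x \<le> B / (1 - \<epsilon>)" using e_le[OF x] B[OF x] e \<epsilon> by (auto simp: \<phi>'_def intro!: divide_right_mono)
  qed (simp add: \<phi>'_def[abs_def])
  have "cone \<A> \<phi>'"
  proof (rule coneI[OF b'])
    fix x y assume xy: "x \<in> J" "y \<in> J"
    let ?d = "hdist x y"
    have "e * (exp (\<A> * ?d) - 1) = \<epsilon> * (exp (\<A> * ?d) - 1) * (I / w)" by (simp add: e_def)
    also have "\<dots> \<le> exp (- \<A>) * (exp (\<A> * ?d) - exp ((\<A> - 1) * ?d)) * (I / w)"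
      using I w by (intro mult_right_mono exp_gap hdist xy) auto
    also have "\<dots> = (exp (\<A> * ?d) - exp ((\<A> - 1) * ?d)) * (exp (- \<A>) * (I / w))" by simp
    also have "\<dots> \<le> (exp (\<A> * ?d) - exp ((\<A> - 1) * ?d)) * L \<phi> y"
      using lower[OF xy(2)] hdist(1)[OF xy] by (intro mult_left_mono) (auto intro: mult_right_mono)
    finally have "L \<phi> x - e \<le> exp (\<A> * ?d) * (L \<phi> y - e)"
      using coneD[OF c xy] by (simp add: algebra_simps)
    thus "\<phi>' x \<le> exp (\<A> * ?d) * \<phi>' y" using \<epsilon> by (simp add: \<phi>'_def divide_right_mono)
  qed
  moreover have "(\<integral>x. \<phi>' x \<partial>LJ) = I"
  proof -
    have "(\<integral>x. \<phi>' x \<partial>LJ) = ((\<integral>x. L \<phi> x \<partial>LJ) - (\<integral>x. e \<partial>LJ)) / (1 - \<epsilon>)"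
      using bounded_nonneg_integrable[OF b] by (simp add: \<phi>'_def)
    also have "\<dots> = (I - \<epsilon> * I) / (1 - \<epsilon>)" using w unfolding IL integral_const_LJ by (simp add: e_def)
    also have "\<dots> = I" using \<epsilon> by (simp add: field_simps)
    finally show ?thesis .
  qed
  moreover have "L \<phi> x = \<epsilon> * (I / w) * 1 + (1 - \<epsilon>) * \<phi>' x" for x using \<epsilon> by (simp add: \<phi>'_def e_def)
  ultimately show thesis using that unfolding I_def by blast
qed

text \<open>Two functions with the same integral have the same constants split off by \<open>coupling\<close>. These
cancel in the difference, and what remains is multiplied by \<open>1 - \<epsilon>\<close> at each step.\<close>

lemma Ln_contraction:
  assumes "cone \<A> \<phi>" "cone \<A> \<psi>" "(\<integral>x. \<phi> x \<partial>LJ) = (\<integral>x. \<psi> x \<partial>LJ)" "x \<in> J"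
  shows "\<bar>(L ^^ n) \<phi> x - (L ^^ n) \<psi> x\<bar> \<le> (1 - \<epsilon>) ^ n * (exp \<A> * (\<integral>x. \<phi> x \<partial>LJ) / w)"
  using assms(1-3)
proof (induction n arbitrary: \<phi> \<psi>)
  case 0
  have "0 \<le> \<A>" using \<A> by simp
  note u = cone_upper[OF 0(1) this assms(4)] cone_upper[OF 0(2) this assms(4)]
  have "\<phi> x \<le> exp \<A> * (\<integral>x. \<phi> x \<partial>LJ) / w" "\<psi> x \<le> exp \<A> * (\<integral>x. \<phi> x \<partial>LJ) / w"
    using u w 0(3) by (auto simp: pos_le_divide_eq)
  thus ?case using bounded_nonneg_nonneg[OF cone_bnn[OF 0(1)] assms(4)] bounded_nonneg_nonneg[OF cone_bnn[OF 0(2)] assms(4)] by simp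
next
  case (Suc n)
  define c where "c = \<epsilon> * ((\<integral>x. \<phi> x \<partial>LJ) / w)"
  obtain \<phi>' where \<phi>': "cone \<A> \<phi>'" "(\<integral>x. \<phi>' x \<partial>LJ) = (\<integral>x. \<phi> x \<partial>LJ)"
    "\<And>x. x \<in> J \<Longrightarrow> L \<phi> x = c * 1 + (1 - \<epsilon>) * \<phi>' x" unfolding c_def using coupling[OF Suc.prems(1)] by blast
  obtain \<psi>' where \<psi>': "cone \<A> \<psi>'" "(\<integral>x. \<psi>' x \<partial>LJ) = (\<integral>x. \<psi> x \<partial>LJ)"
    "\<And>x. x \<in> J \<Longrightarrow> L \<psi> x = c * 1 + (1 - \<epsilon>) * \<psi>' x"
    unfolding c_def Suc.prems(3) using coupling[OF Suc.prems(2)] by blast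
  have b1: "bounded_nonneg (\<lambda>_. 1)" by (rule bounded_nonneg_const) simp
  have *: "(L ^^ Suc n) \<xi> x = c * (L ^^ n) (\<lambda>_. 1) x + (1 - \<epsilon>) * (L ^^ n) \<xi>' x"
    if "cone \<A> \<xi>'" "\<And>x. x \<in> J \<Longrightarrow> L \<xi> x = c * 1 + (1 - \<epsilon>) * \<xi>' x" for \<xi> \<xi>'
  proof -
    have "(L ^^ Suc n) \<xi> x = (L ^^ n) (L \<xi>) x" by (simp add: funpow_swap1)
    also have "\<dots> = (L ^^ n) (\<lambda>x. c * 1 + (1 - \<epsilon>) * \<xi>' x) x" using that assms(4) by (intro Ln_cong) auto
    also have "\<dots> = c * (L ^^ n) (\<lambda>_. 1) x + (1 - \<epsilon>) * (L ^^ n) \<xi>' x"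
      by (rule Ln_add_scale[OF b1 cone_bnn[OF that(1)] assms(4)])
    finally show ?thesis .
  qed
  have "(L ^^ Suc n) \<phi> x - (L ^^ Suc n) \<psi> x = (1 - \<epsilon>) * ((L ^^ n) \<phi>' x - (L ^^ n) \<psi>' x)"
    using *[OF \<phi>'(1,3)] *[OF \<psi>'(1,3)] by (simp add: right_diff_distrib)
  hence "\<bar>(L ^^ Suc n) \<phi> x - (L ^^ Suc n) \<psi> x\<bar> = (1 - \<epsilon>) * \<bar>(L ^^ n) \<phi>' x - (L ^^ n) \<psi>' x\<bar>"
    using \<epsilon> by (simp only: abs_mult)
  also have "\<dots> \<le> (1 - \<epsilon>) * ((1 - \<epsilon>) ^ n * (exp \<A> * (\<integral>x. \<phi>' x \<partial>LJ) / w))"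
    using \<epsilon> \<phi>' \<psi>' Suc.prems by (intro mult_left_mono Suc.IH) auto
  finally show ?case by (simp add: \<phi>')
qed

section \<open>The invariant density and the decay of correlations\<close>

text \<open>The invariant density; \<open>w\<close> normalises the limit, as the constant \<open>1\<close> has integral \<open>w\<close>.\<close>

definition h :: "real \<Rightarrow> real" where
  "h x = lim (\<lambda>n. (L ^^ n) (\<lambda>_. 1) x) / w"

lemma bounded_nonneg_one: "bounded_nonneg (\<lambda>_. 1)" by (rule bounded_nonneg_const) simp

lemma cone_one: "cone \<A> (\<lambda>_. 1)" using \<A> by (intro cone_const) auto

lemma integral_one: "(\<integral>x. 1 \<partial>LJ) = w" using integral_const_LJ[of 1] by simp

lemma Ln_one_Cauchy_bound:
  assumes "x \<in> J"
  shows "\<bar>(L ^^ (n + k)) (\<lambda>_. 1) x - (L ^^ n) (\<lambda>_. 1) x\<bar> \<le> (1 - \<epsilon>) ^ n * exp \<A>"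
proof -
  have "(L ^^ (n + k)) (\<lambda>_. 1) x = (L ^^ n) ((L ^^ k) (\<lambda>_. 1)) x" by (simp add: funpow_add)
  moreover have "\<bar>(L ^^ n) ((L ^^ k) (\<lambda>_. 1)) x - (L ^^ n) (\<lambda>_. 1) x\<bar>
      \<le> (1 - \<epsilon>) ^ n * (exp \<A> * (\<integral>x. (L ^^ k) (\<lambda>_. 1) x \<partial>LJ) / w)"
    by (intro Ln_contraction Ln_cone cone_one assms) (simp only: integral_Ln[OF bounded_nonneg_one])
  moreover have "(\<integral>x. (L ^^ k) (\<lambda>_. 1) x \<partial>LJ) = w" using integral_Ln[OF bounded_nonneg_one] integral_one by simp
  ultimately show ?thesis using w by simp
qed

text \<open>By \<open>Ln_contraction\<close> the iterates of the constant \<open>1\<close> form a Cauchy sequence, uniformly on \<open>J\<close>.\<close>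

lemma Ln_one_tendsto: assumes "x \<in> J" shows "(\<lambda>n. (L ^^ n) (\<lambda>_. 1) x) \<longlonglongrightarrow> w * h x"
proof -
  have "Cauchy (\<lambda>n. (L ^^ n) (\<lambda>_. 1) x)"
  proof (rule metric_CauchyI)
    fix e :: real assume "0 < e"
    have lim: "(\<lambda>n. (1 - \<epsilon>) ^ n * exp \<A>) \<longlonglongrightarrow> 0 * exp \<A>"
      using \<epsilon> by (intro tendsto_mult LIMSEQ_realpow_zero tendsto_const) auto
    have "\<forall>\<^sub>F n in sequentially. (1 - \<epsilon>) ^ n * exp \<A> < e / 2"
      using order_tendstoD(2)[OF lim, of "e / 2"] \<open>0 < e\<close> by simp
    then obtain N where N: "(1 - \<epsilon>) ^ N * exp \<A> < e / 2" by (auto simp: eventually_sequentially)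
    have *: "\<bar>(L ^^ n) (\<lambda>_. 1) x - (L ^^ N) (\<lambda>_. 1) x\<bar> < e / 2" if "N \<le> n" for n
      using Ln_one_Cauchy_bound[OF assms, of N "n - N"] that N by simp
    show "\<exists>M. \<forall>m\<ge>M. \<forall>n\<ge>M. dist ((L ^^ m) (\<lambda>_. 1) x) ((L ^^ n) (\<lambda>_. 1) x) < e"
    proof (intro exI[of _ N] allI impI)
      fix m n assume "N \<le> m" "N \<le> n"
      thus "dist ((L ^^ m) (\<lambda>_. 1) x) ((L ^^ n) (\<lambda>_. 1) x) < e"
        using *[of m] *[of n] unfolding dist_real_def by linarith
    qed
  qed
  hence "convergent (\<lambda>n. (L ^^ n) (\<lambda>_. 1) x)" by (simp add: Cauchy_convergent_iff)
  thus ?thesis using w by (simp add: h_def convergent_LIMSEQ_iff)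
qed

lemma Ln_one_close:
  assumes "x \<in> J" shows "\<bar>(L ^^ n) (\<lambda>_. 1) x - w * h x\<bar> \<le> (1 - \<epsilon>) ^ n * exp \<A>"
proof -
  have lim: "(\<lambda>k. \<bar>(L ^^ n) (\<lambda>_. 1) x - (L ^^ (k + n)) (\<lambda>_. 1) x\<bar>) \<longlonglongrightarrow> \<bar>(L ^^ n) (\<lambda>_. 1) x - w * h x\<bar>"
    by (intro tendsto_intros LIMSEQ_ignore_initial_segment Ln_one_tendsto assms)
  show ?thesis
    by (rule LIMSEQ_le_const2[OF lim]) (use Ln_one_Cauchy_bound[OF assms, of n] in \<open>auto simp: add.commute abs_minus_commute\<close>)
qed

lemma cone_h: "cone \<A> h"
proof (rule coneI)
  have nn: "0 \<le> h x" if "x \<in> J" for x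
  proof -
    have "0 \<le> w * h x"
      by (rule LIMSEQ_le_const[OF Ln_one_tendsto[OF that]]) (use bounded_nonneg_nonneg[OF Ln_bnn[OF bounded_nonneg_one] that] in auto)
    thus ?thesis using w by (simp add: zero_le_mult_iff)
  qed
  show "bounded_nonneg h"
  proof (rule bounded_nonnegI[OF _ nn])
    have [measurable]: "(L ^^ n) (\<lambda>_. 1) \<in> borel_measurable LJ" for n by (rule bounded_nonneg_meas[OF Ln_bnn[OF bounded_nonneg_one]])
    show "h \<in> borel_measurable LJ" unfolding h_def[abs_def] by measurable
    fix x assume x: "x \<in> J"
    show "h x \<le> (1 + exp \<A>) / w" using Ln_one_close[OF x, of 0] w by (simp add: field_simps)
  qed
  fix x y assume xy: "x \<in> J" "y \<in> J"
  have "w * h x \<le> exp (\<A> * hdist x y) * (w * h y)"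
    by (rule LIMSEQ_le[OF Ln_one_tendsto[OF xy(1)] tendsto_mult_left[OF Ln_one_tendsto[OF xy(2)]]])
      (use coneD[OF Ln_cone[OF cone_one] xy] in auto)
  thus "h x \<le> exp (\<A> * hdist x y) * h y" using w by (simp add: mult.left_commute)
qed

lemmas bounded_nonneg_h = cone_bnn[OF cone_h]

text \<open>Since \<open>L\<close> is linear and monotone, the uniform convergence of the iterates passes through it.\<close>

lemma L_h: assumes "x \<in> J" shows "L h x = h x"
proof -
  have s: "\<bar>L ((L ^^ n) (\<lambda>_. 1)) x - w * L h x\<bar> \<le> (1 - \<epsilon>) ^ n * exp \<A> * L (\<lambda>_. 1) x" for n
  proof -
    let ?\<phi> = "(L ^^ n) (\<lambda>_. 1)" and ?c = "(1 - \<epsilon>) ^ n * exp \<A>"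
    have c: "0 \<le> ?c" using \<epsilon> by simp
    have b: "bounded_nonneg ?\<phi>" by (rule Ln_bnn[OF bounded_nonneg_one])
    have *: "\<bar>?\<phi> y - w * h y\<bar> \<le> ?c" if "y \<in> J" for y by (rule Ln_one_close[OF that])
    have bn1: "bounded_nonneg (\<lambda>y. w * h y + ?c * 1)"
    proof -
      obtain B where B: "\<And>x. x \<in> J \<Longrightarrow> h x \<le> B" using bounded_nonnegE[OF bounded_nonneg_h] by blast
      note [measurable] = bounded_nonneg_meas[OF bounded_nonneg_h]
      show ?thesis
      proof (rule bounded_nonnegI)
        fix y assume "y \<in> J"
        thus "0 \<le> w * h y + ?c * 1" "w * h y + ?c * 1 \<le> w * B + ?c"
          using w c B bounded_nonneg_nonneg[OF bounded_nonneg_h] by (auto intro!: mult_left_mono add_nonneg_nonneg)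
      qed measurable
    qed
    have bn2: "bounded_nonneg (\<lambda>y. 1 * ?\<phi> y + ?c * 1)"
    proof -
      obtain B where B: "\<And>x. x \<in> J \<Longrightarrow> ?\<phi> x \<le> B" using bounded_nonnegE[OF b] by blast
      note [measurable] = bounded_nonneg_meas[OF b]
      show ?thesis
      proof (rule bounded_nonnegI)
        fix y assume y: "y \<in> J"
        show "0 \<le> 1 * ?\<phi> y + ?c * 1" "1 * ?\<phi> y + ?c * 1 \<le> B + ?c"
          using c B[OF y] bounded_nonneg_nonneg[OF b y] by auto
      qed measurable
    qed
    have bh: "bounded_nonneg (\<lambda>y. w * h y)" using bounded_nonneg_cmult[OF bounded_nonneg_h] w by simp
    have le1: "?\<phi> y \<le> w * h y + ?c * 1" "w * h y \<le> 1 * ?\<phi> y + ?c * 1" if "y \<in> J" for y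
      using *[OF that] by (auto simp: abs_le_iff)
    have "L ?\<phi> x \<le> L (\<lambda>y. w * h y + ?c * 1) x" using le1 by (intro L_mono b bn1 assms) auto
    also have "\<dots> = w * L h x + ?c * L (\<lambda>_. 1) x" by (rule L_add_scale[OF bounded_nonneg_h bounded_nonneg_one assms])
    finally have 1: "L ?\<phi> x \<le> w * L h x + ?c * L (\<lambda>_. 1) x" .
    have "w * L h x = L (\<lambda>y. w * h y + 0 * 1) x" using L_add_scale[OF bounded_nonneg_h bounded_nonneg_one assms, of w 0] by simp
    also have "\<dots> \<le> L (\<lambda>y. 1 * ?\<phi> y + ?c * 1) x" using le1 bh by (intro L_mono bn2 assms) auto
    also have "\<dots> = 1 * L ?\<phi> x + ?c * L (\<lambda>_. 1) x" by (rule L_add_scale[OF b bounded_nonneg_one assms])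
    finally show ?thesis using 1 by (simp add: abs_le_iff)
  qed
  have lim: "(\<lambda>n. (1 - \<epsilon>) ^ n * exp \<A> * L (\<lambda>_. 1) x) \<longlonglongrightarrow> 0"
    using \<epsilon> by (intro tendsto_mult_left_zero LIMSEQ_realpow_zero) auto
  have "(\<lambda>n. L ((L ^^ n) (\<lambda>_. 1)) x - w * L h x) \<longlonglongrightarrow> 0"
    by (rule Lim_null_comparison[OF _ lim]) (simp only: real_norm_def s eventually_True)
  hence "(\<lambda>n. L ((L ^^ n) (\<lambda>_. 1)) x) \<longlonglongrightarrow> w * L h x" by (rule LIM_zero_cancel)
  hence "(\<lambda>n. (L ^^ Suc n) (\<lambda>_. 1) x) \<longlonglongrightarrow> w * L h x" by simp
  moreover have "(\<lambda>n. (L ^^ Suc n) (\<lambda>_. 1) x) \<longlonglongrightarrow> w * h x"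
    by (rule LIMSEQ_Suc[OF Ln_one_tendsto[OF assms]])
  ultimately have "w * L h x = w * h x" by (rule LIMSEQ_unique)
  thus ?thesis using w by simp
qed

lemma Ln_h: "x \<in> J \<Longrightarrow> (L ^^ n) h x = h x"
proof (induction n arbitrary: x)
  case (Suc n)
  have "(L ^^ Suc n) h x = L ((L ^^ n) h) x" by simp
  also have "\<dots> = L h x" using Suc by (intro L_cong) auto
  finally show ?case using L_h[OF Suc.prems] by simp
qed simp

lemma integral_h: "(\<integral>x. h x \<partial>LJ) = 1"
proof -
  have "\<bar>w - w * (\<integral>x. h x \<partial>LJ)\<bar> \<le> (1 - \<epsilon>) ^ n * (exp \<A> * w)" for n
  proof -
    let ?\<phi> = "(L ^^ n) (\<lambda>_. 1)"
    note i = bounded_nonneg_integrable[OF Ln_bnn[OF bounded_nonneg_one]] bounded_nonneg_integrable[OF bounded_nonneg_h]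
    have eq: "w - w * (\<integral>x. h x \<partial>LJ) = (\<integral>x. ?\<phi> x - w * h x \<partial>LJ)"
      using i integral_Ln[OF bounded_nonneg_one] integral_one by simp
    have "\<bar>w - w * (\<integral>x. h x \<partial>LJ)\<bar> \<le> (\<integral>x. \<bar>?\<phi> x - w * h x\<bar> \<partial>LJ)"
      unfolding eq by (rule integral_abs_bound)
    also have "\<dots> \<le> (\<integral>x. (1 - \<epsilon>) ^ n * exp \<A> \<partial>LJ)"
    proof (rule integral_mono)
      have "integrable LJ (\<lambda>x. w * h x)" using i(2) by (rule integrable_mult_right)
      thus "integrable LJ (\<lambda>x. \<bar>?\<phi> x - w * h x\<bar>)"
        by (rule integrable_abs[OF Bochner_Integration.integrable_diff[OF i(1)]])
      show "\<bar>?\<phi> x - w * h x\<bar> \<le> (1 - \<epsilon>) ^ n * exp \<A>" if "x \<in> space LJ" for x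
        using Ln_one_close that by (simp only: space_LJ)
    qed simp
    finally show ?thesis by (simp only: integral_const_LJ mult.assoc)
  qed
  moreover have "(\<lambda>n. (1 - \<epsilon>) ^ n * (exp \<A> * w)) \<longlonglongrightarrow> 0"
    using \<epsilon> by (intro tendsto_mult_left_zero LIMSEQ_realpow_zero) auto
  ultimately have "\<bar>w - w * (\<integral>x. h x \<partial>LJ)\<bar> \<le> 0" by (intro LIMSEQ_le_const[of _ 0]) blast+
  thus ?thesis using w by simp
qed

lemma h_lower: "x \<in> J \<Longrightarrow> 1 \<le> exp \<A> * w * h x"
  using cone_lower[OF cone_h, of x] \<A> by (simp add: integral_h mult_ac)

lemma h_upper: "x \<in> J \<Longrightarrow> h x \<le> exp \<A> / w"
  using cone_upper[OF cone_h, of x] \<A> w by (simp add: integral_h field_simps)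

definition "N = density LJ (\<lambda>x. ennreal (h x))"

lemma h_meas [measurable]: "h \<in> borel_measurable LJ" by (rule bounded_nonneg_meas[OF bounded_nonneg_h])

lemma sets_N [measurable_cong, simp]: "sets N = sets LJ" by (simp add: N_def)

lemma space_N [simp]: "space N = J" by (simp add: N_def)

lemma h_nonneg: "x \<in> J \<Longrightarrow> 0 \<le> h x" by (rule bounded_nonneg_nonneg[OF bounded_nonneg_h])

lemma integral_N: assumes [measurable]: "g \<in> borel_measurable LJ" shows "(\<integral>x. g x \<partial>N) = (\<integral>x. h x * g x \<partial>LJ)"
  unfolding N_def using h_nonneg by (subst integral_density) auto

lemma integrable_N: "bounded_nonneg g \<Longrightarrow> integrable N g"
  using bounded_nonneg_integrable[OF bounded_nonneg_mult[OF bounded_nonneg_h]] h_nonneg bounded_nonneg_meas[of g]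
  unfolding N_def by (subst integrable_density) auto

lemma prob_space_N: "prob_space N"
proof
  have "emeasure N (space N) = (\<integral>\<^sup>+x. ennreal (h x) \<partial>LJ)"
    using sets.top[of LJ] unfolding N_def by (subst emeasure_density) (auto intro!: nn_integral_cong)
  also have "\<dots> = ennreal 1"
    using integral_h h_nonneg by (subst nn_integral_eq_integral) (auto intro!: bounded_nonneg_integrable bounded_nonneg_h)
  finally show "emeasure N (space N) = 1" by simp
qed

sublocale N: prob_space N by (rule prob_space_N)

lemma N_stationary: assumes "bounded_nonneg g" shows "(\<integral>x. g ((F ^^ n) x) \<partial>N) = (\<integral>x. g x \<partial>N)"
proof -
  have "(\<integral>x. g ((F ^^ n) x) \<partial>N) = (\<integral>x. h x * g ((F ^^ n) x) \<partial>LJ)"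
    by (rule integral_N[OF bounded_nonneg_meas[OF bounded_nonneg_comp[OF assms]]])
  also have "\<dots> = (\<integral>x. (L ^^ n) h x * g x \<partial>LJ)" by (rule transfer_duality_iterate[OF bounded_nonneg_h assms])
  also have "\<dots> = (\<integral>x. h x * g x \<partial>LJ)" by (intro Bochner_Integration.integral_cong) (auto simp: Ln_h)
  also have "\<dots> = (\<integral>x. g x \<partial>N)" by (rule integral_N[OF bounded_nonneg_meas[OF assms], symmetric])
  finally show ?thesis .
qed

lemma measure_LJ_le_N: assumes [measurable]: "A \<in> sets LJ" shows "measure LJ A \<le> exp \<A> * w * measure N A"
proof -
  have AJ: "A \<subseteq> J" using sets.sets_into_space[OF assms] by simp
  have b: "bounded_nonneg (indicator A)" by (rule bounded_nonnegI[of _ 1]) (auto simp: indicator_def)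
  have "measure LJ A = (\<integral>x. indicator A x \<partial>LJ)" using AJ by (simp add: Int_absorb2)
  also have "\<dots> \<le> (\<integral>x. exp \<A> * w * (h x * indicator A x) \<partial>LJ)"
    using h_lower by (intro integral_mono integrable_mult_right bounded_nonneg_integrable bounded_nonneg_mult bounded_nonneg_h b) (auto simp: indicator_def)
  also have "\<dots> = exp \<A> * w * (\<integral>x. indicator A x \<partial>N)"
    by (subst integral_N) auto
  also have "(\<integral>x. indicator A x \<partial>N) = measure N A" using AJ by (simp add: Int_absorb2)
  finally show ?thesis .
qed

lemma measure_N_le_LJ: assumes [measurable]: "A \<in> sets LJ" shows "measure N A \<le> exp \<A> / w * measure LJ A"
proof -
  have AJ: "A \<subseteq> J" using sets.sets_into_space[OF assms] by simp
  have b: "bounded_nonneg (indicator A)" by (rule bounded_nonnegI[of _ 1]) (auto simp: indicator_def)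
  have "measure N A = (\<integral>x. indicator A x \<partial>N)" using AJ by (simp add: Int_absorb2)
  also have "\<dots> = (\<integral>x. h x * indicator A x \<partial>LJ)"
    by (subst integral_N) auto
  also have "\<dots> \<le> (\<integral>x. exp \<A> / w * indicator A x \<partial>LJ)"
    using h_upper by (intro integral_mono integrable_mult_right bounded_nonneg_integrable bounded_nonneg_mult bounded_nonneg_h b) (auto simp: indicator_def)
  also have "\<dots> = exp \<A> / w * measure LJ A" using AJ by (simp add: Int_absorb2)
  finally show ?thesis .
qed

text \<open>The invariant probability and Lebesgue measure on \<open>J\<close> have the same null sets, and the
invariant measure of a set is that of its preimages under \<open>F\<close>.\<close>

lemma null_preimages:
  assumes N0: "N0 \<in> sets LJ" "measure LJ N0 = 0"
  shows "{y\<in>J. \<exists>j. (F ^^ j) y \<in> N0} \<in> sets LJ" "measure LJ {y\<in>J. \<exists>j. (F ^^ j) y \<in> N0} = 0"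
proof -
  have N0_sub: "N0 \<subseteq> J" using sets.sets_into_space[OF N0(1)] by simp
  have b: "bounded_nonneg (indicator N0)" using N0 by (intro bounded_nonnegI[of _ 1]) (auto simp: indicator_def)
  define E where "E j = {y\<in>J. (F ^^ j) y \<in> N0}" for j
  have E_eq: "E j = (F ^^ j) -` N0 \<inter> space LJ" for j by (auto simp: E_def)
  have E: "E j \<in> sets LJ" for j unfolding E_eq using F_iter_LJ N0(1) by (rule measurable_sets)
  have "measure N N0 \<le> exp \<A> / w * measure LJ N0" by (rule measure_N_le_LJ[OF N0(1)])
  hence N0': "measure N N0 = 0" using N0(2) by (simp add: measure_nonneg antisym)
  have "measure N (E j) = 0" for j
  proof -
    have "measure N (E j) = (\<integral>y. indicator (E j) y \<partial>N)"
      by (simp add: E_def Int_absorb2 subset_eq)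
    also have "\<dots> = (\<integral>y. indicator N0 ((F ^^ j) y) \<partial>N)"
      by (intro Bochner_Integration.integral_cong) (auto simp: indicator_def E_def)
    also have "\<dots> = (\<integral>y. indicator N0 y \<partial>N)" by (rule N_stationary[OF b])
    also have "\<dots> = measure N N0" using N0_sub by (simp add: Int_absorb2)
    finally show ?thesis using N0' by simp
  qed
  hence "E j \<in> null_sets N" for j using E by (auto simp: null_sets_def N.emeasure_eq_measure)
  hence U: "(\<Union>j. E j) \<in> null_sets N" by (rule null_sets_UN)
  have eq: "{y\<in>J. \<exists>j. (F ^^ j) y \<in> N0} = (\<Union>j. E j)" by (auto simp: E_def)
  show 1: "{y\<in>J. \<exists>j. (F ^^ j) y \<in> N0} \<in> sets LJ" unfolding eq using E by auto
  have "measure LJ (\<Union>j. E j) \<le> exp \<A> * w * measure N (\<Union>j. E j)" using 1 unfolding eq by (rule measure_LJ_le_N)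
  also have "measure N (\<Union>j. E j) = 0" using U by (simp add: measure_eq_0_null_sets)
  finally show "measure LJ {y\<in>J. \<exists>j. (F ^^ j) y \<in> N0} = 0" unfolding eq by (simp add: measure_nonneg antisym)
qed

text \<open>The condition relates values on one branch only, so such an observable may be unbounded and may
jump between branches, as the return time does.\<close>

definition branch_regular :: "(real \<Rightarrow> real) \<Rightarrow> bool" where
  "branch_regular q \<longleftrightarrow> (\<forall>i. \<forall>x\<in>J. \<forall>y\<in>J. q (H i x) \<le> exp (hdist x y) * q (H i y))"

text \<open>One application of \<open>L\<close> to \<open>h * q\<close> gives a function in the cone, with integral \<open>m\<close>. It can be
compared with \<open>m * h\<close>, which also lies in the cone and is fixed by \<open>L\<close>.\<close>

lemma correlation_decay:
  assumes q: "bounded_nonneg q" and reg: "branch_regular q"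
  defines "m \<equiv> (\<integral>x. q x \<partial>N)"
  shows "\<bar>(\<integral>x. q x * q ((F ^^ Suc l) x) \<partial>N) - m\<^sup>2\<bar> \<le> (1 - \<epsilon>) ^ l * (exp (2 * \<A>) * m\<^sup>2)"
proof -
  have mq: "m = (\<integral>x. h x * q x \<partial>LJ)" unfolding m_def by (rule integral_N[OF bounded_nonneg_meas[OF q]])
  have m0: "0 \<le> m" unfolding mq using h_nonneg bounded_nonneg_nonneg[OF q] by (intro Bochner_Integration.integral_nonneg) auto
  note bhq = bounded_nonneg_mult[OF bounded_nonneg_h q]
  have c1: "cone \<A> (L (\<lambda>x. h x * q x))"
  proof (rule cone_mono[OF L_cone_branchwise[OF bhq]])
    fix i x y assume xy: "x \<in> J" "y \<in> J"
    have "h (H i x) * q (H i x) \<le> (exp (\<theta> * \<A> * hdist x y) * h (H i y)) * (exp (hdist x y) * q (H i y))"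
      using reg xy bounded_nonneg_nonneg[OF q H_range[OF xy(1)]] h_nonneg[OF H_range[OF xy(2)]]
      by (intro mult_mono cone_branch cone_h) (auto simp: branch_regular_def)
    also have "\<dots> = (exp (\<theta> * \<A> * hdist x y) * exp (hdist x y)) * (h (H i y) * q (H i y))" by simp
    also have "exp (\<theta> * \<A> * hdist x y) * exp (hdist x y) = exp ((\<theta> * \<A> + 1) * hdist x y)"
      by (simp add: distrib_right flip: exp_add)
    finally show "h (H i x) * q (H i x) \<le> exp ((\<theta> * \<A> + 1) * hdist x y) * (h (H i y) * q (H i y))" .
  qed simp
  have c2: "cone \<A> (\<lambda>x. m * h x)" by (rule cone_scale[OF cone_h m0])
  have I: "(\<integral>x. L (\<lambda>x. h x * q x) x \<partial>LJ) = m" "(\<integral>x. m * h x \<partial>LJ) = m"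
    using integral_L[OF bhq] integral_h by (auto simp: mq)
  let ?\<phi> = "(L ^^ l) (L (\<lambda>x. h x * q x))"
  have close: "\<bar>?\<phi> x - m * h x\<bar> \<le> (1 - \<epsilon>) ^ l * (exp \<A> * m / w)" if "x \<in> J" for x
  proof -
    have "\<bar>?\<phi> x - (L ^^ l) (\<lambda>x. m * h x) x\<bar> \<le> (1 - \<epsilon>) ^ l * (exp \<A> * (\<integral>x. L (\<lambda>x. h x * q x) x \<partial>LJ) / w)"
      by (rule Ln_contraction[OF c1 c2 _ that]) (simp only: I)
    moreover have "(L ^^ l) (\<lambda>x. m * h x) x = m * h x"
      using Ln_add_scale[OF bounded_nonneg_h bounded_nonneg_one that, of l m 0] Ln_h[OF that] by simp
    ultimately show ?thesis by (simp only: I)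
  qed
  have b\<phi>: "bounded_nonneg ?\<phi>" by (intro Ln_bnn L_bnn bhq)
  note int1 = bounded_nonneg_integrable[OF bounded_nonneg_mult[OF b\<phi> q]] and int2 = bounded_nonneg_integrable[OF bhq] and int3 = bounded_nonneg_integrable[OF q]
  have "(\<integral>x. q x * q ((F ^^ Suc l) x) \<partial>N) = (\<integral>x. h x * (q x * q ((F ^^ Suc l) x)) \<partial>LJ)"
    by (rule integral_N[OF bounded_nonneg_meas[OF bounded_nonneg_mult[OF q bounded_nonneg_comp[OF q]]]])
  also have "\<dots> = (\<integral>x. (L ^^ Suc l) (\<lambda>x. h x * q x) x * q x \<partial>LJ)"
    using transfer_duality_iterate[OF bhq q, of "Suc l"] by (simp only: mult.assoc)
  also have "\<dots> = (\<integral>x. ?\<phi> x * q x \<partial>LJ)" by (simp only: funpow_Suc_right comp_def)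
  finally have "(\<integral>x. q x * q ((F ^^ Suc l) x) \<partial>N) - m\<^sup>2 = (\<integral>x. ?\<phi> x * q x \<partial>LJ) - m * (\<integral>x. h x * q x \<partial>LJ)"
    by (simp only: power2_eq_square mq[symmetric])
  also have "\<dots> = (\<integral>x. ?\<phi> x * q x - m * (h x * q x) \<partial>LJ)"
    using int1 int2 by simp
  finally have eq: "(\<integral>x. q x * q ((F ^^ Suc l) x) \<partial>N) - m\<^sup>2 = (\<integral>x. ?\<phi> x * q x - m * (h x * q x) \<partial>LJ)" .
  have "\<bar>(\<integral>x. q x * q ((F ^^ Suc l) x) \<partial>N) - m\<^sup>2\<bar> \<le> (\<integral>x. \<bar>?\<phi> x * q x - m * (h x * q x)\<bar> \<partial>LJ)"
    unfolding eq by (rule integral_abs_bound)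
  also have "\<dots> \<le> (\<integral>x. (1 - \<epsilon>) ^ l * (exp \<A> * m / w) * q x \<partial>LJ)"
  proof (rule integral_mono)
    fix x assume "x \<in> space LJ"
    hence x: "x \<in> J" by simp
    have "?\<phi> x * q x - m * (h x * q x) = (?\<phi> x - m * h x) * q x" by (simp only: left_diff_distrib mult.assoc)
    hence "\<bar>?\<phi> x * q x - m * (h x * q x)\<bar> = \<bar>?\<phi> x - m * h x\<bar> * q x"
      using bounded_nonneg_nonneg[OF q x] by (simp only: abs_mult abs_of_nonneg)
    also have "\<dots> \<le> (1 - \<epsilon>) ^ l * (exp \<A> * m / w) * q x"
      by (intro mult_right_mono close x bounded_nonneg_nonneg[OF q x])
    finally show "\<bar>?\<phi> x * q x - m * (h x * q x)\<bar> \<le> (1 - \<epsilon>) ^ l * (exp \<A> * m / w) * q x" .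
  qed (use int1 int2 int3 in auto)
  also have "\<dots> = (1 - \<epsilon>) ^ l * (exp \<A> * m / w) * (\<integral>x. q x \<partial>LJ)" by simp
  also have "\<dots> \<le> (1 - \<epsilon>) ^ l * (exp \<A> * m / w) * (exp \<A> * w * m)"
  proof (rule mult_left_mono)
    have "(\<integral>x. q x \<partial>LJ) \<le> (\<integral>x. exp \<A> * w * (h x * q x) \<partial>LJ)"
      using int2 int3
    proof (intro integral_mono integrable_mult_right)
      fix x assume "x \<in> space LJ"
      hence x: "x \<in> J" by simp
      show "q x \<le> exp \<A> * w * (h x * q x)"
        using mult_right_mono[OF h_lower[OF x] bounded_nonneg_nonneg[OF q x]] by (simp add: mult_ac)
    qed
    thus "(\<integral>x. q x \<partial>LJ) \<le> exp \<A> * w * m" by (simp add: mq)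
    show "0 \<le> (1 - \<epsilon>) ^ l * (exp \<A> * m / w)" using \<epsilon> m0 w by simp
  qed
  also have "\<dots> = (1 - \<epsilon>) ^ l * (exp \<A> * exp \<A> * m\<^sup>2)" using w by (simp add: power2_eq_square)
  also have "exp \<A> * exp \<A> = exp (2 * \<A>)" by (simp flip: exp_add)
  finally show ?thesis .
qed

text \<open>Linear growth of the variance follows from summable correlations. The bound by the second moment
of \<open>q\<close> is what matters, because \<open>q\<close> is used with a small support and large values.\<close>

lemma variance_birkhoff_le:
  assumes q: "bounded_nonneg q" and reg: "branch_regular q"
  defines "m \<equiv> (\<integral>x. q x \<partial>N)"
  shows "integrable N (\<lambda>x. ((\<Sum>j=s..<s+n. q ((F ^^ j) x)) - real n * m)\<^sup>2)"
    "(\<integral>x. ((\<Sum>j=s..<s+n. q ((F ^^ j) x)) - real n * m)\<^sup>2 \<partial>N) \<le> real n * ((1 + 2 * exp (2 * \<A>) / \<epsilon>) * (\<integral>x. (q x)\<^sup>2 \<partial>N))"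
proof -
  let ?q = "\<lambda>j x. q ((F ^^ j) x)"
  define V where "V = (\<integral>x. (q x)\<^sup>2 \<partial>N)"
  define c where "c = exp (2 * \<A>) * m\<^sup>2"
  have m0: "0 \<le> m" unfolding m_def using bounded_nonneg_nonneg[OF q] by (intro Bochner_Integration.integral_nonneg) auto
  have c0: "0 \<le> c" by (simp add: c_def)
  have bq2: "bounded_nonneg (\<lambda>x. (q x)\<^sup>2)" using bounded_nonneg_mult[OF q q] by (simp add: power2_eq_square)
  have iq: "integrable N (?q j)" for j by (intro integrable_N bounded_nonneg_comp q)
  have iqq: "integrable N (\<lambda>x. ?q i x * ?q j x)" for i j by (intro integrable_N bounded_nonneg_mult bounded_nonneg_comp q)
  have Eq: "(\<integral>x. ?q j x \<partial>N) = m" for j unfolding m_def by (rule N_stationary[OF q])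
  have mV: "m\<^sup>2 \<le> V"
  proof -
    have "0 \<le> N.variance q" by (rule N.variance_positive)
    also have "N.variance q = V - m\<^sup>2"
      unfolding V_def m_def using integrable_N[OF q] integrable_N[OF bq2] by (rule N.variance_eq)
    finally show ?thesis by simp
  qed
  have corr: "(\<integral>x. ?q i x * ?q (i + Suc l) x \<partial>N) - m\<^sup>2 \<le> (1 - \<epsilon>) ^ l * c" for i l
  proof -
    have "(\<integral>x. ?q i x * ?q (i + Suc l) x \<partial>N) = (\<integral>x. q ((F ^^ i) x) * q ((F ^^ Suc l) ((F ^^ i) x)) \<partial>N)"
      by (simp only: funpow_add[of "Suc l" i F] comp_def add.commute[of i "Suc l"])
    also have "\<dots> = (\<integral>x. q x * q ((F ^^ Suc l) x) \<partial>N)"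
      by (rule N_stationary[OF bounded_nonneg_mult[OF q bounded_nonneg_comp[OF q]]])
    finally show ?thesis using correlation_decay[OF q reg, of l] by (simp add: c_def m_def abs_le_iff)
  qed
  have geo: "(\<Sum>l<k. (1 - \<epsilon>) ^ l) \<le> 1 / \<epsilon>" for k
  proof -
    have "(\<Sum>l<k. (1 - \<epsilon>) ^ l) = (1 - (1 - \<epsilon>) ^ k) / \<epsilon>" using \<epsilon> by (subst sum_gp_strict) auto
    also have "\<dots> \<le> 1 / \<epsilon>" using \<epsilon> by (intro divide_right_mono) auto
    finally show ?thesis .
  qed
  let ?S = "\<lambda>n x. (\<Sum>j=s..<s+n. ?q j x) - real n * m"
  have int: "integrable N (\<lambda>x. (?S n x)\<^sup>2)" and iS: "integrable N (?S n)" and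
    iSZ: "integrable N (\<lambda>x. ?S n x * (?q j x - m))" for n j
  proof -
    have eq: "?S n x = (\<Sum>j=s..<s+n. ?q j x - m)" for n x by (simp add: sum_subtractf)
    have *: "integrable N (\<lambda>x. (?q i x - m) * (?q j x - m))" for i j
    proof -
      have "integrable N (\<lambda>x. ?q i x * ?q j x - m * ?q i x - m * ?q j x + m * m)"
        using iqq iq by (intro Bochner_Integration.integrable_add Bochner_Integration.integrable_diff integrable_mult_right) auto
      moreover have "(?q i x - m) * (?q j x - m) = ?q i x * ?q j x - m * ?q i x - m * ?q j x + m * m" for x
        by (simp add: algebra_simps)
      ultimately show ?thesis by simp
    qed
    show "integrable N (\<lambda>x. (?S n x)\<^sup>2)"
      unfolding eq power2_eq_square sum_product by (intro Bochner_Integration.integrable_sum *)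
    show "integrable N (?S n)" unfolding eq by (intro Bochner_Integration.integrable_sum Bochner_Integration.integrable_diff iq) simp
    show "integrable N (\<lambda>x. ?S n x * (?q j x - m))"
      unfolding eq sum_distrib_right by (intro Bochner_Integration.integrable_sum *)
  qed
  show "integrable N (\<lambda>x. (?S n x)\<^sup>2)" by (rule int)
  have cov_q: "(\<integral>x. (?q i x - m) * (?q j x - m) \<partial>N) = (\<integral>x. ?q i x * ?q j x \<partial>N) - m\<^sup>2" for i j
  proof -
    have "(\<integral>x. (?q i x - m) * (?q j x - m) \<partial>N) = (\<integral>x. ?q i x * ?q j x - m * ?q i x - m * ?q j x + m * m \<partial>N)"
      by (intro Bochner_Integration.integral_cong) (auto simp: algebra_simps)
    also have "\<dots> = (\<integral>x. ?q i x * ?q j x \<partial>N) - m * m - m * m + m * m"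
      using iqq[of i j] iq[of i] iq[of j] by (simp add: Eq N.prob_space[unfolded space_N])
    finally show ?thesis by (simp add: power2_eq_square)
  qed
  have cross: "(\<integral>x. ?S n x * (?q (s + n) x - m) \<partial>N) \<le> c / \<epsilon>" for n
  proof -
    have iqm: "integrable N (\<lambda>x. (?q i x - m) * (?q (s + n) x - m))" for i
    proof -
      have "integrable N (\<lambda>x. ?q i x * ?q (s+n) x - m * ?q i x - m * ?q (s+n) x + m * m)"
        using iqq iq by (intro Bochner_Integration.integrable_add Bochner_Integration.integrable_diff integrable_mult_right) auto
      moreover have "(?q i x - m) * (?q (s+n) x - m) = ?q i x * ?q (s+n) x - m * ?q i x - m * ?q (s+n) x + m * m" for x
        by (simp add: algebra_simps)
      ultimately show ?thesis by simp
    qed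
    have "(\<integral>x. ?S n x * (?q (s + n) x - m) \<partial>N) = (\<integral>x. (\<Sum>i=s..<s+n. (?q i x - m) * (?q (s + n) x - m)) \<partial>N)"
      by (intro Bochner_Integration.integral_cong) (simp_all add: sum_distrib_right[symmetric] sum_subtractf)
    also have "\<dots> = (\<Sum>i=s..<s+n. (\<integral>x. (?q i x - m) * (?q (s + n) x - m) \<partial>N))"
      by (intro Bochner_Integration.integral_sum iqm)
    also have "\<dots> \<le> (\<Sum>i=s..<s+n. (1 - \<epsilon>) ^ (s + n - Suc i) * c)"
    proof (rule sum_mono)
      fix i assume i: "i \<in> {s..<s+n}"
      thus "(\<integral>x. (?q i x - m) * (?q (s + n) x - m) \<partial>N) \<le> (1 - \<epsilon>) ^ (s + n - Suc i) * c"
        unfolding cov_q using corr[of i "s + n - Suc i"] by simp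
    qed
    also have "\<dots> = (\<Sum>l<n. (1 - \<epsilon>) ^ l) * c"
      unfolding sum_distrib_right
      by (rule sum.reindex_bij_witness[of _ "\<lambda>l. s + n - Suc l" "\<lambda>i. s + n - Suc i"]) auto
    also have "\<dots> \<le> 1 / \<epsilon> * c" by (intro mult_right_mono geo c0)
    finally show ?thesis by simp
  qed
  have "(\<integral>x. (?S n x)\<^sup>2 \<partial>N) \<le> real n * (V + 2 * (c / \<epsilon>))" for n
  proof (induction n)
    case 0
    show ?case by simp
  next
    case (Suc n)
    let ?Z = "\<lambda>x. ?q (s + n) x - m"
    have "?S (Suc n) x = ?S n x + ?Z x" for x by (simp add: algebra_simps)
    hence eq: "(?S (Suc n) x)\<^sup>2 = (?S n x)\<^sup>2 + 2 * (?S n x * ?Z x) + ?Z x * ?Z x" for x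
      by (simp only:) (simp add: power2_eq_square algebra_simps)
    have iZ: "integrable N (\<lambda>x. ?Z x * ?Z x)"
    proof -
      have "integrable N (\<lambda>x. ?q (s + n) x * ?q (s+n) x - m * ?q (s + n) x - m * ?q (s+n) x + m * m)"
        using iqq iq by (intro Bochner_Integration.integrable_add Bochner_Integration.integrable_diff integrable_mult_right) auto
      moreover have "?Z x * ?Z x = ?q (s + n) x * ?q (s+n) x - m * ?q (s + n) x - m * ?q (s+n) x + m * m" for x
        by (simp add: algebra_simps)
      ultimately show ?thesis by simp
    qed
    have EZ: "(\<integral>x. ?Z x * ?Z x \<partial>N) \<le> V"
    proof -
      have "(\<integral>x. ?q (s + n) x * ?q (s + n) x \<partial>N) = V"
        unfolding V_def power2_eq_square by (rule N_stationary[OF bounded_nonneg_mult[OF q q]])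
      thus ?thesis unfolding cov_q by simp
    qed
    have "(\<integral>x. (?S (Suc n) x)\<^sup>2 \<partial>N) = (\<integral>x. (?S n x)\<^sup>2 \<partial>N) + 2 * (\<integral>x. ?S n x * ?Z x \<partial>N) + (\<integral>x. ?Z x * ?Z x \<partial>N)"
      unfolding eq
      by (simp only: Bochner_Integration.integral_add int iSZ iZ Bochner_Integration.integrable_add integrable_mult_right integral_mult_right_zero)
    also have "\<dots> \<le> real n * (V + 2 * (c / \<epsilon>)) + 2 * (c / \<epsilon>) + V"
      using Suc cross[of n] EZ by (intro add_mono mult_left_mono) auto
    also have "\<dots> = real (Suc n) * (V + 2 * (c / \<epsilon>))"
      unfolding of_nat_Suc distrib_right[of 1] mult_1_left by linarith
    finally show ?case .
  qed
  also have "real n * (V + 2 * (c / \<epsilon>)) \<le> real n * ((1 + 2 * exp (2 * \<A>) / \<epsilon>) * V)"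
  proof (rule mult_left_mono)
    have "2 * (c / \<epsilon>) \<le> 2 * (exp (2 * \<A>) * V / \<epsilon>)"
      unfolding c_def using mV \<epsilon> by (intro mult_left_mono divide_right_mono) auto
    thus "V + 2 * (c / \<epsilon>) \<le> (1 + 2 * exp (2 * \<A>) / \<epsilon>) * V" by (simp add: distrib_right)
  qed simp
  finally show "(\<integral>x. (?S n x)\<^sup>2 \<partial>N) \<le> real n * ((1 + 2 * exp (2 * \<A>) / \<epsilon>) * (\<integral>x. (q x)\<^sup>2 \<partial>N))"
    by (simp only: V_def)
qed

section \<open>The variation of Birkhoff sums of the induced map\<close>

text \<open>The hypotheses of \<open>pvar_heavy_tailed_sums\<close> hold under the invariant probability for \<open>Q\<close> along
the orbit: cutting \<open>Q\<close> by the values of \<open>rt\<close> keeps it regular on branches. The result then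
passes to Lebesgue measure.\<close>

theorem birkhoff_pvar:
  fixes rt :: "real \<Rightarrow> nat" and Q :: "real \<Rightarrow> real" and \<alpha> p Ct CQ :: real
  assumes \<alpha>: "1 < \<alpha>" "\<alpha> < p" "p < 2" and Ct: "0 < Ct" and CQ: "0 \<le> CQ"
    and rt_meas [measurable]: "rt \<in> LJ \<rightarrow>\<^sub>M count_space UNIV"
    and rt1: "\<And>x. 1 \<le> rt x" and rtH: "\<And>i x y. x \<in> J \<Longrightarrow> y \<in> J \<Longrightarrow> rt (H i x) = rt (H i y)"
    and tail: "\<And>n. 1 \<le> n \<Longrightarrow> measure LJ {x\<in>J. n \<le> rt x} \<le> Ct * real n powr (- \<alpha>)"
    and Q_meas [measurable]: "Q \<in> borel_measurable LJ" and Q0: "\<And>x. 0 \<le> Q x"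
    and reg: "branch_regular Q" and QC: "\<And>x. x \<in> J \<Longrightarrow> Q x \<le> CQ * real (rt x)"
  shows "\<exists>m. ((\<forall>x\<in>J. 1 \<le> Q x) \<longrightarrow> 0 < m) \<and>
    bounded_in_prob LJ (\<lambda>n y R. pvar_le p (\<lambda>l. (\<Sum>j<l. Q ((F ^^ j) y)) - real l * m) n (R * real n powr (1/\<alpha>)))"
proof -
  define q where "q k x = (if 2 ^ k \<le> rt x \<and> rt x < 2 ^ (k + 1) then Q x else 0)" for k x
  define mk where "mk k = (\<integral>x. q k x \<partial>N)" for k
  define C2 where "C2 = exp \<A> / w * Ct"
  have C2: "0 < C2" using w Ct by (simp add: C2_def)
  have q_meas [measurable]: "q k \<in> borel_measurable LJ" for k unfolding q_def by measurable
  have q0: "0 \<le> q k x" for k x using Q0 by (simp add: q_def)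
  define T where "T n = {x\<in>J. n \<le> rt x}" for n
  have T_meas: "T n \<in> sets LJ" for n
  proof -
    have "{x\<in>space LJ. n \<le> rt x} \<in> sets LJ" by measurable
    thus ?thesis by (simp add: T_def)
  qed
  have Ntail: "measure N (T n) \<le> C2 * real n powr (- \<alpha>)" if "1 \<le> n" for n
  proof -
    have "measure N (T n) \<le> exp \<A> / w * measure LJ (T n)" by (rule measure_N_le_LJ[OF T_meas])
    also have "\<dots> \<le> exp \<A> / w * (Ct * real n powr (- \<alpha>))"
      using tail[OF that] w by (intro mult_left_mono) (auto simp: T_def)
    finally show ?thesis by (simp add: C2_def)
  qed
  have Tk: "measure N (T (2 ^ k)) \<le> C2 * 2 powr (- (real k * \<alpha>))" for k
    using Ntail[of "2 ^ k"] by (simp add: powr_realpow[symmetric] powr_powr)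
  have q_le: "q k x \<le> CQ * 2 ^ (k + 1) * indicator (T (2 ^ k)) x" if "x \<in> J" for k x
  proof (cases "2 ^ k \<le> rt x \<and> rt x < 2 ^ (k + 1)")
    case True
    have "real (rt x) \<le> real (2 ^ (k + 1))" using True by (simp only: of_nat_le_iff less_imp_le)
    hence "CQ * real (rt x) \<le> CQ * 2 ^ (k + 1)" using CQ by (intro mult_left_mono) auto
    thus ?thesis using True QC[OF that] that by (simp add: q_def T_def)
  qed (use CQ in \<open>auto simp: q_def\<close>)
  have bq: "bounded_nonneg (q k)" for k
  proof (rule bounded_nonnegI[OF q_meas q0])
    fix x assume x: "x \<in> J"
    show "q k x \<le> CQ * 2 ^ (k + 1)"
    proof (rule order_trans[OF q_le[OF x]])
      have "CQ * 2 ^ (k + 1) * indicator (T (2 ^ k)) x \<le> CQ * 2 ^ (k + 1) * 1"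
        using CQ by (intro mult_left_mono) (auto simp: indicator_def)
      thus "CQ * 2 ^ (k + 1) * indicator (T (2 ^ k)) x \<le> CQ * 2 ^ (k + 1)" by simp
    qed
  qed
  have reg_q: "branch_regular (q k)" for k
    unfolding branch_regular_def
  proof (intro allI ballI)
    fix i x y assume xy: "x \<in> J" "y \<in> J"
    show "q k (H i x) \<le> exp (hdist x y) * q k (H i y)"
      using reg xy rtH[OF xy, of i] unfolding branch_regular_def q_def by auto
  qed
  have b_ind: "bounded_nonneg (indicator (T n))" for n
    using T_meas by (intro bounded_nonnegI[of _ 1]) (auto simp: indicator_def)
  have int_ind: "(\<integral>x. indicator (T n) x \<partial>N) = measure N (T n)" for n
    using sets.sets_into_space[OF T_meas[of n]] by (simp add: Int_absorb2)
  have mk0: "0 \<le> mk k" for k unfolding mk_def using q0 by (intro Bochner_Integration.integral_nonneg)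
  have mk_le: "mk k \<le> (2 * CQ * C2) * 2 powr (- (real k * (\<alpha> - 1)))" for k
  proof -
    have "mk k \<le> (\<integral>x. CQ * 2 ^ (k + 1) * indicator (T (2 ^ k)) x \<partial>N)"
      unfolding mk_def using q_le integrable_N[OF bq] integrable_N[OF b_ind]
      by (intro integral_mono integrable_mult_right) auto
    also have "\<dots> = CQ * 2 ^ (k + 1) * measure N (T (2 ^ k))" by (simp only: integral_mult_right_zero int_ind)
    also have "\<dots> \<le> CQ * 2 ^ (k + 1) * (C2 * 2 powr (- (real k * \<alpha>)))"
      using CQ Tk by (intro mult_left_mono) auto
    also have "\<dots> = (2 * CQ * C2) * (2 powr (real k) * 2 powr (- (real k * \<alpha>)))" by (simp add: powr_realpow)
    also have "2 powr (real k) * 2 powr (- (real k * \<alpha>)) = 2 powr (- (real k * (\<alpha> - 1)))"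
      by (simp add: powr_add[symmetric] algebra_simps)
    finally show ?thesis .
  qed
  have sq_le: "(\<integral>x. (q k x)\<^sup>2 \<partial>N) \<le> (4 * CQ\<^sup>2 * C2) * 2 powr (real k * (2 - \<alpha>))" for k
  proof -
    have "(\<integral>x. (q k x)\<^sup>2 \<partial>N) \<le> (\<integral>x. (CQ * 2 ^ (k + 1))\<^sup>2 * indicator (T (2 ^ k)) x \<partial>N)"
    proof (rule integral_mono)
      show "integrable N (\<lambda>x. (q k x)\<^sup>2)"
        unfolding power2_eq_square by (intro integrable_N bounded_nonneg_mult bq)
      show "integrable N (\<lambda>x. (CQ * 2 ^ (k + 1))\<^sup>2 * indicator (T (2 ^ k)) x)"
        by (intro integrable_mult_right integrable_N b_ind)
      fix x assume "x \<in> space N"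
      hence "(q k x)\<^sup>2 \<le> (CQ * 2 ^ (k + 1) * indicator (T (2 ^ k)) x)\<^sup>2"
        using q_le q0 by (intro power_mono) auto
      thus "(q k x)\<^sup>2 \<le> (CQ * 2 ^ (k + 1))\<^sup>2 * indicator (T (2 ^ k)) x"
        by (auto simp: indicator_def split: if_splits)
    qed
    also have "\<dots> = (CQ * 2 ^ (k + 1))\<^sup>2 * measure N (T (2 ^ k))" by (simp only: integral_mult_right_zero int_ind)
    also have "\<dots> \<le> (CQ * 2 ^ (k + 1))\<^sup>2 * (C2 * 2 powr (- (real k * \<alpha>)))"
      using Tk by (intro mult_left_mono) auto
    also have "\<dots> = (4 * CQ\<^sup>2 * C2) * (2 powr (real k) * 2 powr (real k) * 2 powr (- (real k * \<alpha>)))"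
      by (simp add: powr_realpow power2_eq_square)
    also have "2 powr (real k) * 2 powr (real k) * 2 powr (- (real k * \<alpha>)) = 2 powr (real k * (2 - \<alpha>))"
      by (simp add: powr_add[symmetric] algebra_simps)
    finally show ?thesis .
  qed
  define K where "K = 1 + 2 * exp (2 * \<A>) / \<epsilon>"
  have K: "0 < K" using \<epsilon> unfolding K_def by (intro add_pos_nonneg) auto
  define C where "C = K * (4 * CQ\<^sup>2 * C2) + 2 * CQ * C2 + C2"
  have C: "0 < C" "C2 \<le> C" "2 * CQ * C2 \<le> C" "K * (4 * CQ\<^sup>2 * C2) \<le> C"
    using C2 K CQ by (auto simp: C_def add_nonneg_pos)
  have F_N: "(F ^^ j) \<in> N \<rightarrow>\<^sub>M LJ" for j using F_iter_LJ[of j] by (simp cong: measurable_cong_sets)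
  have bd: "bounded_in_prob N (\<lambda>n y R. pvar_le p (\<lambda>l. (\<Sum>j<l. Q ((F ^^ j) y)) - real l * suminf mk) n (R * real n powr (1/\<alpha>)))"
  proof (rule N.pvar_heavy_tailed_sums[where C = C and rt = "\<lambda>j y. rt ((F ^^ j) y)"])
    show "(\<lambda>y. Q ((F ^^ j) y)) \<in> borel_measurable N" for j by (rule measurable_compose[OF F_N Q_meas])
    show "(\<lambda>y. rt ((F ^^ j) y)) \<in> N \<rightarrow>\<^sub>M count_space UNIV" for j by (rule measurable_compose[OF F_N rt_meas])
    show "integrable N (\<lambda>y. ((\<Sum>j = s..<s + n. if 2 ^ k \<le> rt ((F ^^ j) y) \<and> rt ((F ^^ j) y) < 2 ^ (k + 1) then Q ((F ^^ j) y) else 0) - real n * mk k)\<^sup>2)" for k s n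
      using variance_birkhoff_le(1)[OF bq[of k] reg_q[of k], of s n] unfolding mk_def q_def .
    show "N.expectation (\<lambda>y. ((\<Sum>j = s..<s + n. if 2 ^ k \<le> rt ((F ^^ j) y) \<and> rt ((F ^^ j) y) < 2 ^ (k + 1) then Q ((F ^^ j) y) else 0) - real n * mk k)\<^sup>2)
        \<le> real n * (C * 2 powr (real k * (2 - \<alpha>)))" for k s n
    proof -
      have "K * (\<integral>x. (q k x)\<^sup>2 \<partial>N) \<le> K * ((4 * CQ\<^sup>2 * C2) * 2 powr (real k * (2 - \<alpha>)))"
        using K sq_le by (intro mult_left_mono) auto
      also have "\<dots> = (K * (4 * CQ\<^sup>2 * C2)) * 2 powr (real k * (2 - \<alpha>))" by simp
      also have "\<dots> \<le> C * 2 powr (real k * (2 - \<alpha>))" using C by (intro mult_right_mono) auto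
      finally have "real n * (K * (\<integral>x. (q k x)\<^sup>2 \<partial>N)) \<le> real n * (C * 2 powr (real k * (2 - \<alpha>)))"
        by (intro mult_left_mono) auto
      thus ?thesis using variance_birkhoff_le(2)[OF bq[of k] reg_q[of k], of s n]
        unfolding mk_def q_def K_def by linarith
    qed
    show "mk k \<le> C * 2 powr (- (real k * (\<alpha> - 1)))" for k
      by (rule order_trans[OF mk_le mult_right_mono[OF C(3)]]) simp
    show "N.prob {y \<in> space N. n \<le> rt ((F ^^ j) y)} \<le> C * real n powr (- \<alpha>)" if n: "1 \<le> n" for j n
    proof -
      have sub: "{y \<in> space N. n \<le> rt ((F ^^ j) y)} \<in> sets N"
        using measurable_compose[OF F_N[of j] rt_meas] by measurable
      have "N.prob {y \<in> space N. n \<le> rt ((F ^^ j) y)} = (\<integral>y. indicator {y \<in> space N. n \<le> rt ((F ^^ j) y)} y \<partial>N)"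
        using sets.sets_into_space[OF sub] by (simp add: Int_absorb2)
      also have "\<dots> = (\<integral>y. indicator (T n) ((F ^^ j) y) \<partial>N)"
        using F_iter_in by (intro Bochner_Integration.integral_cong) (auto simp: indicator_def T_def)
      also have "\<dots> = measure N (T n)" unfolding N_stationary[OF b_ind] by (rule int_ind)
      also have "\<dots> \<le> C2 * real n powr (- \<alpha>)" by (rule Ntail[OF n])
      also have "\<dots> \<le> C * real n powr (- \<alpha>)" using C by (intro mult_right_mono) auto
      finally show ?thesis .
    qed
  qed (use \<alpha> C Q0 rt1 mk0 in auto)
  have bd': "bounded_in_prob LJ (\<lambda>n y R. pvar_le p (\<lambda>l. (\<Sum>j<l. Q ((F ^^ j) y)) - real l * suminf mk) n (R * real n powr (1/\<alpha>)))"
    unfolding bounded_in_prob_def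
  proof (intro allI impI)
    fix e :: real assume e: "0 < e"
    have E: "0 < exp \<A> * w" using w by simp
    obtain R where R: "R > 0" "\<And>n. n \<ge> 1 \<Longrightarrow> \<exists>A\<in>sets N. measure N A \<le> e / (exp \<A> * w) \<and>
       (\<forall>y\<in>space N - A. pvar_le p (\<lambda>l. (\<Sum>j<l. Q ((F ^^ j) y)) - real l * suminf mk) n (R * real n powr (1/\<alpha>)))"
      using bd[unfolded bounded_in_prob_def, rule_format, OF divide_pos_pos[OF e E]] by blast
    show "\<exists>R>0. \<forall>n\<ge>1. \<exists>A\<in>sets LJ. measure LJ A \<le> e \<and>
       (\<forall>y\<in>space LJ - A. pvar_le p (\<lambda>l. (\<Sum>j<l. Q ((F ^^ j) y)) - real l * suminf mk) n (R * real n powr (1/\<alpha>)))"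
    proof (intro exI[of _ R] conjI allI impI R(1))
      fix n :: nat assume "1 \<le> n"
      then obtain A where A: "A \<in> sets N" "measure N A \<le> e / (exp \<A> * w)"
        "\<forall>y\<in>space N - A. pvar_le p (\<lambda>l. (\<Sum>j<l. Q ((F ^^ j) y)) - real l * suminf mk) n (R * real n powr (1/\<alpha>))"
        using R(2) by blast
      have "measure LJ A \<le> exp \<A> * w * measure N A" using A by (intro measure_LJ_le_N) simp
      also have "\<dots> \<le> exp \<A> * w * (e / (exp \<A> * w))" using A E by (intro mult_left_mono) auto
      also have "\<dots> = e" using E w by simp
      finally show "\<exists>A\<in>sets LJ. measure LJ A \<le> e \<and>
       (\<forall>y\<in>space LJ - A. pvar_le p (\<lambda>l. (\<Sum>j<l. Q ((F ^^ j) y)) - real l * suminf mk) n (R * real n powr (1/\<alpha>)))"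
        using A by (intro bexI[of _ A]) auto
    qed
  qed
  have pos: "0 < suminf mk" if Q1: "\<forall>x\<in>J. 1 \<le> Q x"
  proof -
    define B where "B k = {x\<in>space N. 2 ^ k \<le> rt x \<and> rt x < 2 ^ (k + 1)}" for k
    have rt_N: "rt \<in> N \<rightarrow>\<^sub>M count_space UNIV" using rt_meas by (simp cong: measurable_cong_sets)
    have B_meas: "B k \<in> sets N" for k unfolding B_def using rt_N by measurable
    have B_mk: "measure N (B k) \<le> mk k" for k
    proof -
      have "bounded_nonneg (indicator (B k))" using B_meas[of k] by (intro bounded_nonnegI[of _ 1]) (auto simp: indicator_def)
      hence "(\<integral>x. indicator (B k) x \<partial>N) \<le> mk k"
        unfolding mk_def
        by (rule integral_mono[OF integrable_N integrable_N[OF bq]]) (use Q1 Q0 in \<open>auto simp: B_def q_def indicator_def\<close>)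
      thus ?thesis using sets.sets_into_space[OF B_meas[of k]] by (simp add: Int_absorb2)
    qed
    have "\<exists>k. 0 < mk k"
    proof (rule ccontr)
      assume "\<not> ?thesis"
      hence "mk k = 0" for k using mk0[of k] by (metis less_eq_real_def)
      hence "measure N (B k) = 0" for k using B_mk[of k] by (metis measure_nonneg antisym)
      hence "B k \<in> null_sets N" for k using B_meas by (auto simp: null_sets_def N.emeasure_eq_measure)
      hence "(\<Union>k. B k) \<in> null_sets N" by (rule null_sets_UN)
      moreover have "(\<Union>k. B k) = space N"
      proof (intro equalityI subsetI)
        fix x assume "x \<in> space N"
        moreover obtain k where "2 ^ k \<le> rt x" "rt x < 2 ^ (k + 1)" using ex_power_ivl1[of 2 "rt x"] rt1[of x] by auto
        ultimately show "x \<in> (\<Union>k. B k)" unfolding B_def by blast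
      qed (auto simp: B_def)
      ultimately show False using N.emeasure_space_1 by (simp only: null_sets_def mem_Collect_eq) simp
    qed
    moreover have "summable mk"
      using suminf_tail_geometric_le(1)[of "\<alpha> - 1" mk "2 * CQ * C2"] \<alpha> mk0 mk_le by simp
    ultimately show ?thesis using mk0 suminf_pos2 by blast
  qed
  show ?thesis using bd' pos by blast
qed

end

section \<open>The neutral branch\<close>

text \<open>The neutral branch \<open>G\<close> with a fixed point at \<open>0\<close>; \<open>\<gamma>\<close> is \<open>1/\<alpha>\<close>, and \<open>c\<close> is the number of
branches of the intermittent map.\<close>

locale neutral_branch =
  fixes c \<gamma> :: real
  assumes c: "2 \<le> c" and \<gamma>: "1/2 \<le> \<gamma>" "\<gamma> < 1"
begin

definition G :: "real \<Rightarrow> real" where "G y = y * (1 + c powr \<gamma> * y powr \<gamma>)"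

definition G' :: "real \<Rightarrow> real" where "G' y = 1 + (1 + \<gamma>) * c powr \<gamma> * y powr \<gamma>"

lemma cpos: "0 < c" "0 < c powr \<gamma>" "1 \<le> c powr \<gamma>"
  using c \<gamma> ge_one_powr_ge_zero[of c \<gamma>] by auto

lemma G_0 [simp]: "G 0 = 0" by (simp add: G_def)

lemma G_deriv: assumes "0 < y" shows "(G has_real_derivative G' y) (at y)"
proof -
  have e: "y * y powr (\<gamma> - 1) = y powr \<gamma>" using assms by (simp add: powr_diff)
  have "1 * (1 + c powr \<gamma> * y powr \<gamma>) + (0 + c powr \<gamma> * (\<gamma> * y powr (\<gamma> - 1))) * y
    = 1 + c powr \<gamma> * y powr \<gamma> + c powr \<gamma> * \<gamma> * (y * y powr (\<gamma> - 1))" by simp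
  also have "\<dots> = G' y" unfolding e G'_def by (simp add: distrib_right)
  finally have eq: "1 * (1 + c powr \<gamma> * y powr \<gamma>) + (0 + c powr \<gamma> * (\<gamma> * y powr (\<gamma> - 1))) * y = G' y" .
  show ?thesis
    unfolding G_def[abs_def] eq[symmetric]
    by (rule DERIV_mult[OF DERIV_ident DERIV_add[OF DERIV_const DERIV_cmult[OF has_real_derivative_powr[OF assms]]]])
qed

lemma G'_ge_1: "0 \<le> y \<Longrightarrow> 1 \<le> G' y" using cpos \<gamma> by (simp add: G'_def)

lemma G'_mono: "0 \<le> x \<Longrightarrow> x \<le> y \<Longrightarrow> G' x \<le> G' y"
  unfolding G'_def using cpos \<gamma> by (intro add_left_mono mult_left_mono powr_mono2) auto

lemma G_strict: assumes "0 \<le> x" "x < y" shows "G x < G y"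
  unfolding G_def
proof (rule mult_strict_mono)
  show "x < y" by fact
  have "x powr \<gamma> < y powr \<gamma>" using assms \<gamma> by (intro powr_less_mono2) auto
  thus "1 + c powr \<gamma> * x powr \<gamma> < 1 + c powr \<gamma> * y powr \<gamma>" using cpos by simp
  show "0 < y" using assms by simp
  show "0 \<le> 1 + c powr \<gamma> * x powr \<gamma>" using cpos by simp
qed

lemma G_ge: "0 \<le> y \<Longrightarrow> y \<le> G y"
  using mult_left_mono[of 1 "1 + c powr \<gamma> * y powr \<gamma>" y] cpos by (simp add: G_def)

lemma G_gt: "0 < y \<Longrightarrow> y < G y"
  using mult_strict_left_mono[of 1 "1 + c powr \<gamma> * y powr \<gamma>" y] cpos by (simp add: G_def)

lemma G_cont: "continuous_on {0..} G"
  unfolding G_def using \<gamma> by (intro continuous_intros continuous_on_powr') auto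

lemma G_inv_c: "G (1/c) = 2/c"
proof -
  have "c powr \<gamma> * (1/c) powr \<gamma> = 1" using cpos by (simp add: powr_divide)
  thus ?thesis by (simp add: G_def)
qed

lemma G'_inv_c: "G' (1/c) \<le> 3"
proof -
  have "c powr \<gamma> * (1/c) powr \<gamma> = 1" using cpos by (simp add: powr_divide)
  thus ?thesis using \<gamma> by (simp add: G'_def mult.assoc)
qed

lemma powr_inv_c_le: "0 \<le> y \<Longrightarrow> y \<le> 1/c \<Longrightarrow> c powr \<gamma> * y powr \<gamma> \<le> 1"
proof -
  assume y: "0 \<le> y" "y \<le> 1/c"
  have "c powr \<gamma> * y powr \<gamma> \<le> c powr \<gamma> * (1/c) powr \<gamma>"
    using y cpos \<gamma> by (intro mult_left_mono powr_mono2) auto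
  also have "\<dots> = 1" using cpos by (simp add: powr_divide)
  finally show ?thesis .
qed

lemma G_le_2: "0 \<le> y \<Longrightarrow> y \<le> 1/c \<Longrightarrow> G y \<le> 2 * y"
  using mult_left_mono[of "1 + c powr \<gamma> * y powr \<gamma>" 2 y] powr_inv_c_le[of y] by (simp add: G_def)

definition g :: "real \<Rightarrow> real" where "g x = (THE y. 0 \<le> y \<and> G y = x)"

lemma g_ex1: assumes "0 \<le> x" shows "\<exists>!y. 0 \<le> y \<and> G y = x"
proof -
  obtain y where "0 \<le> y" "G y = x"
    using IVT'[of G 0 x x] assms G_ge[OF assms] continuous_on_subset[OF G_cont, of "{0..x}"] by auto
  moreover have "y = z" if "0 \<le> y" "0 \<le> z" "G y = G z" for y z
    using G_strict[of y z] G_strict[of z y] that by (cases y z rule: linorder_cases) auto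
  ultimately show ?thesis by blast
qed

lemma g_nonneg: "0 \<le> x \<Longrightarrow> 0 \<le> g x" and G_g: "0 \<le> x \<Longrightarrow> G (g x) = x"
  using theI'[OF g_ex1] unfolding g_def by auto

lemma g_G: "0 \<le> y \<Longrightarrow> g (G y) = y"
  unfolding g_def using g_ex1[of "G y"] G_ge[of y] by (intro the1_equality) auto

lemma g_pos: "0 < x \<Longrightarrow> 0 < g x"
  using g_nonneg[of x] G_g[of x] by (cases "g x = 0") auto

lemma g_less: "0 < x \<Longrightarrow> g x < x" using G_gt[OF g_pos[of x]] G_g[of x] by simp

lemma g_strict: assumes "0 \<le> x" "x < y" shows "g x < g y"
proof (rule ccontr)
  assume "\<not> ?thesis"
  hence "G (g y) \<le> G (g x)"
    using G_strict[of "g y" "g x"] g_nonneg[of y] assms by (cases "g y = g x") auto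
  thus False using G_g[of x] G_g[of y] assms by simp
qed

lemma g_2c: "g (2/c) = 1/c" using g_G[of "1/c"] G_inv_c cpos by simp

lemma g_deriv: assumes "0 < x" shows "(g has_real_derivative inverse (G' (g x))) (at x)"
proof (rule DERIV_inverse_function[where f = G and a = 0 and b = "x + 1"])
  show "(G has_real_derivative G' (g x)) (at (g x))" by (rule G_deriv[OF g_pos[OF assms]])
  show "G' (g x) \<noteq> 0" using G'_ge_1[of "g x"] g_nonneg[of x] assms by simp
  show "G (g y) = y" if "0 < y" "y < x + 1" for y using G_g that by simp
  have "isCont g (G (g x))"
  proof (rule isCont_inverse_function[where f = G and x = "g x" and d = "g x / 2"])
    show "0 < g x / 2" using g_pos[OF assms] by simp
    fix z assume "\<bar>z - g x\<bar> \<le> g x / 2"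
    hence z: "0 < z" using g_pos[OF assms] by linarith
    show "g (G z) = z" using z by (simp add: g_G)
    show "isCont G z" by (rule DERIV_isCont[OF G_deriv[OF z]])
  qed
  thus "isCont g x" using G_g assms by simp
qed (use assms in auto)

lemma gn_pos: "0 < x \<Longrightarrow> 0 < (g ^^ n) x" by (induction n) (auto intro: g_pos)

lemma gn_nonneg: "0 \<le> x \<Longrightarrow> 0 \<le> (g ^^ n) x" by (induction n) (auto intro: g_nonneg)

lemma gn_strict: "0 \<le> x \<Longrightarrow> x < y \<Longrightarrow> (g ^^ n) x < (g ^^ n) y"
proof (induction n)
  case (Suc n)
  have "0 \<le> (g ^^ n) x" using Suc.prems by (intro gn_nonneg)
  thus ?case using Suc by (auto intro: g_strict)
qed simp

lemma gn_mono: "0 \<le> x \<Longrightarrow> x \<le> y \<Longrightarrow> (g ^^ n) x \<le> (g ^^ n) y"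
  using gn_strict[of x y n] by (cases "x = y") auto

text \<open>The derivative of \<open>g ^^ n\<close>, by the chain rule.\<close>

fun slope :: "nat \<Rightarrow> real \<Rightarrow> real" where
  "slope 0 x = 1"
| "slope (Suc n) x = inverse (G' ((g ^^ Suc n) x)) * slope n x"

lemma gn_deriv: "0 < x \<Longrightarrow> ((g ^^ n) has_real_derivative slope n x) (at x)"
proof (induction n)
  case 0
  show ?case by (simp add: id_def)
next
  case (Suc n)
  have "(g has_real_derivative inverse (G' (g ((g ^^ n) x)))) (at ((g ^^ n) x))"
    by (rule g_deriv[OF gn_pos[OF Suc.prems]])
  from DERIV_chain2[OF this Suc.IH[OF Suc.prems]] show ?case by (simp add: comp_def)
qed

lemma gn_mvt:
  assumes "0 < x" "x < y"
  obtains z where "x < z" "z < y" "(g ^^ n) y - (g ^^ n) x = (y - x) * slope n z"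
proof -
  have "\<exists>z>x. z < y \<and> (g ^^ n) y - (g ^^ n) x = (y - x) * slope n z"
    by (rule MVT2[OF assms(2)]) (rule gn_deriv, use assms in linarith)
  thus thesis using that by blast
qed

lemma gn_cont: "continuous_on {0<..} (g ^^ n)"
  using gn_deriv by (intro DERIV_continuous_on) (auto intro: has_field_derivative_at_within)

lemma slope_pos: "0 < x \<Longrightarrow> 0 < slope n x"
proof (induction n)
  case (Suc n)
  have "1 \<le> G' ((g ^^ Suc n) x)" by (rule G'_ge_1[OF less_imp_le[OF gn_pos[OF Suc.prems]]])
  thus ?case using Suc by simp
qed simp

lemma slope_le_1: "0 < x \<Longrightarrow> slope n x \<le> 1"
proof (induction n)
  case (Suc n)
  have "1 \<le> G' ((g ^^ Suc n) x)" by (rule G'_ge_1[OF less_imp_le[OF gn_pos[OF Suc.prems]]])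
  hence "inverse (G' ((g ^^ Suc n) x)) \<le> 1" by (simp add: inverse_le_1_iff)
  hence "inverse (G' ((g ^^ Suc n) x)) * slope n x \<le> 1 * 1"
    using Suc slope_pos[OF Suc.prems, of n] by (intro mult_mono) auto
  thus ?case by simp
qed simp

lemma slope_cont: "continuous_on {0<..} (slope n)"
proof (induction n)
  case (Suc n)
  have "continuous_on {0<..} (\<lambda>x. G' ((g ^^ Suc n) x))"
    unfolding G'_def using \<gamma> by (intro continuous_intros continuous_on_powr' gn_cont) (auto intro: less_imp_le[OF gn_pos] simp del: funpow.simps)
  moreover have "G' ((g ^^ Suc n) x) \<noteq> 0" if "x \<in> {0<..}" for x
    using G'_ge_1[OF less_imp_le[OF gn_pos[of x "Suc n"]]] that by auto
  ultimately show ?case using Suc by (auto intro!: continuous_intros)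
qed simp

text \<open>The intervals \<open>(edge (Suc n), edge n)\<close> are the successive preimages of \<open>(1/c, 2/c)\<close> under \<open>G\<close>.\<close>

definition edge :: "nat \<Rightarrow> real" where "edge n = (g ^^ n) (2/c)"

lemma edge_pos: "0 < edge n" unfolding edge_def using cpos by (intro gn_pos) simp

lemma edge_Suc: "edge (Suc n) = g (edge n)" by (simp add: edge_def)

lemma edge_Suc': "edge (Suc n) = (g ^^ n) (1/c)"
  using g_2c by (simp add: edge_def funpow_swap1)

lemma edge_0: "edge 0 = 2/c" by (simp add: edge_def)

lemma edge_1: "edge (Suc 0) = 1/c" using edge_Suc'[of 0] by simp

lemma edge_decreasing: "edge (Suc n) < edge n" unfolding edge_Suc by (rule g_less[OF edge_pos])

lemma edge_antimono: "m \<le> n \<Longrightarrow> edge n \<le> edge m"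
  by (rule lift_Suc_antimono_le[of edge]) (auto intro: less_imp_le edge_decreasing)

lemma edge_le_double: "edge n \<le> 2 * edge (Suc n)"
proof -
  have "edge (Suc n) \<le> 1/c" using edge_antimono[of "Suc 0" "Suc n"] edge_1 by simp
  thus ?thesis using G_le_2[of "edge (Suc n)"] edge_pos[of "Suc n"] G_g[of "edge n"] edge_pos[of n] by (simp add: edge_Suc)
qed

lemma gn_in: assumes "1/c \<le> x" "x \<le> 2/c" shows "edge (Suc n) \<le> (g ^^ n) x" "(g ^^ n) x \<le> edge n"
  using gn_mono[of "1/c" x n] gn_mono[of x "2/c" n] assms cpos order_trans[OF _ assms(1), of 0]
  unfolding edge_Suc' by (auto simp: edge_def)

lemma gn_in_strict: assumes "1/c < x" "x < 2/c" shows "edge (Suc n) < (g ^^ n) x" "(g ^^ n) x < edge n"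
  using gn_strict[of "1/c" x n] gn_strict[of x "2/c" n] assms cpos order_less_trans[OF _ assms(1), of 0]
  unfolding edge_Suc' by (auto simp: edge_def)

text \<open>As \<open>G'\<close> is increasing, the quotient of the slopes at two points is bounded by a product of the
quotients \<open>G' (edge j) / G' (edge (Suc j))\<close>, which telescopes.\<close>

lemma slope_weak_distortion:
  assumes x: "1/c \<le> x" "x \<le> 2/c" and y: "1/c \<le> y" "y \<le> 2/c"
  shows "slope n x * G' (edge (Suc n)) \<le> 3 * slope n y"
proof (induction n)
  case 0
  show ?case using G'_inv_c by (simp add: edge_1)
next
  case (Suc n)
  have pos: "0 < x" "0 < y" using x(1) y(1) cpos by (auto intro: less_le_trans[of 0 "1/c"])
  note gn = gn_in[OF x, of "Suc n"] gn_in[OF y, of "Suc n"]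
  have 1: "G' (edge (Suc (Suc n))) \<le> G' ((g ^^ Suc n) x)"
    using gn edge_pos[of "Suc (Suc n)"] by (intro G'_mono) auto
  have 2: "G' ((g ^^ Suc n) y) \<le> G' (edge (Suc n))"
    using gn edge_pos[of "Suc (Suc n)"] by (intro G'_mono) auto
  have g1: "1 \<le> G' ((g ^^ Suc n) x)" "1 \<le> G' ((g ^^ Suc n) y)" "1 \<le> G' (edge (Suc n))"
    by (rule G'_ge_1[OF less_imp_le[OF gn_pos[OF pos(1)]]] G'_ge_1[OF less_imp_le[OF gn_pos[OF pos(2)]]]
        G'_ge_1[OF less_imp_le[OF edge_pos]])+
  have "slope (Suc n) x * G' (edge (Suc (Suc n))) = slope n x * (G' (edge (Suc (Suc n))) / G' ((g ^^ Suc n) x))"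
    by (simp add: divide_inverse)
  also have "\<dots> \<le> slope n x * 1" using 1 g1 slope_pos[OF pos(1), of n] by (intro mult_left_mono) auto
  also have "\<dots> = slope n x * G' (edge (Suc n)) / G' (edge (Suc n))" using g1 by simp
  also have "\<dots> \<le> 3 * slope n y / G' (edge (Suc n))" using Suc g1 by (intro divide_right_mono) auto
  also have "\<dots> \<le> 3 * slope n y / G' ((g ^^ Suc n) y)"
    using 2 g1 slope_pos[OF pos(2), of n] by (intro divide_left_mono) auto
  also have "\<dots> = 3 * slope (Suc n) y" by (simp add: divide_inverse)
  finally show ?case .
qed

lemma gn_diff_le:
  assumes x: "1/c \<le> x" and xy: "x < y" and y: "y \<le> 2/c"
  shows "(g ^^ n) y - (g ^^ n) x \<le> 3 * c * (edge n - edge (Suc n)) * (y - x)"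
proof -
  have c0: "0 < 1/c" using cpos by simp
  obtain z where z: "x < z" "z < y" "(g ^^ n) y - (g ^^ n) x = (y - x) * slope n z"
    using gn_mvt[OF less_le_trans[OF c0 x] xy] .
  have lt: "1/c < 2/c" using cpos by (simp add: divide_strict_right_mono)
  obtain z' where z': "1/c < z'" "z' < 2/c" "(g ^^ n) (2/c) - (g ^^ n) (1/c) = (2/c - 1/c) * slope n z'"
    using gn_mvt[OF c0 lt] .
  have "slope n z \<le> slope n z * G' (edge (Suc n))"
    using slope_pos[of z n] G'_ge_1[of "edge (Suc n)"] edge_pos[of "Suc n"] z x c0 by (simp add: less_imp_le)
  also have "\<dots> \<le> 3 * slope n z'" using x y z z' by (intro slope_weak_distortion) auto
  also have "slope n z' = c * (edge n - edge (Suc n))"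
    using z'(3) cpos unfolding edge_Suc' by (simp add: edge_def field_simps)
  finally have "(y - x) * slope n z \<le> (y - x) * (3 * (c * (edge n - edge (Suc n))))" using xy by (intro mult_left_mono) auto
  thus ?thesis using z(3) by (simp add: mult_ac)
qed

lemma powr_diff_bounds:
  assumes "0 < u" "u < v"
  shows "v powr \<gamma> - u powr \<gamma> \<le> \<gamma> * u powr (\<gamma> - 1) * (v - u)" "\<gamma> * v powr (\<gamma> - 1) * (v - u) \<le> v powr \<gamma> - u powr \<gamma>"
proof -
  have d: "((\<lambda>t. t powr \<gamma>) has_real_derivative \<gamma> * t powr (\<gamma> - 1)) (at t)" if "0 < t" for t :: real
    using that by (intro has_real_derivative_powr)
  have "\<exists>z>u. z < v \<and> v powr \<gamma> - u powr \<gamma> = (v - u) * (\<gamma> * z powr (\<gamma> - 1))"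
    by (rule MVT2[OF assms(2)]) (rule d, use assms in linarith)
  then obtain z where z: "u < z" "z < v" "v powr \<gamma> - u powr \<gamma> = (v - u) * (\<gamma> * z powr (\<gamma> - 1))"
    by blast
  have "z powr (\<gamma> - 1) \<le> u powr (\<gamma> - 1)" "v powr (\<gamma> - 1) \<le> z powr (\<gamma> - 1)"
    using z assms \<gamma> by (auto intro!: powr_mono2')
  hence "(v - u) * (\<gamma> * z powr (\<gamma> - 1)) \<le> (v - u) * (\<gamma> * u powr (\<gamma> - 1))" "(v - u) * (\<gamma> * v powr (\<gamma> - 1)) \<le> (v - u) * (\<gamma> * z powr (\<gamma> - 1))"
    using \<gamma> assms by (auto intro!: mult_left_mono)
  thus "v powr \<gamma> - u powr \<gamma> \<le> \<gamma> * u powr (\<gamma> - 1) * (v - u)" "\<gamma> * v powr (\<gamma> - 1) * (v - u) \<le> v powr \<gamma> - u powr \<gamma>"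
    using z(3) by (simp_all add: mult_ac)
qed

text \<open>The weak distortion bound compares \<open>g ^^ n\<close> with an affine map. Concavity then bounds the
difference of powers by the difference of powers of the edges, up to a
constant, since consecutive edges differ by a factor of at most two. These differences telescope over \<open>n\<close>.\<close>

lemma gn_powr_diff_le:
  assumes x: "1/c \<le> x" and xy: "x < y" and y: "y \<le> 2/c"
  shows "(g ^^ n) y powr \<gamma> - (g ^^ n) x powr \<gamma> \<le> 6 * c * (y - x) * (edge n powr \<gamma> - edge (Suc n) powr \<gamma>)"
proof -
  let ?u = "(g ^^ n) x" and ?v = "(g ^^ n) y" and ?a = "edge n" and ?b = "edge (Suc n)"
  have b0: "0 < ?b" by (rule edge_pos)
  have x0: "0 < x" using x cpos by (auto intro: less_le_trans[of 0 "1/c"])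
  have u: "?b \<le> ?u" using gn_in[of x n] x xy y by auto
  have uv: "?u < ?v" using gn_strict[of x y n] x0 xy by simp
  have "?v powr \<gamma> - ?u powr \<gamma> \<le> \<gamma> * ?u powr (\<gamma> - 1) * (?v - ?u)"
    using u b0 uv by (intro powr_diff_bounds) auto
  also have "\<dots> \<le> \<gamma> * ?b powr (\<gamma> - 1) * (3 * c * (?a - ?b) * (y - x))"
    using u b0 uv \<gamma> gn_diff_le[OF assms, of n] by (intro mult_mono powr_mono2') auto
  also have "\<dots> = 3 * c * (y - x) * (\<gamma> * ?b powr (\<gamma> - 1) * (?a - ?b))" by simp
  also have "\<dots> \<le> 3 * c * (y - x) * (2 * (?a powr \<gamma> - ?b powr \<gamma>))"
  proof (rule mult_left_mono)
    have "?b powr (\<gamma> - 1) \<le> 2 * ?a powr (\<gamma> - 1)"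
    proof -
      have "2 powr (-1) * ?b powr (\<gamma> - 1) \<le> 2 powr (\<gamma> - 1) * ?b powr (\<gamma> - 1)"
        using \<gamma> by (intro mult_right_mono powr_mono) auto
      also have "\<dots> = (2 * ?b) powr (\<gamma> - 1)" by (simp add: powr_mult)
      also have "\<dots> \<le> ?a powr (\<gamma> - 1)"
        using edge_le_double[of n] edge_pos[of n] \<gamma> by (intro powr_mono2') auto
      finally show ?thesis by (simp add: powr_minus)
    qed
    hence "\<gamma> * ?b powr (\<gamma> - 1) * (?a - ?b) \<le> \<gamma> * (2 * ?a powr (\<gamma> - 1)) * (?a - ?b)"
      using \<gamma> edge_decreasing[of n] by (intro mult_right_mono mult_left_mono) auto
    also have "\<dots> = 2 * (\<gamma> * ?a powr (\<gamma> - 1) * (?a - ?b))" by simp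
    also have "\<dots> \<le> 2 * (?a powr \<gamma> - ?b powr \<gamma>)"
      using powr_diff_bounds(2)[OF b0 edge_decreasing[of n]] by simp
    finally show "\<gamma> * ?b powr (\<gamma> - 1) * (?a - ?b) \<le> 2 * (?a powr \<gamma> - ?b powr \<gamma>)" .
  qed (use cpos xy in auto)
  also have "\<dots> = 6 * c * (y - x) * (?a powr \<gamma> - ?b powr \<gamma>)" by (simp add: algebra_simps)
  finally show ?thesis .
qed

text \<open>The logarithm of \<open>G'\<close> varies at most as much as \<open>G'\<close>, because \<open>G' \<ge> 1\<close>, and \<open>G'\<close> is affine in \<open>y powr \<gamma>\<close>.\<close>

lemma slope_distortion_less:
  assumes x: "1/c \<le> x" and xy: "x < y" and y: "y \<le> 2/c"
  shows "slope n x \<le> exp ((1 + \<gamma>) * c powr \<gamma> * (6 * c * (y - x)) * (edge (Suc 0) powr \<gamma> - edge (Suc n) powr \<gamma>)) * slope n y"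
proof (induction n)
  case 0
  show ?case by simp
next
  case (Suc n)
  let ?K = "(1 + \<gamma>) * c powr \<gamma>" and ?L = "6 * c * (y - x)"
  let ?u = "(g ^^ Suc n) x" and ?v = "(g ^^ Suc n) y"
  have x0: "0 < x" using x cpos by (auto intro: less_le_trans[of 0 "1/c"])
  have y0: "0 < y" using x0 xy by simp
  have g1: "1 \<le> G' ?u" "1 \<le> G' ?v" 
    by (rule G'_ge_1[OF less_imp_le[OF gn_pos[OF x0]]] G'_ge_1[OF less_imp_le[OF gn_pos[OF y0]]])+
  define d where "d = ?K * (?L * (edge (Suc n) powr \<gamma> - edge (Suc (Suc n)) powr \<gamma>))"
  have "G' ?v - G' ?u = ?K * (?v powr \<gamma> - ?u powr \<gamma>)" by (simp add: G'_def algebra_simps)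
  also have "\<dots> \<le> d" unfolding d_def
    using gn_powr_diff_le[OF assms, of "Suc n"] cpos \<gamma> by (intro mult_left_mono) auto
  finally have diff: "G' ?v \<le> G' ?u + d" by simp
  have "G' ?v / G' ?u \<le> exp d"
  proof -
    have uv: "?u < ?v" using gn_strict[of x y "Suc n"] x0 xy by simp
    have "edge (Suc (Suc n)) powr \<gamma> \<le> edge (Suc n) powr \<gamma>"
      using edge_decreasing[of "Suc n"] edge_pos[of "Suc (Suc n)"] \<gamma> by (intro powr_mono2) auto
    hence d0: "0 \<le> d" unfolding d_def using cpos \<gamma> xy by auto
    have "G' ?v \<le> G' ?u + d * G' ?u" using diff d0 g1 mult_left_mono[of 1 "G' ?u" d] by simp
    hence "G' ?v / G' ?u \<le> 1 + d" using g1 by (simp add: pos_divide_le_eq algebra_simps)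
    also have "\<dots> \<le> exp d" by (rule exp_ge_add_one_self)
    finally show ?thesis .
  qed
  hence "inverse (G' ?u) \<le> exp d * inverse (G' ?v)" using g1 by (simp add: field_simps)
  hence "slope (Suc n) x \<le> (exp d * inverse (G' ?v)) * (exp (?K * ?L * (edge (Suc 0) powr \<gamma> - edge (Suc n) powr \<gamma>)) * slope n y)"
    unfolding slope.simps using Suc g1 slope_pos[OF x0, of n] by (intro mult_mono) auto
  also have "\<dots> = (exp d * exp (?K * ?L * (edge (Suc 0) powr \<gamma> - edge (Suc n) powr \<gamma>))) * slope (Suc n) y" by simp
  also have "exp d * exp (?K * ?L * (edge (Suc 0) powr \<gamma> - edge (Suc n) powr \<gamma>)) = exp (?K * ?L * (edge (Suc 0) powr \<gamma> - edge (Suc (Suc n)) powr \<gamma>))"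
    unfolding d_def by (simp add: algebra_simps flip: exp_add)
  finally show ?case .
qed

lemma slope_distortion:
  assumes x: "1/c \<le> x" "x \<le> 2/c" and y: "1/c \<le> y" "y \<le> 2/c"
  shows "slope n x \<le> exp (12 * c * \<bar>x - y\<bar>) * slope n y"
proof (cases x y rule: linorder_cases)
  case less
  have x0: "0 < x" using x cpos by (auto intro: less_le_trans[of 0 "1/c"])
  have y0: "0 < y" using x0 less by simp
  have "c powr \<gamma> * (edge (Suc 0) powr \<gamma> - edge (Suc n) powr \<gamma>) \<le> c powr \<gamma> * edge (Suc 0) powr \<gamma>"
    using cpos by (intro mult_left_mono) auto
  also have "\<dots> \<le> 1" using powr_inv_c_le[of "1/c"] cpos by (simp add: edge_1)
  finally have 1: "c powr \<gamma> * (edge (Suc 0) powr \<gamma> - edge (Suc n) powr \<gamma>) \<le> 1" .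
  have "(1 + \<gamma>) * c powr \<gamma> * (6 * c * (y - x)) * (edge (Suc 0) powr \<gamma> - edge (Suc n) powr \<gamma>)
      = ((1 + \<gamma>) * (6 * c * (y - x))) * (c powr \<gamma> * (edge (Suc 0) powr \<gamma> - edge (Suc n) powr \<gamma>))" by simp
  also have "\<dots> \<le> ((1 + \<gamma>) * (6 * c * (y - x))) * 1"
    using 1 \<gamma> cpos less by (intro mult_left_mono) auto
  also have "\<dots> \<le> (2 * (6 * c * (y - x))) * 1"
    using \<gamma> cpos less by (intro mult_right_mono) auto
  finally have "exp ((1 + \<gamma>) * c powr \<gamma> * (6 * c * (y - x)) * (edge (Suc 0) powr \<gamma> - edge (Suc n) powr \<gamma>)) \<le> exp (12 * c * \<bar>x - y\<bar>)"
    using less by simp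
  hence "exp ((1 + \<gamma>) * c powr \<gamma> * (6 * c * (y - x)) * (edge (Suc 0) powr \<gamma> - edge (Suc n) powr \<gamma>)) * slope n y \<le> exp (12 * c * \<bar>x - y\<bar>) * slope n y"
    using slope_pos[OF y0, of n] by (intro mult_right_mono) auto
  thus ?thesis using slope_distortion_less[OF x(1) less y(2), of n] by linarith
next
  case equal
  thus ?thesis by simp
next
  case greater
  have y0: "0 < y" using y cpos by (auto intro: less_le_trans[of 0 "1/c"])
  have x0: "0 < x" using y0 greater by simp
  have "slope n x \<le> slope n y"
  proof (induction n)
    case (Suc n)
    have "(g ^^ Suc n) y \<le> (g ^^ Suc n) x" using greater y0 by (intro gn_mono) auto
    hence "G' ((g ^^ Suc n) y) \<le> G' ((g ^^ Suc n) x)" using gn_pos[OF y0, of "Suc n"] by (intro G'_mono) auto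
    moreover have "1 \<le> G' ((g ^^ Suc n) y)" by (rule G'_ge_1[OF less_imp_le[OF gn_pos[OF y0]]])
    ultimately have "inverse (G' ((g ^^ Suc n) x)) \<le> inverse (G' ((g ^^ Suc n) y))" by (intro le_imp_inverse_le) auto
    moreover have "0 \<le> inverse (G' ((g ^^ Suc n) y))" using \<open>1 \<le> G' ((g ^^ Suc n) y)\<close> by simp
    ultimately show ?case unfolding slope.simps using Suc slope_pos[OF x0, of n] by (intro mult_mono) auto
  qed simp
  also have "\<dots> \<le> exp (12 * c * \<bar>x - y\<bar>) * slope n y"
    using slope_pos[OF y0, of n] cpos by simp
  finally show ?thesis .
qed

lemma gn_nonexpanding: assumes "0 < x" "0 < y" shows "\<bar>(g ^^ n) x - (g ^^ n) y\<bar> \<le> \<bar>x - y\<bar>"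
proof -
  have *: "\<bar>(g ^^ n) x - (g ^^ n) y\<bar> \<le> \<bar>x - y\<bar>" if xy: "0 < x" "x < y" for x y
  proof -
    obtain z where z: "x < z" "z < y" "(g ^^ n) y - (g ^^ n) x = (y - x) * slope n z"
      using gn_mvt[OF xy] .
    have z0: "0 < z" using z xy by simp
    have "(y - x) * slope n z \<le> (y - x) * 1" using slope_le_1[OF z0, of n] xy by (intro mult_left_mono) auto
    thus ?thesis using z(3) gn_strict[of x y n] xy by simp
  qed
  show ?thesis using *[of x y] *[of y x] assms by (cases x y rule: linorder_cases) (auto simp: abs_minus_commute)
qed

text \<open>Near the neutral fixed point \<open>y powr - \<gamma>\<close> is the natural coordinate: each step of \<open>g\<close> adds
about a constant to it, and at least \<open>1/4\<close> along the edges. The exponent is at least \<open>1/2\<close>, so it is enough to estimate an inverse square root.\<close>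

lemma edge_powr_grows: "real n / 4 \<le> edge n powr (- \<gamma>)"
proof (induction n)
  case (Suc n)
  let ?y = "edge (Suc n)"
  define s where "s = c powr \<gamma> * ?y powr \<gamma>"
  have y0: "0 < ?y" by (rule edge_pos)
  have "?y \<le> 1/c" using edge_antimono[of "Suc 0" "Suc n"] edge_1 by simp
  hence s: "0 < s" "s \<le> 1" using powr_inv_c_le[of ?y] y0 cpos by (auto simp: s_def)
  have eq: "edge n = ?y * (1 + s)" using G_g[of "edge n"] edge_pos[of n] by (simp add: edge_Suc[symmetric] G_def s_def)
  have "(1 + s) powr (- \<gamma>) \<le> (1 + s) powr (- (1/2))" using \<gamma> s by (intro powr_mono) auto
  also have "(1 + s) powr (- (1/2)) = 1 / sqrt (1 + s)" using s by (simp add: powr_minus_divide powr_half_sqrt)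
  also have "\<dots> \<le> 1 - s / 4"
  proof -
    define t where "t = s / 4"
    have t: "0 \<le> t" "t \<le> 1/4" and st: "s = 4 * t" using s by (auto simp: t_def)
    have "(1 + s) * (1 - t)\<^sup>2 = 1 + t * (2 - 7 * t + 4 * t\<^sup>2)"
      by (simp add: st power2_eq_square algebra_simps)
    moreover have "0 \<le> t * (2 - 7 * t + 4 * t\<^sup>2)" using t by (intro mult_nonneg_nonneg add_nonneg_nonneg) auto
    ultimately have "1 \<le> (1 + s) * (1 - t)\<^sup>2" by linarith
    hence "sqrt 1 \<le> sqrt ((1 + s) * (1 - t)\<^sup>2)" by (rule real_sqrt_le_mono)
    also have "sqrt ((1 + s) * (1 - t)\<^sup>2) = sqrt (1 + s) * (1 - t)" using t by (simp add: real_sqrt_mult)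
    finally have "1 \<le> (1 - s / 4) * sqrt (1 + s)" by (simp add: t_def mult.commute)
    thus ?thesis using s by (simp add: pos_divide_le_eq)
  qed
  finally have le: "(1 + s) powr (- \<gamma>) \<le> 1 - s / 4" .
  have "edge n powr (- \<gamma>) = ?y powr (- \<gamma>) * (1 + s) powr (- \<gamma>)"
    unfolding eq by (rule powr_mult)
  also have "\<dots> \<le> ?y powr (- \<gamma>) * (1 - s / 4)" using le by (rule mult_left_mono) simp
  also have "\<dots> = ?y powr (- \<gamma>) - ?y powr (- \<gamma>) * ?y powr \<gamma> * (c powr \<gamma> / 4)"
    unfolding s_def right_diff_distrib by simp
  also have "?y powr (- \<gamma>) * ?y powr \<gamma> = 1" using y0 by (simp flip: powr_add)
  finally have "edge n powr (- \<gamma>) + 1/4 \<le> ?y powr (- \<gamma>)" using cpos by simp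
  thus ?case using Suc by simp
qed simp

lemma edge_le: assumes "1 \<le> n" shows "edge n \<le> (real n / 4) powr (- (1/\<gamma>))"
proof -
  have "(edge n powr (- \<gamma>)) powr (- (1/\<gamma>)) \<le> (real n / 4) powr (- (1/\<gamma>))"
    using assms \<gamma> edge_powr_grows[of n] by (intro powr_mono2') auto
  thus ?thesis using \<gamma> edge_pos[of n] by (simp add: powr_powr)
qed

lemma edge_interval:
  assumes "0 < z" "z < 2/c" "\<And>n. z \<noteq> edge n"
  obtains n y where "1/c < y" "y < 2/c" "z = (g ^^ n) y"
proof -
  have "\<exists>n. edge n < z"
  proof -
    obtain n :: nat where n: "4 * z powr (- \<gamma>) < real n" using reals_Archimedean2 by blast
    have "z powr (- \<gamma>) < edge n powr (- \<gamma>)" using n edge_powr_grows[of n] by simp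
    have "edge n < z"
    proof (rule ccontr)
      assume "\<not> edge n < z"
      hence "edge n powr (- \<gamma>) \<le> z powr (- \<gamma>)" using assms(1) \<gamma> by (intro powr_mono2') auto
      thus False using \<open>z powr (- \<gamma>) < edge n powr (- \<gamma>)\<close> by simp
    qed
    thus ?thesis by blast
  qed
  \<comment> \<open>\<open>z\<close> lies between the first edge below it and the preceding one\<close>
  define k where "k = (LEAST n. edge n < z)"
  have k: "edge k < z" unfolding k_def by (rule LeastI_ex) fact
  have "k \<noteq> 0"
  proof
    assume "k = 0"
    thus False using k edge_0 assms(2) by simp
  qed
  then obtain n where n: "k = Suc n" by (cases k) auto
  have "\<not> edge n < z" using not_less_Least[of n "\<lambda>n. edge n < z"] n by (simp add: k_def)
  hence zn: "z < edge n" using assms(3)[of n] by simp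
  have c0: "0 < 1/c" "1/c \<le> 2/c" using cpos by (auto intro: divide_right_mono)
  have "continuous_on {1/c..2/c} (g ^^ n)" 
    using less_le_trans[OF c0(1)] by (intro continuous_on_subset[OF gn_cont]) auto
  then obtain y where y: "1/c \<le> y" "y \<le> 2/c" "(g ^^ n) y = z"
    using IVT'[of "g ^^ n" "1/c" z "2/c"] k zn c0 unfolding n edge_Suc' by (auto simp: edge_def)
  have "y \<noteq> 1/c" "y \<noteq> 2/c" using y(3) k zn unfolding n edge_Suc' by (auto simp: edge_def)
  thus thesis using that[of y n] y by auto
qed

end

section \<open>The inducing scheme of the intermittent maps\<close>

text \<open>Both maps at once: \<open>c\<close> is \<open>2\<close> for the first and \<open>3\<close> for the second. The points of \<open>(1/c, 2/c)\<close> are mapped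
affinely onto the unit interval, spend \<open>e i\<close> steps near a neutral fixed point, and return. The
flag \<open>mirrored i\<close> tells whether this fixed point is \<open>1\<close> rather than \<open>0\<close>.\<close>

locale intermittent = neutral_branch c \<gamma> for c \<gamma> :: real +
  fixes f :: "real \<Rightarrow> real" and e :: "nat \<Rightarrow> nat" and mirrored :: "nat \<Rightarrow> bool"
  assumes f_meas [measurable]: "f \<in> borel_measurable borel"
    and f_left: "\<And>y. 0 \<le> y \<Longrightarrow> y < 1/c \<Longrightarrow> f y = G y"
    and f_mid: "\<And>y. 1/c \<le> y \<Longrightarrow> y < 2/c \<Longrightarrow> f y = c * y - 1"
    and f_right: "\<And>i y. mirrored i \<Longrightarrow> 2/3 \<le> y \<Longrightarrow> y \<le> 1 \<Longrightarrow> f y = 1 - G (1 - y)"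
    and mirrored: "\<And>i. mirrored i \<Longrightarrow> c = 3 \<and> 1 \<le> e i"
    and index_inj: "\<And>i j. i \<noteq> j \<Longrightarrow> e i \<noteq> e j \<or> mirrored i \<noteq> mirrored j"
    and left_ex: "\<And>n. \<exists>i. e i = n \<and> \<not> mirrored i"
    and right_ex: "\<And>n. c \<noteq> 2 \<Longrightarrow> 1 \<le> n \<Longrightarrow> \<exists>i. e i = n \<and> mirrored i"
    and c23: "c = 2 \<or> c = 3"
begin

abbreviation "O' \<equiv> {1/c<..<2/c}"

definition H :: "nat \<Rightarrow> real \<Rightarrow> real" where
  "H i x = (if mirrored i then (2 - (g ^^ e i) (1 - x)) / c else (1 + (g ^^ e i) x) / c)"

definition H' :: "nat \<Rightarrow> real \<Rightarrow> real" where
  "H' i x = (if mirrored i then slope (e i) (1 - x) / c else slope (e i) x / c)"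

definition covered :: "real \<Rightarrow> bool" where "covered x \<longleftrightarrow> (\<exists>i. x \<in> H i ` O')"

definition idx :: "real \<Rightarrow> nat" where "idx x = (LEAST i. x \<in> H i ` O')"

text \<open>The values of \<open>rt\<close> and \<open>F\<close> on points that are not covered concern a null set. They are chosen
such that \<open>rt\<close> is positive and \<open>F\<close> maps the interval to itself everywhere.\<close>

definition rt :: "real \<Rightarrow> nat" where "rt x = (if covered x then Suc (e (idx x)) else 1)"

definition F :: "real \<Rightarrow> real" where "F x = (if covered x then (f ^^ rt x) x else 3 / (2 * c))"

lemma O'_pos: "1/c \<le> x \<Longrightarrow> 0 < x" using cpos by (auto intro: less_le_trans[of 0 "1/c"])

lemma reflect: "mirrored i \<Longrightarrow> 1/c \<le> x \<Longrightarrow> x \<le> 2/c \<Longrightarrow> 1/c \<le> 1 - x \<and> 1 - x \<le> 2/c"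
  using mirrored[of i] by auto

lemma reflect_strict: "mirrored i \<Longrightarrow> x \<in> O' \<Longrightarrow> 1 - x \<in> O'"
  using mirrored[of i] by auto

lemma H_deriv: assumes "1/c \<le> x" "x \<le> 2/c" shows "(H i has_real_derivative H' i x) (at x)"
proof (cases "mirrored i")
  case True
  have "0 < 1 - x" using O'_pos reflect[OF True assms] by blast
  hence d: "((g ^^ e i) has_real_derivative slope (e i) (1 - x)) (at (1 - x))" by (rule gn_deriv)
  have "((\<lambda>x. 1 - x) has_real_derivative - 1) (at x)" by (auto intro!: derivative_eq_intros)
  from DERIV_chain2[OF d this]
  have "((\<lambda>x. (g ^^ e i) (1 - x)) has_real_derivative slope (e i) (1 - x) * - 1) (at x)" .
  from DERIV_cdivide[OF DERIV_diff[OF DERIV_const this], of 2 c]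
  have "((\<lambda>x. (2 - (g ^^ e i) (1 - x)) / c) has_real_derivative (0 - slope (e i) (1 - x) * - 1) / c) (at x)" .
  thus ?thesis using True by (simp add: H_def[abs_def] H'_def)
next
  case False
  have "((g ^^ e i) has_real_derivative slope (e i) x) (at x)" by (rule gn_deriv[OF O'_pos[OF assms(1)]])
  from DERIV_cdivide[OF DERIV_add[OF DERIV_const this], of 1 c]
  have "((\<lambda>x. (1 + (g ^^ e i) x) / c) has_real_derivative (0 + slope (e i) x) / c) (at x)" .
  thus ?thesis using False by (simp add: H_def[abs_def] H'_def)
qed

lemma H'_cont: "continuous_on {1/c..2/c} (H' i)"
proof (cases "mirrored i")
  case True
  have "continuous_on {1/c..2/c} (\<lambda>x. slope (e i) (1 - x))"
  proof (rule continuous_on_compose2[OF slope_cont])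
    show "(\<lambda>x. 1 - x) ` {1/c..2/c} \<subseteq> {0<..}" using mirrored[OF True] by auto
  qed (intro continuous_intros)
  thus ?thesis using True cpos unfolding H'_def by (auto intro!: continuous_intros)
next
  case False
  have "continuous_on {1/c..2/c} (slope (e i))"
    using O'_pos by (intro continuous_on_subset[OF slope_cont]) auto
  thus ?thesis using False cpos unfolding H'_def by (auto intro!: continuous_intros)
qed

lemma H'_pos: assumes "1/c \<le> x" "x \<le> 2/c" shows "0 < H' i x"
proof (cases "mirrored i")
  case True
  thus ?thesis using slope_pos[of "1 - x"] O'_pos[of "1 - x"] reflect[OF True assms] cpos by (simp add: H'_def)
qed (use slope_pos O'_pos assms cpos in \<open>simp add: H'_def\<close>)

lemma H'_le: assumes "1/c \<le> x" "x \<le> 2/c" shows "H' i x \<le> 1/2"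
proof -
  have *: "slope n y / c \<le> 1/2" if "0 < y" for n y
  proof -
    have "slope n y / c \<le> 1 / c" using slope_le_1[OF that, of n] cpos by (intro divide_right_mono) auto
    also have "\<dots> \<le> 1/2" using c by simp
    finally show ?thesis .
  qed
  show ?thesis
    using *[OF O'_pos[OF assms(1)]] *[OF O'_pos, of "1 - x"] reflect[OF _ assms] by (auto simp: H'_def)
qed

lemma H'_distortion:
  assumes "1/c \<le> x" "x \<le> 2/c" "1/c \<le> y" "y \<le> 2/c"
  shows "H' i x \<le> exp (12 * c * \<bar>x - y\<bar>) * H' i y"
proof (cases "mirrored i")
  case True
  have "slope (e i) (1 - x) \<le> exp (12 * c * \<bar>(1 - x) - (1 - y)\<bar>) * slope (e i) (1 - y)"
    using reflect[OF True assms(1,2)] reflect[OF True assms(3,4)] by (intro slope_distortion) auto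
  thus ?thesis using True cpos by (simp add: H'_def divide_right_mono abs_minus_commute)
next
  case False
  thus ?thesis using slope_distortion[OF assms, of "e i"] cpos by (simp add: H'_def divide_right_mono)
qed

lemma gn_bounds: assumes "x \<in> O'" shows "0 < (g ^^ n) x" "(g ^^ n) x < edge n" "edge (Suc n) < (g ^^ n) x" "(g ^^ n) x < 2/c"
  "1 \<le> n \<Longrightarrow> (g ^^ n) x < 1/c"
proof -
  show 1: "(g ^^ n) x < edge n" "edge (Suc n) < (g ^^ n) x" using gn_in_strict[of x n] assms by auto
  show "0 < (g ^^ n) x" using gn_pos[OF O'_pos[of x], of n] assms by auto
  show "(g ^^ n) x < 2/c" using 1 edge_antimono[of 0 n] edge_0 by simp
  show "1 \<le> n \<Longrightarrow> (g ^^ n) x < 1/c" using 1 edge_antimono[of 1 n] edge_1 by simp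
qed

lemma H_in: assumes "x \<in> O'" shows "H i x \<in> O'"
proof (cases "mirrored i")
  case True
  have "1 \<le> e i" using mirrored[OF True] by simp
  hence "0 < (g ^^ e i) (1 - x)" "(g ^^ e i) (1 - x) < 1/c"
    by (auto intro: gn_bounds(1,5)[OF reflect_strict[OF True assms]])
  moreover have "1/c \<le> 1" using c by simp
  ultimately have "1 < 2 - (g ^^ e i) (1 - x)" "2 - (g ^^ e i) (1 - x) < 2" by linarith+
  hence "1 / c < (2 - (g ^^ e i) (1 - x)) / c" "(2 - (g ^^ e i) (1 - x)) / c < 2 / c"
    using cpos by (auto intro: divide_strict_right_mono)
  thus ?thesis using True by (simp add: H_def)
next
  case False
  have "0 < (g ^^ e i) x" "(g ^^ e i) x < 2/c" using gn_bounds[OF assms] by auto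
  moreover have "2/c \<le> 1" using c by simp
  ultimately have "0 < (g ^^ e i) x" "(g ^^ e i) x < 1" by auto
  hence "1 / c < (1 + (g ^^ e i) x) / c" "(1 + (g ^^ e i) x) / c < 2 / c"
    using cpos by (auto intro: divide_strict_right_mono)
  thus ?thesis using False by (simp add: H_def)
qed

lemma orbit_H:
  assumes x: "x \<in> O'" and l: "l \<le> e i"
  shows "(f ^^ Suc l) (H i x) = (if mirrored i then 1 - (g ^^ (e i - l)) (1 - x) else (g ^^ (e i - l)) x)"
  using l
proof (induction l)
  case 0
  have "f (H i x) = c * H i x - 1" using H_in[OF x, of i] by (intro f_mid) auto
  thus ?case using cpos by (auto simp: H_def)
next
  case (Suc l)
  define k where "k = e i - Suc l"
  have k: "e i - l = Suc k" using Suc.prems by (simp add: k_def)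
  have IH: "(f ^^ Suc l) (H i x) = (if mirrored i then 1 - (g ^^ Suc k) (1 - x) else (g ^^ Suc k) x)"
    using Suc by (simp only: k Suc_leD)
  show ?case
  proof (cases "mirrored i")
    case True
    have y: "1 - x \<in> O'" by (rule reflect_strict[OF True x])
    let ?z = "(g ^^ Suc k) (1 - x)"
    have z: "0 < ?z" "?z < 1/3" using gn_bounds(1,5)[OF y, of "Suc k"] mirrored[OF True] by auto
    have "f (1 - ?z) = 1 - G (1 - (1 - ?z))" using z by (intro f_right[OF True]) auto
    also have "\<dots> = 1 - G (g ((g ^^ k) (1 - x)))" by simp
    also have "\<dots> = 1 - (g ^^ k) (1 - x)" using gn_bounds(1)[OF y, of k] by (subst G_g) auto
    finally show ?thesis using IH True by (simp add: k_def)
  next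
    case False
    let ?z = "(g ^^ Suc k) x"
    have z: "0 < ?z" "?z < 1/c" using gn_bounds(1,5)[OF x, of "Suc k"] by auto
    have "f ?z = G ?z" using z by (intro f_left) auto
    also have "\<dots> = (g ^^ k) x" using gn_bounds(1)[OF x, of k] by (simp add: G_g)
    finally show ?thesis using IH False by (simp add: k_def)
  qed
qed

lemma return_H: assumes "x \<in> O'" shows "(f ^^ Suc (e i)) (H i x) = x"
  unfolding orbit_H[OF assms order_refl] by simp

text \<open>Inverse branches contract, so along an excursion two points of one branch are at most as far
apart as at its end. Hence excursion sums are Hoelder on each branch, with a
constant proportional to the return time.\<close>

lemma orbit_nonexpanding:
  assumes "x \<in> O'" "y \<in> O'" "l \<le> Suc (e i)"
  shows "\<bar>(f ^^ l) (H i x) - (f ^^ l) (H i y)\<bar> \<le> \<bar>x - y\<bar>"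
proof -
  have xy: "0 < x" "0 < y" using assms O'_pos by auto
  have r: "0 < 1 - x \<and> 0 < 1 - y" if "mirrored i"
    using O'_pos[of "1 - x"] O'_pos[of "1 - y"] reflect_strict[OF that assms(1)] reflect_strict[OF that assms(2)] by auto
  have a: "\<bar>(g ^^ n) x - (g ^^ n) y\<bar> \<le> \<bar>x - y\<bar>" for n by (rule gn_nonexpanding[OF xy])
  have b: "\<bar>(g ^^ n) (1 - x) - (g ^^ n) (1 - y)\<bar> \<le> \<bar>x - y\<bar>" if "mirrored i" for n
    using gn_nonexpanding[of "1 - x" "1 - y" n] r[OF that] by (simp add: abs_minus_commute)
  show ?thesis
  proof (cases l)
    case 0
    have "\<bar>H i x - H i y\<bar> = \<bar>c * H i x - c * H i y\<bar> / c"
      using cpos by (simp add: abs_mult flip: right_diff_distrib)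
    also have "\<dots> \<le> \<bar>x - y\<bar> / c"
      using a[of "e i"] b[of "e i"] cpos by (intro divide_right_mono) (auto simp: H_def abs_minus_commute)
    also have "\<dots> \<le> \<bar>x - y\<bar> / 1" using c by (intro divide_left_mono) auto
    finally show ?thesis using 0 by simp
  next
    case (Suc k)
    hence k: "k \<le> e i" using assms(3) by simp
    show ?thesis unfolding Suc orbit_H[OF assms(1) k] orbit_H[OF assms(2) k]
      using a[of "e i - k"] b[of "e i - k"] by (auto simp: abs_minus_commute)
  qed
qed

lemma H_disjoint: assumes "x \<in> O'" "y \<in> O'" "H i x = H j y" shows "i = j"
proof (rule ccontr)
  assume "i \<noteq> j"
  have *: "m = n" if "z \<in> O'" "z' \<in> O'" "(g ^^ m) z = (g ^^ n) z'" for m n z z'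
  proof (rule ccontr)
    have aux: False if "m < n" "z \<in> O'" "z' \<in> O'" "(g ^^ m) z = (g ^^ n) z'" for m n z z'
      using gn_bounds(3)[OF that(2), of m] gn_bounds(2)[OF that(3), of n] edge_antimono[of "Suc m" n] that by simp
    assume "m \<noteq> n"
    thus False using aux[of m n z z'] aux[of n m z' z] that by (metis linorder_neqE_nat)
  qed
  have mixed: False if "mirrored k" "\<not> mirrored l" "u \<in> O'" "v \<in> O'" "H k u = H l v" for k l u v
  proof -
    have "1 \<le> e k" and c3: "1/c + 2/c = 1" using mirrored[OF that(1)] by auto
    have "(g ^^ e k) (1 - u) < 1/c"
      by (rule gn_bounds(5)[OF reflect_strict[OF that(1,3)] \<open>1 \<le> e k\<close>])
    moreover have "(g ^^ e l) v < 2/c" by (rule gn_bounds(4)[OF that(4)])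
    moreover have "2 - (g ^^ e k) (1 - u) = 1 + (g ^^ e l) v" using that cpos by (simp add: H_def)
    ultimately show False using c3 by linarith
  qed
  show False
  proof (cases "mirrored i = mirrored j")
    case True
    have "e i = e j"
    proof (cases "mirrored i")
      case T: True
      hence "(g ^^ e i) (1 - x) = (g ^^ e j) (1 - y)" using assms(3) True cpos by (simp add: H_def)
      thus ?thesis using *[of "1 - x" "1 - y"] reflect_strict T True assms(1,2) by metis
    next
      case F: False
      hence "(g ^^ e i) x = (g ^^ e j) y" using assms(3) True cpos by (simp add: H_def)
      thus ?thesis using *[of x y] assms(1,2) by metis
    qed
    thus False using index_inj[OF \<open>i \<noteq> j\<close>] True by simp
  next
    case False
    thus False using mixed[of i j x y] mixed[of j i y x] assms by auto
  qed
qed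

lemma covered_H: "y \<in> O' \<Longrightarrow> covered (H i y)" unfolding covered_def by blast

lemma idx_H: assumes "x \<in> O'" shows "idx (H i x) = i" "covered (H i x)"
proof -
  show "covered (H i x)" unfolding covered_def using assms by blast
  have "H i x \<in> H j ` O' \<Longrightarrow> j = i" for j using H_disjoint[OF assms] by blast
  thus "idx (H i x) = i" unfolding idx_def using assms by (intro Least_equality) auto
qed

lemma rt_H: "x \<in> O' \<Longrightarrow> rt (H i x) = Suc (e i)" by (simp add: rt_def idx_H)

lemma F_H: "x \<in> O' \<Longrightarrow> F (H i x) = x"
  unfolding F_def by (simp only: idx_H(2) rt_H return_H if_True)

lemma rt_ge_1: "1 \<le> rt x" by (simp add: rt_def)

lemma H_image_borel: "H i ` O' \<in> sets borel"
proof -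
  have "open (H i ` O')"
  proof (rule injective_into_1d_imp_open_map_UNIV)
    show "open O'" by simp
    show "continuous_on O' (H i)"
      by (rule DERIV_continuous_on[OF has_field_derivative_at_within[OF H_deriv]]) auto
    show "inj_on (H i) O'" using F_H by (metis inj_onI)
  qed simp_all
  thus ?thesis by simp
qed

lemma idx_meas [measurable]: "idx \<in> borel \<rightarrow>\<^sub>M count_space UNIV"
  unfolding idx_def
  by (rule measurable_Least) (simp add: pred_def H_image_borel)

lemma covered_meas [measurable]: "Measurable.pred borel covered"
proof -
  have "{x. covered x} = (\<Union>i. H i ` O')" by (auto simp: covered_def)
  thus ?thesis using H_image_borel by (simp add: pred_def)
qed

lemma rt_meas [measurable]: "rt \<in> borel \<rightarrow>\<^sub>M count_space UNIV"
  unfolding rt_def[abs_def] by measurable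

lemma f_iter_meas [measurable]: "(f ^^ n) \<in> borel_measurable borel"
  by (induction n) (auto simp: comp_def intro: measurable_compose[OF _ f_meas])

lemma F_borel [measurable]: "F \<in> borel_measurable borel"
proof -
  have "(\<lambda>x. (f ^^ rt x) x) \<in> borel_measurable borel"
    by (rule measurable_compose_countable[OF f_iter_meas rt_meas])
  thus ?thesis unfolding F_def[abs_def] by measurable
qed

lemma F_in: "x \<in> O' \<Longrightarrow> F x \<in> O'"
proof (cases "covered x")
  case True
  then obtain i z where "z \<in> O'" "x = H i z" by (auto simp: covered_def)
  thus ?thesis using F_H by simp
next
  case False
  thus ?thesis using cpos by (simp add: F_def field_simps)
qed

lemma cover_AE: "AE x in lborel. x \<in> O' \<longrightarrow> covered x"
proof -
  \<comment> \<open>contains the end points of the images of all branches\<close>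
  define E where "E = range (\<lambda>n. (1 + edge n) / c) \<union> range (\<lambda>n. (2 - edge n) / c)"
  have "countable E" unfolding E_def by (intro countable_Un countable_image) auto
  hence ae: "AE x in lborel. x \<notin> E" by (intro AE_not_in countable_imp_null_set_lborel)
  have cov: "covered x" if x: "x \<in> O'" "x \<notin> E" for x
  proof -
    define z where "z = c * x - 1"
    have x_eq: "x = (1 + z) / c" using cpos by (simp add: z_def)
    have z01: "0 < z" "z < 1" using x(1) cpos by (auto simp: z_def field_simps)
    have nz: "z \<noteq> edge n" for n using x(2) unfolding E_def x_eq by auto
    have nz': "1 - z \<noteq> edge n" for n
    proof
      assume "1 - z = edge n"
      hence "x = (2 - edge n) / c" unfolding x_eq by simp
      thus False using x(2) unfolding E_def by auto
    qed
    show ?thesis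
    proof (cases "z < 2/c")
      case True
      then obtain n y where y: "1/c < y" "y < 2/c" "z = (g ^^ n) y" using edge_interval[OF z01(1) _ nz] by blast
      obtain i where i: "e i = n" "\<not> mirrored i" using left_ex by blast
      have "x = H i y" using y i by (simp add: H_def x_eq)
      thus ?thesis using covered_H[of y i] y by simp
    next
      case False
      hence c3: "c = 3" using c23 z01 by auto
      have "z \<noteq> 2/c" using nz[of 0] edge_0 by simp
      hence zz: "0 < 1 - z" "1 - z < 1/c" "1 - z < 2/c" using False z01 c3 by auto
      obtain n y where y: "1/c < y" "y < 2/c" "1 - z = (g ^^ n) y" using edge_interval[OF zz(1,3) nz'] by blast
      have "n \<noteq> 0"
      proof
        assume "n = 0"
        thus False using y zz by simp
      qed
      then obtain i where i: "e i = n" "mirrored i" using right_ex[of n] c3 by auto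
      have "x = H i (1 - y)" using y(3) i by (simp add: H_def x_eq)
      moreover have "1 - y \<in> O'" using y c3 by simp
      ultimately show ?thesis using covered_H[of "1 - y" i] by simp
    qed
  qed
  show ?thesis using ae by eventually_elim (use cov in blast)
qed

text \<open>A point that needs at least \<open>n\<close> steps to return lies within \<open>edge (n - 1) / c\<close> of an end
point of the interval.\<close>

lemma rt_tail:
  assumes "1 \<le> n"
  shows "measure lborel {x\<in>O'. n \<le> rt x} \<le> 8 powr (1/\<gamma>) * real n powr (- (1/\<gamma>))"
proof (cases "n = 1")
  case True
  have le: "1/c \<le> 2/c" using cpos by (simp add: divide_right_mono)
  have "measure lborel {x\<in>O'. n \<le> rt x} \<le> measure lborel O'"
  proof (intro measure_mono_fmeasurable fmeasurableI)
    show "emeasure lborel O' < \<infinity>" using le by simp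
  qed auto
  also have "\<dots> = 1/c" using le by (simp add: diff_divide_distrib[symmetric])
  also have "\<dots> \<le> 1" using c by simp
  also have "(1::real) \<le> 8 powr (1/\<gamma>)" using \<gamma> by (intro ge_one_powr_ge_zero) auto
  finally show ?thesis using True by simp
next
  case False
  hence n2: "2 \<le> n" using assms by simp
  define t where "t = edge (n - 1) / c"
  have t0: "0 < t" using edge_pos cpos by (simp add: t_def)
  have sub: "{x\<in>O'. n \<le> rt x} \<subseteq> {1/c..1/c + t} \<union> {2/c - t..2/c}"
  proof
    fix x assume x: "x \<in> {x\<in>O'. n \<le> rt x}"
    hence cov: "covered x" using n2 by (auto simp: rt_def split: if_splits)
    then obtain i z where z: "z \<in> O'" "x = H i z" by (auto simp: covered_def)
    hence e: "n - 1 \<le> e i" using x rt_H[OF z(1), of i] by auto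
    have le: "(g ^^ e i) y / c \<le> t" if "y \<in> O'" for y
      using gn_bounds(2)[OF that, of "e i"] edge_antimono[OF e] cpos unfolding t_def by (intro divide_right_mono) auto
    have ge: "0 \<le> (g ^^ e i) y / c" if "y \<in> O'" for y
      using gn_bounds(1)[OF that, of "e i"] cpos by simp
    show "x \<in> {1/c..1/c + t} \<union> {2/c - t..2/c}"
    proof (cases "mirrored i")
      case True
      show ?thesis using le[OF reflect_strict[OF True z(1)]] ge[OF reflect_strict[OF True z(1)]] True
        by (auto simp: z(2) H_def diff_divide_distrib)
    next
      case False
      show ?thesis using le[OF z(1)] ge[OF z(1)] False by (auto simp: z(2) H_def add_divide_distrib)
    qed
  qed
  have "measure lborel {x\<in>O'. n \<le> rt x} \<le> measure lborel ({1/c..1/c + t} \<union> {2/c - t..2/c})"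
    using sub t0 by (intro measure_mono_fmeasurable fmeasurable.Un) (auto intro!: fmeasurableI)
  also have "\<dots> \<le> measure lborel {1/c..1/c + t} + measure lborel {2/c - t..2/c}"
    by (intro measure_Un_le) auto
  also have "\<dots> = 2 * t" using t0 by simp
  also have "\<dots> \<le> edge (n - 1)" using c edge_pos[of "n - 1"] cpos by (simp add: t_def pos_divide_le_eq mult.commute)
  also have "\<dots> \<le> (real (n - 1) / 4) powr (- (1/\<gamma>))" using n2 by (intro edge_le) auto
  also have "\<dots> \<le> (real n / 8) powr (- (1/\<gamma>))" using n2 \<gamma> by (intro powr_mono2') auto
  also have "\<dots> = 8 powr (1/\<gamma>) * real n powr (- (1/\<gamma>))" 
    by (simp add: powr_divide powr_minus_divide)
  finally show ?thesis .
qed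

lemma full_branch_map:
  assumes "0 < \<eta>" "\<eta> \<le> 1"
  shows "full_branch_map (1/c) (2/c) (12 * c) \<eta> H H' F"
proof
  show "1/c < 2/c" using cpos by (simp add: divide_strict_right_mono)
  have "2/c - 1/c \<le> 1" using c by (simp add: diff_divide_distrib[symmetric])
  thus "2/c \<le> 1/c + 1" by simp
  show "AE x in lborel. x \<in> O' \<longrightarrow> (\<exists>i. x \<in> H i ` O')" using cover_AE by (simp add: covered_def)
  show "F \<in> restrict_space lborel O' \<rightarrow>\<^sub>M restrict_space lborel O'"
  proof (rule measurable_restrict_space3)
    show "F \<in> lborel \<rightarrow>\<^sub>M lborel" by simp
    show "F \<in> O' \<rightarrow> O'" using F_in by blast
  qed
  show "H i ` O' \<inter> H j ` O' = {}" if "i \<noteq> j" for i j using H_disjoint that by blast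
qed (use assms cpos H_deriv H'_cont H'_pos H'_le H'_distortion H_in F_H in auto)

section \<open>From induced time to real time\<close>

lemma sum_lessThan_add:
  fixes h :: "nat \<Rightarrow> real"
  shows "(\<Sum>a<m + r. h a) = (\<Sum>a<m. h a) + (\<Sum>l<r. h (m + l))"
  by (induction r) (auto simp: algebra_simps)

definition excursion_sum :: "(real \<Rightarrow> real) \<Rightarrow> real \<Rightarrow> real" where
  "excursion_sum w x = (\<Sum>l<rt x. w ((f ^^ l) x))"

definition return_time :: "real \<Rightarrow> nat \<Rightarrow> nat" where
  "return_time y j = (\<Sum>i<j. rt ((F ^^ i) y))"

lemma return_time_strict: "strict_mono (return_time y)"
  using rt_ge_1 by (auto intro!: strict_monoI_Suc simp: return_time_def Suc_le_eq)

lemma return_time_ge: "j \<le> return_time y j"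
  using strict_mono_imp_increasing[OF return_time_strict] .

lemma F_iterate:
  assumes "\<And>j. covered ((F ^^ j) y)"
  shows "(F ^^ j) y = (f ^^ return_time y j) y"
proof (induction j)
  case (Suc j)
  have "(F ^^ Suc j) y = (f ^^ rt ((F ^^ j) y)) ((F ^^ j) y)"
    using assms[of j] by (simp add: F_def)
  also have "\<dots> = (f ^^ (rt ((F ^^ j) y) + return_time y j)) y" unfolding Suc by (simp add: funpow_add)
  finally show ?case by (simp add: return_time_def add.commute)
qed (simp add: return_time_def)

lemma sum_at_return_time:
  assumes "\<And>j. covered ((F ^^ j) y)"
  shows "(\<Sum>a<return_time y j. w ((f ^^ a) y)) = (\<Sum>i<j. excursion_sum w ((F ^^ i) y))"
proof (induction j)
  case (Suc j)
  have "(\<Sum>a<return_time y (Suc j). w ((f ^^ a) y)) = (\<Sum>a<return_time y j. w ((f ^^ a) y))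
      + (\<Sum>l<rt ((F ^^ j) y). w ((f ^^ (return_time y j + l)) y))"
    by (simp add: return_time_def sum_lessThan_add)
  also have "(\<Sum>l<rt ((F ^^ j) y). w ((f ^^ (return_time y j + l)) y)) = excursion_sum w ((F ^^ j) y)"
    unfolding excursion_sum_def
    by (intro sum.cong refl, subst F_iterate[OF assms, of j]) (simp add: funpow_add add.commute[of "return_time y j"])
  finally show ?case using Suc by simp
qed (simp add: return_time_def)

text \<open>At return times the path is a combination of the Birkhoff sums of the excursion sums and of the
return times, with the coefficient chosen such that their drifts cancel. Between return times its
total variation is bounded by a multiple of the return time, and the powers of these return times
are controlled by the \<open>p\<close>-variation of their own sums (\<open>pvar_le_unit_steps\<close>).\<close>

lemma pvar_real_time:
  assumes p: "1 \<le> p" "1/p \<le> \<gamma>" and cov: "\<And>j. covered ((F ^^ j) y)"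
    and n: "1 \<le> n" and nn: "0 \<le> R1" "0 \<le> R2" "0 \<le> m2" "0 \<le> B"
    and wB: "\<And>x. \<bar>w x\<bar> \<le> B"
    and p1: "pvar_le p (\<lambda>l. (\<Sum>j<l. excursion_sum w ((F ^^ j) y) + B0 * real (rt ((F ^^ j) y))) - real l * m1) n (R1 * real n powr \<gamma>)"
    and p2: "pvar_le p (\<lambda>l. (\<Sum>j<l. real (rt ((F ^^ j) y))) - real l * m2) (Suc n) (R2 * real (Suc n) powr \<gamma>)"
    and m2: "m2 \<noteq> 0"
  defines "cst \<equiv> m1 / m2 - B0"
  shows "pvar_le p (\<lambda>l. (\<Sum>a<l. w ((f ^^ a) y)) - real l * cst) n
    ((R1 + \<bar>m1 / m2\<bar> * (2 * R2) + 4 * ((B + \<bar>cst\<bar>) * (R2 + m2))) * real n powr \<gamma>)"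
proof -
  define u where "u l = (\<Sum>a<l. w ((f ^^ a) y)) - real l * cst" for l
  let ?r = "\<lambda>j. real (rt ((F ^^ j) y))"
  \<comment> \<open>one more step than \<open>n\<close>, because the excursion in progress at time \<open>n\<close> is included as a whole\<close>
  define N where "N = real (Suc n) powr \<gamma>"
  have N0: "0 \<le> N" by (simp add: N_def)
  have N_le: "N \<le> 2 * real n powr \<gamma>"
  proof -
    have "N \<le> (2 * real n) powr \<gamma>" unfolding N_def using n \<gamma> by (intro powr_mono2) auto
    also have "\<dots> = 2 powr \<gamma> * real n powr \<gamma>" by (rule powr_mult)
    also have "\<dots> \<le> 2 powr 1 * real n powr \<gamma>" using \<gamma> by (intro mult_right_mono powr_mono) auto
    finally show ?thesis by simp
  qed
  have coarse: "pvar_le p (\<lambda>j. u (return_time y j)) n (R1 * real n powr \<gamma> + \<bar>- (m1 / m2)\<bar> * (R2 * N))"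
  proof -
    have "pvar_le p (\<lambda>l. (\<Sum>j<l. ?r j) - real l * m2) n (R2 * N)"
      using p nn by (intro pvar_le_mono[OF p2]) (auto simp: N_def)
    hence "pvar_le p (\<lambda>l. - (m1 / m2) * ((\<Sum>j<l. ?r j) - real l * m2)) n (\<bar>- (m1 / m2)\<bar> * (R2 * N))"
      using nn N0 by (intro pvar_le_scale) auto
    from pvar_le_add[OF p(1) p1 this]
    have "pvar_le p (\<lambda>l. ((\<Sum>j<l. excursion_sum w ((F ^^ j) y) + B0 * ?r j) - real l * m1)
        + (- (m1 / m2) * ((\<Sum>j<l. ?r j) - real l * m2))) n (R1 * real n powr \<gamma> + \<bar>- (m1 / m2)\<bar> * (R2 * N))"
      using nn N0 by simp
    moreover have "((\<Sum>j<l. excursion_sum w ((F ^^ j) y) + B0 * ?r j) - real l * m1)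
        + (- (m1 / m2) * ((\<Sum>j<l. ?r j) - real l * m2)) = u (return_time y l)" for l
    proof -
      have "real (return_time y l) = (\<Sum>j<l. ?r j)" by (simp add: return_time_def)
      thus ?thesis unfolding u_def sum_at_return_time[OF cov] cst_def using m2
        by (simp add: sum.distrib sum_distrib_left[symmetric] algebra_simps)
    qed
    ultimately show ?thesis by simp
  qed
  have rsum: "(\<Sum>j\<le>n. ?r j powr p) \<le> (R2 * N + m2 * N) powr p"
  proof -
    have "(\<Sum>j\<le>n. ?r j powr p) \<le> (\<Sum>j\<le>n. (\<bar>?r j - m2\<bar> + m2) powr p)"
      using p by (intro sum_mono powr_mono2) auto
    also have "\<dots> \<le> (R2 * N + m2 * N) powr p"
    proof (rule minkowski_powr_sum)
      have "(\<Sum>j\<le>n. \<bar>?r j - m2\<bar> powr p) = (\<Sum>j\<le>n. \<bar>((\<Sum>i<Suc j. ?r i) - real (Suc j) * m2) - ((\<Sum>i<j. ?r i) - real j * m2)\<bar> powr p)"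
        by (intro sum.cong) (auto simp: algebra_simps)
      also have "\<dots> \<le> (R2 * N) powr p" unfolding N_def by (rule pvar_le_unit_steps[OF p2])
      finally show "(\<Sum>j\<le>n. \<bar>?r j - m2\<bar> powr p) \<le> (R2 * N) powr p" .
      have "(\<Sum>j\<le>n. m2 powr p) = real (Suc n) * m2 powr p" by simp
      also have "\<dots> = (real (Suc n) powr (1/p) * m2) powr p"
        using p by (simp add: powr_mult powr_powr)
      also have "\<dots> \<le> (N * m2) powr p"
        using p nn unfolding N_def by (intro powr_mono2 mult_right_mono powr_mono) auto
      finally show "(\<Sum>j\<le>n. m2 powr p) \<le> (m2 * N) powr p" by (simp add: mult.commute)
    qed (use p nn N0 in auto)
    finally show ?thesis .
  qed
  define B1 where "B1 = B + \<bar>cst\<bar>"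
  have B1: "0 \<le> B1" using nn by (simp add: B1_def)
  have pv: "pvar_le p u n ((R1 * real n powr \<gamma> + \<bar>- (m1 / m2)\<bar> * (R2 * N)) + 2 * (B1 * (R2 * N + m2 * N)))"
  proof (rule pvar_le_coarsen[OF p(1) return_time_strict[of y] _ _ coarse])
    show "return_time y 0 = 0" by (simp add: return_time_def)
    show "n < return_time y (Suc n)" using return_time_ge[of "Suc n" y] by simp
    have "(\<Sum>j\<le>n. (\<Sum>l=return_time y j..<return_time y (Suc j). \<bar>u (Suc l) - u l\<bar>) powr p) \<le> (\<Sum>j\<le>n. (B1 * ?r j) powr p)"
    proof (intro sum_mono powr_mono2)
      fix j
      have "\<bar>u (Suc l) - u l\<bar> \<le> B1" for l
      proof -
        have "u (Suc l) - u l = w ((f ^^ l) y) - cst" by (simp add: u_def algebra_simps)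
        thus ?thesis using wB[of "(f ^^ l) y"] unfolding B1_def by linarith
      qed
      hence "(\<Sum>l=return_time y j..<return_time y (Suc j). \<bar>u (Suc l) - u l\<bar>) \<le> (\<Sum>l=return_time y j..<return_time y (Suc j). B1)"
        by (intro sum_mono)
      also have "\<dots> = B1 * ?r j" by (simp add: return_time_def)
      finally show "(\<Sum>l=return_time y j..<return_time y (Suc j). \<bar>u (Suc l) - u l\<bar>) \<le> B1 * ?r j" .
    qed (use p in \<open>auto intro!: sum_nonneg\<close>)
    also have "\<dots> = B1 powr p * (\<Sum>j\<le>n. ?r j powr p)" using B1 by (simp add: powr_mult sum_distrib_left)
    also have "\<dots> \<le> B1 powr p * (R2 * N + m2 * N) powr p" using rsum by (intro mult_left_mono) auto
    also have "\<dots> = (B1 * (R2 * N + m2 * N)) powr p" by (simp add: powr_mult)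
    finally show "(\<Sum>j\<le>n. (\<Sum>l=return_time y j..<return_time y (Suc j). \<bar>u (Suc l) - u l\<bar>) powr p) \<le> (B1 * (R2 * N + m2 * N)) powr p" .
  qed (use nn N0 B1 in auto)
  have le: "(R1 * real n powr \<gamma> + \<bar>- (m1 / m2)\<bar> * (R2 * N)) + 2 * (B1 * (R2 * N + m2 * N))
      \<le> (R1 + \<bar>m1 / m2\<bar> * (2 * R2) + 4 * (B1 * (R2 + m2))) * real n powr \<gamma>"
  proof -
    have a: "K * N \<le> K * (2 * real n powr \<gamma>)" if "0 \<le> K" for K using N_le that by (rule mult_left_mono)
    have gen: "R1 * X + (x * R2) * (2 * X) + 2 * (z * (2 * X)) = (R1 + x * (2 * R2) + 4 * z) * X" for X x z :: real
      by (simp add: algebra_simps)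
    have 1: "0 \<le> \<bar>m1 / m2\<bar> * R2" "0 \<le> B1 * (R2 + m2)" using nn B1 by auto
    have "(R1 * real n powr \<gamma> + \<bar>- (m1 / m2)\<bar> * (R2 * N)) + 2 * (B1 * (R2 * N + m2 * N))
       = R1 * real n powr \<gamma> + (\<bar>m1 / m2\<bar> * R2) * N + 2 * ((B1 * (R2 + m2)) * N)"
      unfolding abs_minus_cancel distrib_right[symmetric, of R2 N m2] by (simp only: mult.assoc)
    also have "\<dots> \<le> R1 * real n powr \<gamma> + (\<bar>m1 / m2\<bar> * R2) * (2 * real n powr \<gamma>) + 2 * ((B1 * (R2 + m2)) * (2 * real n powr \<gamma>))"
      using a[OF 1(1)] a[OF 1(2)] by linarith
    also have "\<dots> = (R1 + \<bar>m1 / m2\<bar> * (2 * R2) + 4 * (B1 * (R2 + m2))) * real n powr \<gamma>"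
      by (rule gen)
    finally show ?thesis .
  qed
  have "pvar_le p u n ((R1 + \<bar>m1 / m2\<bar> * (2 * R2) + 4 * (B1 * (R2 + m2))) * real n powr \<gamma>)"
  proof (rule pvar_le_mono[OF pv order_refl _ le])
    show "0 \<le> (R1 * real n powr \<gamma> + \<bar>- (m1 / m2)\<bar> * (R2 * N)) + 2 * (B1 * (R2 * N + m2 * N))"
      using nn N0 B1 by (intro add_nonneg_nonneg mult_nonneg_nonneg) auto
  qed (use p in auto)
  thus ?thesis unfolding B1_def u_def[abs_def] .
qed

text \<open>The excursion sums become positive and regular on branches when a multiple of the return time is
added, so that \<open>birkhoff_pvar\<close> applies to this sum as well as to the return time itself.\<close>

theorem bounded_in_prob_reference_interval:
  assumes w_meas [measurable]: "w \<in> borel_measurable borel" and wB: "\<And>x. \<bar>w x\<bar> \<le> B"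
    and hold: "\<And>x y. \<bar>w x - w y\<bar> \<le> C * \<bar>x - y\<bar> powr \<eta>" and C: "0 \<le> C" and \<eta>: "0 < \<eta>" "\<eta> \<le> 1"
    and p: "1/\<gamma> < p" "p < 2"
  shows "\<exists>cst. bounded_in_prob (restrict_space lborel O')
    (\<lambda>n y R. pvar_le p (\<lambda>l. (\<Sum>a<l. w ((f ^^ a) y)) - real l * cst) n (R * real n powr \<gamma>))"
proof -
  interpret FB: full_branch_map "1/c" "2/c" "12 * c" \<eta> H H' F by (rule full_branch_map[OF \<eta>])
  have B: "0 \<le> B" using wB[of 0] by linarith
  have \<gamma>1: "1 < 1/\<gamma>" using \<gamma> by simp
  have to_LJ: "g \<in> measurable borel M \<Longrightarrow> g \<in> measurable FB.LJ M" for g :: "real \<Rightarrow> 'z" and M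
    unfolding FB.LJ_def by (rule measurable_restrict_space1) simp
  have rt_LJ: "rt \<in> FB.LJ \<rightarrow>\<^sub>M count_space UNIV" by (rule to_LJ[OF rt_meas])
  have tail: "measure FB.LJ {x\<in>O'. n \<le> rt x} \<le> 8 powr (1/\<gamma>) * real n powr (- (1/\<gamma>))" if "1 \<le> n" for n
    using rt_tail[OF that] unfolding FB.LJ_def by (subst measure_restrict_space) auto
  have rtH: "rt (H i x) = rt (H i y)" if "x \<in> O'" "y \<in> O'" for i x y
    by (simp only: rt_H[OF that(1)] rt_H[OF that(2)])
  \<comment> \<open>\<open>B\<close> makes the sum nonnegative, and \<open>C\<close> makes it dominate its oscillation on a branch\<close>
  define B0 where "B0 = B + C"
  define Q where "Q x = excursion_sum w x + B0 * real (rt x)" for x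
  have exc_le: "\<bar>excursion_sum w x\<bar> \<le> B * real (rt x)" for x
  proof -
    have "\<bar>excursion_sum w x\<bar> \<le> (\<Sum>l<rt x. \<bar>w ((f ^^ l) x)\<bar>)" unfolding excursion_sum_def by (rule sum_abs)
    also have "\<dots> \<le> (\<Sum>l<rt x. B)" by (intro sum_mono wB)
    finally show ?thesis by (simp add: mult.commute)
  qed
  have exc_meas: "excursion_sum w \<in> borel_measurable borel"
  proof -
    have "(\<lambda>x. \<Sum>l<n. w ((f ^^ l) x)) \<in> borel_measurable borel" for n by measurable
    from measurable_compose_countable[OF this rt_meas] show ?thesis unfolding excursion_sum_def[abs_def] .
  qed
  have Q_meas: "Q \<in> borel_measurable borel"
    unfolding Q_def[abs_def] using exc_meas by measurable
  have Q0: "0 \<le> Q x" for x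
  proof -
    have "B * real (rt x) \<le> B0 * real (rt x)" using C by (intro mult_right_mono) (auto simp: B0_def)
    thus ?thesis using exc_le[of x] unfolding Q_def by linarith
  qed
  have Q_le: "Q x \<le> (B + B0) * real (rt x)" for x
    using exc_le[of x] unfolding Q_def distrib_right by linarith
  have regQ: "FB.branch_regular Q"
    unfolding FB.branch_regular_def
  proof (intro allI ballI)
    fix i x y assume xy: "x \<in> O'" "y \<in> O'"
    let ?r = "real (rt (H i y))" and ?d = "FB.hdist x y"
    have d0: "0 \<le> ?d" by (rule FB.hdist(1)[OF xy])
    have "excursion_sum w (H i x) - excursion_sum w (H i y)
        = (\<Sum>l<rt (H i y). w ((f ^^ l) (H i x)) - w ((f ^^ l) (H i y)))"
      unfolding excursion_sum_def rtH[OF xy, of i] by (simp add: sum_subtractf)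
    also have "\<dots> \<le> (\<Sum>l<rt (H i y). C * ?d)"
    proof (rule sum_mono)
      fix l assume "l \<in> {..<rt (H i y)}"
      hence l: "l \<le> Suc (e i)" using rt_H[OF xy(2), of i] by simp
      have "w ((f ^^ l) (H i x)) - w ((f ^^ l) (H i y)) \<le> C * \<bar>(f ^^ l) (H i x) - (f ^^ l) (H i y)\<bar> powr \<eta>"
        using hold[of "(f ^^ l) (H i x)" "(f ^^ l) (H i y)"] by linarith
      also have "\<dots> \<le> C * \<bar>x - y\<bar> powr \<eta>"
        using orbit_nonexpanding[OF xy l] C \<eta> by (intro mult_left_mono powr_mono2) auto
      finally show "w ((f ^^ l) (H i x)) - w ((f ^^ l) (H i y)) \<le> C * ?d" by (simp add: FB.hdist_def)
    qed
    finally have diff: "excursion_sum w (H i x) - excursion_sum w (H i y) \<le> ?r * (C * ?d)" by simp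
    have low: "?r * C \<le> Q (H i y)"
      using exc_le[of "H i y"] unfolding Q_def B0_def distrib_right by (simp add: mult.commute)
    have "Q (H i x) = excursion_sum w (H i x) + B0 * ?r" unfolding Q_def rtH[OF xy, of i] ..
    also have "\<dots> \<le> Q (H i y) + (?r * C) * ?d" using diff unfolding Q_def by (simp add: mult.assoc)
    also have "\<dots> \<le> Q (H i y) + Q (H i y) * ?d" using low d0 by (intro add_left_mono mult_right_mono)
    also have "\<dots> = (1 + ?d) * Q (H i y)" by (simp add: algebra_simps)
    also have "\<dots> \<le> exp ?d * Q (H i y)" using exp_ge_add_one_self[of ?d] Q0 by (intro mult_right_mono)
    finally show "Q (H i x) \<le> exp ?d * Q (H i y)" .
  qed
  have reg_rt: "FB.branch_regular (\<lambda>x. real (rt x))"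
    unfolding FB.branch_regular_def
  proof (intro allI ballI)
    fix i x y assume xy: "x \<in> O'" "y \<in> O'"
    have "1 * real (rt (H i y)) \<le> exp (FB.hdist x y) * real (rt (H i y))"
      using FB.hdist(1)[OF xy] by (intro mult_right_mono) auto
    thus "real (rt (H i x)) \<le> exp (FB.hdist x y) * real (rt (H i y))" by (simp add: rtH[OF xy, of i])
  qed
  have C8: "0 < (8::real) powr (1/\<gamma>)" by simp
  obtain m1 where m1: "bounded_in_prob FB.LJ (\<lambda>n y R. pvar_le p (\<lambda>l. (\<Sum>j<l. Q ((F ^^ j) y)) - real l * m1) n (R * real n powr (1/(1/\<gamma>))))"
    using FB.birkhoff_pvar[OF \<gamma>1 p C8 _ rt_LJ rt_ge_1 rtH tail to_LJ[OF Q_meas] Q0 regQ Q_le] B C unfolding B0_def by auto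
  have QC: "real (rt x) \<le> 1 * real (rt x)" for x by simp
  have rt_real: "(\<lambda>x. real (rt x)) \<in> borel_measurable borel" by measurable
  obtain m2 where m2: "(\<forall>x\<in>O'. 1 \<le> real (rt x)) \<longrightarrow> 0 < m2"
    "bounded_in_prob FB.LJ (\<lambda>n y R. pvar_le p (\<lambda>l. (\<Sum>j<l. real (rt ((F ^^ j) y))) - real l * m2) n (R * real n powr (1/(1/\<gamma>))))"
    using FB.birkhoff_pvar[OF \<gamma>1 p C8 _ rt_LJ rt_ge_1 rtH tail to_LJ[OF rt_real] _ reg_rt QC] by auto
  have m2_pos: "0 < m2" using m2(1) rt_ge_1 by auto
  have gg: "1/(1/\<gamma>) = \<gamma>" by simp
  define cst where "cst = m1 / m2 - B0"
  define N0 where "N0 = {y\<in>O'. \<not> covered y}"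
  have N0: "N0 \<in> sets FB.LJ" "measure FB.LJ N0 = 0"
  proof -
    have b: "N0 \<in> sets borel" unfolding N0_def by measurable
    show 1: "N0 \<in> sets FB.LJ" unfolding FB.LJ_def using b by (auto simp: sets_restrict_space_iff N0_def)
    have "AE x in lborel. x \<notin> N0" using cover_AE by eventually_elim (auto simp: N0_def)
    hence "N0 \<in> null_sets lborel" using b by (simp add: AE_iff_null_sets)
    hence "measure lborel N0 = 0" by (rule measure_eq_0_null_sets)
    moreover have "measure FB.LJ N0 = measure lborel N0"
      unfolding FB.LJ_def by (subst measure_restrict_space) (auto simp: N0_def)
    ultimately show "measure FB.LJ N0 = 0" by simp
  qed
  define Bad where "Bad = {y\<in>O'. \<exists>j. (F ^^ j) y \<in> N0}"
  have Bad: "Bad \<in> sets FB.LJ" "measure FB.LJ Bad = 0"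
    using FB.null_preimages[OF N0] by (auto simp: Bad_def)
  have p1: "1 \<le> p" "1/p \<le> \<gamma>"
  proof -
    show "1 \<le> p" using p \<gamma>1 by linarith
    have "0 < \<gamma>" using \<gamma> by simp
    thus "1/p \<le> \<gamma>" using p \<open>1 \<le> p\<close> by (simp add: field_simps)
  qed
  have "bounded_in_prob FB.LJ (\<lambda>n y R. pvar_le p (\<lambda>l. (\<Sum>a<l. w ((f ^^ a) y)) - real l * cst) n (R * real n powr \<gamma>))"
    unfolding bounded_in_prob_def
  proof (intro allI impI)
    fix \<epsilon> :: real assume "0 < \<epsilon>"
    hence e2: "0 < \<epsilon> / 2" by simp
    obtain R1 where R1: "R1 > 0" "\<And>n. n \<ge> 1 \<Longrightarrow> \<exists>A\<in>sets FB.LJ. measure FB.LJ A \<le> \<epsilon>/2 \<and>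
      (\<forall>y\<in>space FB.LJ - A. pvar_le p (\<lambda>l. (\<Sum>j<l. Q ((F ^^ j) y)) - real l * m1) n (R1 * real n powr \<gamma>))"
      using m1[unfolded bounded_in_prob_def gg, rule_format, OF e2] by blast
    obtain R2 where R2: "R2 > 0" "\<And>n. n \<ge> 1 \<Longrightarrow> \<exists>A\<in>sets FB.LJ. measure FB.LJ A \<le> \<epsilon>/2 \<and>
      (\<forall>y\<in>space FB.LJ - A. pvar_le p (\<lambda>l. (\<Sum>j<l. real (rt ((F ^^ j) y))) - real l * m2) n (R2 * real n powr \<gamma>))"
      using m2(2)[unfolded bounded_in_prob_def gg, rule_format, OF e2] by blast
    define R where "R = R1 + \<bar>m1 / m2\<bar> * (2 * R2) + 4 * ((B + \<bar>cst\<bar>) * (R2 + m2))"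
    have "0 \<le> \<bar>m1 / m2\<bar> * (2 * R2)" "0 \<le> 4 * ((B + \<bar>cst\<bar>) * (R2 + m2))" using R2 B m2_pos by auto
    hence R: "0 < R" using R1(1) unfolding R_def by linarith
    show "\<exists>R>0. \<forall>n\<ge>1. \<exists>A\<in>sets FB.LJ. measure FB.LJ A \<le> \<epsilon> \<and> (\<forall>y\<in>space FB.LJ - A.
        pvar_le p (\<lambda>l. (\<Sum>a<l. w ((f ^^ a) y)) - real l * cst) n (R * real n powr \<gamma>))"
    proof (intro exI[of _ R] conjI allI impI R)
      fix n :: nat assume n: "1 \<le> n"
      obtain A1 where A1: "A1 \<in> sets FB.LJ" "measure FB.LJ A1 \<le> \<epsilon>/2"
        "\<forall>y\<in>space FB.LJ - A1. pvar_le p (\<lambda>l. (\<Sum>j<l. Q ((F ^^ j) y)) - real l * m1) n (R1 * real n powr \<gamma>)"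
        using R1(2)[OF n] by blast
      obtain A2 where A2: "A2 \<in> sets FB.LJ" "measure FB.LJ A2 \<le> \<epsilon>/2"
        "\<forall>y\<in>space FB.LJ - A2. pvar_le p (\<lambda>l. (\<Sum>j<l. real (rt ((F ^^ j) y))) - real l * m2) (Suc n) (R2 * real (Suc n) powr \<gamma>)"
        using R2(2)[of "Suc n"] by auto
      define A where "A = A1 \<union> A2 \<union> Bad"
      have A: "A \<in> sets FB.LJ" unfolding A_def using A1 A2 Bad by auto
      have "measure FB.LJ A \<le> measure FB.LJ (A1 \<union> A2) + measure FB.LJ Bad"
        unfolding A_def using A1 A2 Bad by (intro measure_Un_le) auto
      also have "measure FB.LJ (A1 \<union> A2) \<le> measure FB.LJ A1 + measure FB.LJ A2"
        using A1 A2 by (intro measure_Un_le) auto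
      finally have mA: "measure FB.LJ A \<le> \<epsilon>" using A1 A2 Bad by simp
      have "pvar_le p (\<lambda>l. (\<Sum>a<l. w ((f ^^ a) y)) - real l * cst) n (R * real n powr \<gamma>)"
        if y: "y \<in> space FB.LJ - A" for y
      proof -
        have yO: "y \<in> O'" using y by simp
        have cov: "covered ((F ^^ j) y)" for j
        proof -
          have "(F ^^ j) y \<in> O'" by (rule FB.F_iter_in[OF yO])
          moreover have "(F ^^ j) y \<notin> N0" using y yO unfolding A_def Bad_def by blast
          ultimately show ?thesis unfolding N0_def by blast
        qed
        have y1: "pvar_le p (\<lambda>l. (\<Sum>j<l. excursion_sum w ((F ^^ j) y) + B0 * real (rt ((F ^^ j) y))) - real l * m1) n (R1 * real n powr \<gamma>)"
          using A1(3) y unfolding A_def Q_def by blast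
        have y2: "pvar_le p (\<lambda>l. (\<Sum>j<l. real (rt ((F ^^ j) y))) - real l * m2) (Suc n) (R2 * real (Suc n) powr \<gamma>)"
          using A2(3) y unfolding A_def by blast
        show ?thesis unfolding R_def cst_def
          by (rule pvar_real_time[OF p1 cov n _ _ _ B wB y1 y2]) (use R1 R2 m2_pos in auto)
      qed
      thus "\<exists>A\<in>sets FB.LJ. measure FB.LJ A \<le> \<epsilon> \<and> (\<forall>y\<in>space FB.LJ - A.
        pvar_le p (\<lambda>l. (\<Sum>a<l. w ((f ^^ a) y)) - real l * cst) n (R * real n powr \<gamma>))"
        using A mA by blast
    qed
  qed
  thus ?thesis unfolding FB.LJ_def by blast
qed

text \<open>For \<open>y = (1 + z) / c\<close> in the reference interval \<open>f y = z\<close>, so the path of \<open>z\<close> is the path of \<open>y\<close> without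
its first step, and Lebesgue measure is scaled by \<open>c\<close>.\<close>

theorem bounded_in_prob_unit_interval:
  assumes w_meas: "w \<in> borel_measurable borel" and wB: "\<And>x. \<bar>w x\<bar> \<le> B"
    and hold: "\<And>x y. \<bar>w x - w y\<bar> \<le> C * \<bar>x - y\<bar> powr \<eta>" and C: "0 \<le> C" and \<eta>: "0 < \<eta>" "\<eta> \<le> 1"
    and p: "1/\<gamma> < p" "p < 2"
  shows "\<exists>cst. bounded_in_prob (restrict_space lborel {0..1})
    (\<lambda>n y R. pvar_le p (\<lambda>l. (\<Sum>a<l. w ((f ^^ a) y)) - real l * cst) n (R * real n powr \<gamma>))"
proof -
  obtain cst where b: "bounded_in_prob (restrict_space lborel O')
    (\<lambda>n y R. pvar_le p (\<lambda>l. (\<Sum>a<l. w ((f ^^ a) y)) - real l * cst) n (R * real n powr \<gamma>))"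
    using bounded_in_prob_reference_interval[OF assms] by blast
  have p0: "0 \<le> p" using p \<gamma> order_trans[of 0 "1/\<gamma>" p] by simp
  have "bounded_in_prob (restrict_space lborel {0..1})
    (\<lambda>n y R. pvar_le p (\<lambda>l. (\<Sum>a<l. w ((f ^^ a) y)) - real l * cst) n (R * real n powr \<gamma>))"
    unfolding bounded_in_prob_def
  proof (intro allI impI)
    fix \<epsilon> :: real assume \<epsilon>: "0 < \<epsilon>"
    hence ec: "0 < \<epsilon> / c" using cpos by simp
    obtain R where R: "R > 0" "\<And>n. n \<ge> 1 \<Longrightarrow> \<exists>A\<in>sets (restrict_space lborel O'). measure (restrict_space lborel O') A \<le> \<epsilon> / c \<and>
      (\<forall>y\<in>space (restrict_space lborel O') - A. pvar_le p (\<lambda>l. (\<Sum>a<l. w ((f ^^ a) y)) - real l * cst) n (R * real n powr \<gamma>))"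
      using b[unfolded bounded_in_prob_def, rule_format, OF ec] by blast
    show "\<exists>R>0. \<forall>n\<ge>1. \<exists>A\<in>sets (restrict_space lborel {0..1}). measure (restrict_space lborel {0..1}) A \<le> \<epsilon> \<and>
      (\<forall>y\<in>space (restrict_space lborel {0..1}) - A. pvar_le p (\<lambda>l. (\<Sum>a<l. w ((f ^^ a) y)) - real l * cst) n (R * real n powr \<gamma>))"
    proof (intro exI[of _ "2 * R"] conjI allI impI)
      show "0 < 2 * R" using R by simp
      fix n :: nat assume n: "1 \<le> n"
      obtain A where A: "A \<in> sets (restrict_space lborel O')" "measure (restrict_space lborel O') A \<le> \<epsilon> / c"
        "\<forall>y\<in>space (restrict_space lborel O') - A. pvar_le p (\<lambda>l. (\<Sum>a<l. w ((f ^^ a) y)) - real l * cst) (Suc n) (R * real (Suc n) powr \<gamma>)"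
        using R(2)[of "Suc n"] by auto
      have Ab: "A \<in> sets borel" "A \<subseteq> O'" using A(1) by (auto simp: sets_restrict_space_iff)
      note [measurable] = Ab(1)
      have mA: "measure lborel A \<le> \<epsilon> / c" using A(2) Ab by (subst (asm) measure_restrict_space) auto
      define A' where "A' = {z\<in>{0..1}. (1 + z) / c \<in> A}"
      have A'b: "A' \<in> sets borel" unfolding A'_def by measurable
      \<comment> \<open>the end points correspond to no point of the open reference interval\<close>
      define A'' where "A'' = A' \<union> {0, 1}"
      have le12: "1/c \<le> 2/c" using cpos by (simp add: divide_right_mono)
      have fin: "emeasure lborel A < \<infinity>"
      proof -
        have "emeasure lborel A \<le> emeasure lborel O'" using Ab by (intro emeasure_mono) auto
        also have "\<dots> < \<infinity>" using le12 by simp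
        finally show ?thesis .
      qed
      have "emeasure lborel A' \<le> emeasure lborel {z. 1/c + 1/c * z \<in> A}"
        by (intro emeasure_mono) (auto simp: A'_def add_divide_distrib)
      also have "\<dots> = ennreal c * emeasure lborel A"
      proof -
        have "emeasure lborel A = (\<integral>\<^sup>+x. indicator A x \<partial>lborel)" by simp
        also have "\<dots> = ennreal \<bar>1/c\<bar> * (\<integral>\<^sup>+x. indicator A (1/c + 1/c * x) \<partial>lborel)"
          using cpos by (intro nn_integral_real_affine) auto
        also have "(\<integral>\<^sup>+x. indicator A (1/c + 1/c * x) \<partial>lborel) = (\<integral>\<^sup>+x. indicator {z. 1/c + 1/c * z \<in> A} x \<partial>lborel)"
          by (intro nn_integral_cong) (auto simp: indicator_def)
        also have "\<dots> = emeasure lborel {z. 1/c + 1/c * z \<in> A}" by simp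
        finally have "ennreal c * emeasure lborel A = (ennreal c * ennreal \<bar>1/c\<bar>) * emeasure lborel {z. 1/c + 1/c * z \<in> A}"
          by (simp add: mult.assoc)
        also have "ennreal c * ennreal \<bar>1/c\<bar> = 1" using cpos by (simp flip: ennreal_mult)
        finally show ?thesis by simp
      qed
      finally have "emeasure lborel A' \<le> ennreal c * emeasure lborel A" .
      also have "emeasure lborel A = ennreal (measure lborel A)" using fin by (simp add: emeasure_eq_ennreal_measure)
      also have "ennreal c * ennreal (measure lborel A) = ennreal (c * measure lborel A)" using cpos by (simp add: ennreal_mult)
      finally have "measure lborel A' \<le> c * measure lborel A"
        using cpos by (simp add: measure_def enn2real_leI)
      also have "\<dots> \<le> c * (\<epsilon> / c)" using mA cpos by (intro mult_left_mono) auto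
      also have "\<dots> = \<epsilon>" using cpos by simp
      finally have mA': "measure lborel A' \<le> \<epsilon>" .
      have "measure lborel A'' \<le> measure lborel A' + measure lborel {0, 1::real}"
        unfolding A''_def using A'b by (intro measure_Un_le) auto
      also have "measure lborel {0, 1::real} = 0" by (intro measure_eq_0_null_sets finite_imp_null_set_lborel) simp
      finally have mA'': "measure lborel A'' \<le> \<epsilon>" using mA' by simp
      have sub: "A'' \<subseteq> {0..1}" by (auto simp: A''_def A'_def)
      have A''s: "A'' \<in> sets (restrict_space lborel {0..1})"
        using A'b sub by (simp add: sets_restrict_space_iff A''_def)
      have A''m: "measure (restrict_space lborel {0..1}) A'' \<le> \<epsilon>"
        using mA'' sub by (subst measure_restrict_space) auto
      have N_le: "real (Suc n) powr \<gamma> \<le> 2 * real n powr \<gamma>"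
      proof -
        have "real (Suc n) powr \<gamma> \<le> (2 * real n) powr \<gamma>" using n \<gamma> by (intro powr_mono2) auto
        also have "\<dots> = 2 powr \<gamma> * real n powr \<gamma>" by (rule powr_mult)
        also have "\<dots> \<le> 2 powr 1 * real n powr \<gamma>" using \<gamma> by (intro mult_right_mono powr_mono) auto
        finally show ?thesis by simp
      qed
      have "pvar_le p (\<lambda>l. (\<Sum>a<l. w ((f ^^ a) z)) - real l * cst) n (2 * R * real n powr \<gamma>)"
        if z: "z \<in> space (restrict_space lborel {0..1}) - A''" for z
      proof -
        have z01: "0 < z" "z < 1" using z by (auto simp: A''_def space_restrict_space less_le)
        define y where "y = (1 + z) / c"
        have y: "y \<in> O'" using z01 cpos by (auto simp: y_def intro: divide_strict_right_mono)
        have "y \<notin> A" using z z01 by (auto simp: A''_def A'_def y_def)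
        hence pv: "pvar_le p (\<lambda>l. (\<Sum>a<l. w ((f ^^ a) y)) - real l * cst) (Suc n) (R * real (Suc n) powr \<gamma>)"
          using A(3) y by (auto simp: space_restrict_space)
        have fy: "f y = z" using f_mid[of y] y cpos by (simp add: y_def)
        have "(\<Sum>a<Suc l. w ((f ^^ a) y)) - real (Suc l) * cst - (w y - cst) = (\<Sum>a<l. w ((f ^^ a) z)) - real l * cst" for l
          by (subst sum.lessThan_Suc_shift) (simp add: funpow_swap1 fy algebra_simps del: sum.lessThan_Suc)
        with pvar_le_shift[OF pv, of "w y - cst"]
        have pv': "pvar_le p (\<lambda>l. (\<Sum>a<l. w ((f ^^ a) z)) - real l * cst) n (R * real (Suc n) powr \<gamma>)" by simp
        show ?thesis
        proof (rule pvar_le_mono[OF pv' order_refl])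
          show "R * real (Suc n) powr \<gamma> \<le> 2 * R * real n powr \<gamma>"
            using mult_left_mono[OF N_le, of R] R(1) by simp
        qed (use R(1) p0 in auto)
      qed
      thus "\<exists>A\<in>sets (restrict_space lborel {0..1}). measure (restrict_space lborel {0..1}) A \<le> \<epsilon> \<and>
        (\<forall>y\<in>space (restrict_space lborel {0..1}) - A. pvar_le p (\<lambda>l. (\<Sum>a<l. w ((f ^^ a) y)) - real l * cst) n (2 * R * real n powr \<gamma>))"
        using A''s A''m by blast
    qed
  qed
  thus ?thesis by blast
qed

end

section \<open>The intermittent maps and their partial sum processes\<close>

lemma intermittent_map_I:
  assumes "1 < \<alpha>" "\<alpha> < 2"
  shows "intermittent 2 (1/\<alpha>) (map_I \<alpha>) (\<lambda>i. i) (\<lambda>_. False)"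
proof -
  interpret neutral_branch 2 "1/\<alpha>" using assms by unfold_locales (auto simp: field_simps)
  show ?thesis
  proof
    show "map_I \<alpha> \<in> borel_measurable borel" unfolding map_I_def[abs_def] by measurable
  qed (auto simp: map_I_def G_def)
qed

text \<open>The even indices stand for the excursions near \<open>0\<close>, the odd ones for those near \<open>1\<close>. The index \<open>0\<close> is the immediate return.\<close>

lemma intermittent_map_II:
  assumes "1 < \<alpha>" "\<alpha> < 2"
  shows "intermittent 3 (1/\<alpha>) (map_II \<alpha>) (\<lambda>i. Suc i div 2) odd"
proof -
  interpret neutral_branch 3 "1/\<alpha>" using assms by unfold_locales (auto simp: field_simps)
  show ?thesis
  proof
    show "map_II \<alpha> \<in> borel_measurable borel" unfolding map_II_def[abs_def] by measurable
    show "Suc i div 2 \<noteq> Suc j div 2 \<or> odd i \<noteq> odd j" if "i \<noteq> j" for i j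
      using that by presburger
    show "\<exists>i. Suc i div 2 = n \<and> \<not> odd i" for n by (intro exI[of _ "2 * n"]) auto
    show "\<exists>i. Suc i div 2 = n \<and> odd i" if "1 \<le> n" for n
      using that by (intro exI[of _ "2 * n - 1"]) presburger
    show "3 = 3 \<and> 1 \<le> Suc i div 2" if "odd i" for i using that by presburger
  qed (auto simp: map_II_def G_def)
qed

lemma map_I_unit: assumes "1 < \<alpha>" "0 \<le> y" "y \<le> 1" shows "0 \<le> map_I \<alpha> y" "map_I \<alpha> y \<le> 1"
proof -
  have *: "2 powr (1/\<alpha>) * y powr (1/\<alpha>) \<le> 1" if "y < 1/2"
    using powr_mono2[of "1/\<alpha>" "2 * y" 1] that assms by (simp add: powr_mult)
  show "0 \<le> map_I \<alpha> y" using assms by (simp add: map_I_def)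
  show "map_I \<alpha> y \<le> 1"
  proof (cases "y < 1/2")
    case True
    have "y * (1 + 2 powr (1/\<alpha>) * y powr (1/\<alpha>)) \<le> y * 2" using *[OF True] assms by (intro mult_left_mono) auto
    thus ?thesis using True by (simp add: map_I_def)
  qed (use assms in \<open>simp add: map_I_def\<close>)
qed

lemma map_II_unit: assumes "1 < \<alpha>" "0 \<le> y" "y \<le> 1" shows "0 \<le> map_II \<alpha> y" "map_II \<alpha> y \<le> 1"
proof -
  have *: "z * (1 + 3 powr (1/\<alpha>) * z powr (1/\<alpha>)) \<le> z * 2" if "0 \<le> z" "z \<le> 1/3" for z
    using powr_mono2[of "1/\<alpha>" "3 * z" 1] that assms by (intro mult_left_mono) (simp_all add: powr_mult)
  have **: "0 \<le> z * (1 + 3 powr (1/\<alpha>) * z powr (1/\<alpha>))" if "0 \<le> z" for z using that by simp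
  show "0 \<le> map_II \<alpha> y" "map_II \<alpha> y \<le> 1"
    using assms *[of y] *[of "1 - y"] **[of y] **[of "1 - y"] by (auto simp: map_II_def)
qed

text \<open>The components of \<open>v\<close> are extended to functions that are bounded and Hoelder on the whole line.\<close>

lemma clamp_bound_holder:
  fixes v :: "real \<Rightarrow> real ^ 'd"
  assumes "\<forall>x\<in>{0..1}. \<forall>y\<in>{0..1}. dist (v x) (v y) \<le> C * dist x y powr \<eta>" and \<eta>: "0 < \<eta>" and C: "0 \<le> C"
  defines "w \<equiv> \<lambda>i x. v (max 0 (min 1 x)) $ i"
  shows "\<bar>w i x - w i y\<bar> \<le> C * \<bar>x - y\<bar> powr \<eta>" "\<bar>w i x\<bar> \<le> norm (v 0) + C" "w i \<in> borel_measurable borel"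
proof -
  define k where "k x = max 0 (min 1 x)" for x :: real
  have k: "k x \<in> {0..1}" and k_lip: "\<bar>k x - k y\<bar> \<le> \<bar>x - y\<bar>" for x y
    unfolding k_def by (simp, linarith)
  have w_k: "w i x = v (k x) $ i" for x by (simp add: w_def k_def)
  have hv: "norm (v a - v b) \<le> C * \<bar>a - b\<bar> powr \<eta>" if "a \<in> {0..1}" "b \<in> {0..1}" for a b
    using assms(1) that unfolding dist_norm real_norm_def by blast
  have h: "\<bar>w i x - w i y\<bar> \<le> C * \<bar>x - y\<bar> powr \<eta>" for x y
  proof -
    have "\<bar>w i x - w i y\<bar> \<le> norm (v (k x) - v (k y))"
      using component_le_norm_cart[of "v (k x) - v (k y)" i] by (simp add: w_k)
    also have "\<dots> \<le> C * \<bar>k x - k y\<bar> powr \<eta>" by (rule hv[OF k k])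
    also have "\<dots> \<le> C * \<bar>x - y\<bar> powr \<eta>"
      using k_lip \<eta> C by (intro mult_left_mono powr_mono2) auto
    finally show ?thesis .
  qed
  show "\<bar>w i x - w i y\<bar> \<le> C * \<bar>x - y\<bar> powr \<eta>" by (rule h)
  have "norm (v (k x)) \<le> norm (v 0) + norm (v (k x) - v 0)" by (rule norm_triangle_sub)
  moreover have "norm (v (k x) - v 0) \<le> C * \<bar>k x - 0\<bar> powr \<eta>" by (rule hv[OF k]) simp
  moreover have "C * \<bar>k x - 0\<bar> powr \<eta> \<le> C * 1"
  proof (rule mult_left_mono)
    have "\<bar>k x - 0\<bar> powr \<eta> \<le> 1 powr \<eta>" using \<eta> k[of x] by (intro powr_mono2) auto
    thus "\<bar>k x - 0\<bar> powr \<eta> \<le> 1" by simp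
  qed (rule C)
  moreover have "\<bar>w i x\<bar> \<le> norm (v (k x))" using component_le_norm_cart[of "v (k x)" i] by (simp add: w_k)
  ultimately show "\<bar>w i x\<bar> \<le> norm (v 0) + C" by linarith
  have "continuous_on UNIV (w i)"
    unfolding continuous_on_def
  proof
    fix a :: real
    have "((\<lambda>x. \<bar>x - a\<bar>) \<longlongrightarrow> \<bar>a - a\<bar>) (at a)" by (intro tendsto_intros)
    hence 0: "((\<lambda>x. \<bar>x - a\<bar>) \<longlongrightarrow> 0) (at a)" by simp
    have "((\<lambda>x. \<bar>x - a\<bar> powr \<eta>) \<longlongrightarrow> 0) (at a)"
      by (rule tendsto_zero_powrI[OF 0 tendsto_const _ \<eta>]) simp
    hence lim: "((\<lambda>x. C * \<bar>x - a\<bar> powr \<eta>) \<longlongrightarrow> 0) (at a)" by (rule tendsto_mult_right_zero)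
    have "((\<lambda>x. w i x - w i a) \<longlongrightarrow> 0) (at a)"
      by (rule Lim_null_comparison[OF _ lim]) (simp only: real_norm_def h eventually_True)
    thus "(w i \<longlongrightarrow> w i a) (at a within UNIV)" by (rule LIM_zero_cancel)
  qed
  thus "w i \<in> borel_measurable borel" by (rule borel_measurable_continuous_onI)
qed

lemma minkowski_powr_sum_finite:
  fixes x :: "'a \<Rightarrow> 'b \<Rightarrow> real"
  assumes "1 \<le> p" "finite I" "finite S" "\<And>i j. 0 \<le> x i j" "\<And>i. i \<in> I \<Longrightarrow> 0 \<le> R i"
    "\<And>i. i \<in> I \<Longrightarrow> (\<Sum>j\<in>S. x i j powr p) \<le> R i powr p"
  shows "(\<Sum>j\<in>S. (\<Sum>i\<in>I. x i j) powr p) \<le> (\<Sum>i\<in>I. R i) powr p"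
  using assms(2,5,6)
proof (induction I rule: finite_induct)
  case (insert a I)
  have "(\<Sum>j\<in>S. (x a j + (\<Sum>i\<in>I. x i j)) powr p) \<le> (R a + (\<Sum>i\<in>I. R i)) powr p"
    using insert assms(1,3,4) by (intro minkowski_powr_sum) (auto intro!: sum_nonneg)
  thus ?case using insert by simp
qed (use assms in simp)

lemma unit_partition_chain:
  assumes "(k, t) \<in> unit_partitions"
  shows "interval_chain n k (\<lambda>j. nat \<lfloor>real n * t j\<rfloor>) (\<lambda>j. nat \<lfloor>real n * t (Suc j)\<rfloor>)"
proof -
  have t: "t 0 = 0" "t k = 1" "\<And>j. j < k \<Longrightarrow> t j < t (Suc j)" using assms by (auto simp: unit_partitions_def)
  have le1: "t j \<le> 1" if "j \<le> k" for j
    using that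
  proof (induction rule: inc_induct)
    case (step m)
    thus ?case using t(3)[of m] by simp
  qed (use t in simp)
  have "nat \<lfloor>real n * t j\<rfloor> \<le> nat \<lfloor>real n * t (Suc j)\<rfloor>" if "j < k" for j
    using t(3)[OF that] by (intro nat_mono floor_mono mult_left_mono) auto
  moreover have "nat \<lfloor>real n * t (Suc j)\<rfloor> \<le> n" if "j < k" for j
  proof -
    have "real n * t (Suc j) \<le> real n * 1" using le1[of "Suc j"] that by (intro mult_left_mono) auto
    hence "\<lfloor>real n * t (Suc j)\<rfloor> \<le> int n" by linarith
    thus ?thesis by linarith
  qed
  ultimately show ?thesis by (auto simp: interval_chain_def)
qed

text \<open>Rounding the times \<open>n * t j\<close> down turns a partition of the unit interval into a chain of
intervals of natural numbers. Minkowski's inequality then combines the components of \<open>v\<close>.\<close>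

lemma p_variation_W_le:
  fixes v :: "real \<Rightarrow> real ^ 'd"
  assumes p: "1 \<le> p"
    and pv: "\<And>i. pvar_le p (\<lambda>l. \<Sum>a<l. v ((f ^^ a) y) $ i) n (R i)" and R: "\<And>i. 0 \<le> R i"
  shows "p_variation p (W \<alpha> f v n y) \<le> ennreal (real n powr (- 1/\<alpha>) * (\<Sum>i\<in>UNIV. R i))"
  unfolding p_variation_def
proof (rule SUP_least)
  fix z assume "z \<in> (unit_partitions :: (nat \<times> (nat \<Rightarrow> real)) set)"
  then obtain k t where z: "z = (k, t)" "(k, t) \<in> unit_partitions" by (cases z) auto
  note c = unit_partition_chain[OF z(2), of n]
  define S where "S l = (\<Sum>a<l. v ((f ^^ a) y))" for l
  define s where "s j = nat \<lfloor>real n * t j\<rfloor>" for j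
  define A where "A = real n powr (- 1/\<alpha>)"
  have A: "0 \<le> A" by (simp add: A_def)
  have S_i: "S l $ i = (\<Sum>a<l. v ((f ^^ a) y) $ i)" for l i by (simp add: S_def)
  have "(\<Sum>j=1..k. norm (W \<alpha> f v n y (t j) - W \<alpha> f v n y (t (j - 1))) powr p)
      = (\<Sum>j<k. norm (W \<alpha> f v n y (t (Suc j)) - W \<alpha> f v n y (t j)) powr p)"
    by (simp add: sum.atLeast1_atMost_eq)
  also have "\<dots> = (\<Sum>j<k. (A * norm (S (s (Suc j)) - S (s j))) powr p)"
    by (simp add: W_def A_def S_def s_def flip: scaleR_diff_right)
  also have "\<dots> \<le> (\<Sum>j<k. (\<Sum>i\<in>UNIV. A * \<bar>S (s (Suc j)) $ i - S (s j) $ i\<bar>) powr p)"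
  proof (intro sum_mono powr_mono2)
    fix j
    have "norm (S (s (Suc j)) - S (s j)) \<le> (\<Sum>i\<in>UNIV. \<bar>(S (s (Suc j)) - S (s j)) $ i\<bar>)" by (rule norm_le_l1_cart)
    hence "A * norm (S (s (Suc j)) - S (s j)) \<le> A * (\<Sum>i\<in>UNIV. \<bar>S (s (Suc j)) $ i - S (s j) $ i\<bar>)"
      using A by (intro mult_left_mono) auto
    thus "A * norm (S (s (Suc j)) - S (s j)) \<le> (\<Sum>i\<in>UNIV. A * \<bar>S (s (Suc j)) $ i - S (s j) $ i\<bar>)"
      by (simp add: sum_distrib_left)
  qed (use p A in auto)
  also have "\<dots> \<le> (\<Sum>i\<in>UNIV. A * R i) powr p"
  proof (rule minkowski_powr_sum_finite)
    fix i :: 'd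
    have "(\<Sum>j<k. (A * \<bar>S (s (Suc j)) $ i - S (s j) $ i\<bar>) powr p) = A powr p * (\<Sum>j<k. \<bar>S (s (Suc j)) $ i - S (s j) $ i\<bar> powr p)"
      by (simp add: powr_mult sum_distrib_left)
    also have "\<dots> \<le> A powr p * R i powr p"
      using pvar_leD[OF pv c, of i] unfolding S_i s_def by (intro mult_left_mono) auto
    finally show "(\<Sum>j<k. (A * \<bar>S (s (Suc j)) $ i - S (s j) $ i\<bar>) powr p) \<le> (A * R i) powr p" by (simp add: powr_mult)
  qed (use p A R in auto)
  finally have "(\<Sum>j=1..k. norm (W \<alpha> f v n y (t j) - W \<alpha> f v n y (t (j - 1))) powr p) powr (1/p)
      \<le> ((\<Sum>i\<in>UNIV. A * R i) powr p) powr (1/p)"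
    using p by (intro powr_mono2) (auto intro!: sum_nonneg)
  also have "\<dots> = A * (\<Sum>i\<in>UNIV. R i)"
    using p A R by (simp add: powr_powr sum_distrib_left sum_nonneg)
  finally show "(case z of (k, t) \<Rightarrow> ennreal ((\<Sum>j=1..k. norm (W \<alpha> f v n y (t j) - W \<alpha> f v n y (t (j - 1))) powr p) powr (1/p)))
      \<le> ennreal (real n powr (- 1/\<alpha>) * (\<Sum>i\<in>UNIV. R i))"
    unfolding z(1) by (simp add: A_def ennreal_leI)
qed

lemma p_variation_W_finite:
  fixes v :: "real \<Rightarrow> real ^ 'd"
  assumes "1 \<le> p"
  shows "p_variation p (W \<alpha> f v n y) < \<infinity>"
proof -
  have "p_variation p (W \<alpha> f v n y) \<le> ennreal (real n powr (- 1/\<alpha>) *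
     (\<Sum>i\<in>UNIV. \<Sum>l<n. \<bar>(\<Sum>a<Suc l. v ((f ^^ a) y) $ i) - (\<Sum>a<l. v ((f ^^ a) y) $ i)\<bar>))"
    by (intro p_variation_W_le assms pvar_le_total_variation sum_nonneg) auto
  also have "\<dots> < \<infinity>" by simp
  finally show ?thesis .
qed

text \<open>The path is a step function, so a partition enters only through finitely many natural numbers,
and the supremum is over a countable set.\<close>

lemma p_variation_W_measurable:
  fixes v :: "real \<Rightarrow> real ^ 'd"
  assumes S: "\<And>l. (\<lambda>y. \<Sum>a<l. v ((f ^^ a) y)) \<in> borel_measurable M"
  shows "(\<lambda>y. p_variation p (W \<alpha> f v n y)) \<in> borel_measurable M"
proof -
  define \<Phi> where "\<Phi> z = (case z of (k, t) \<Rightarrow> map (\<lambda>j. nat \<lfloor>real n * t j\<rfloor>) [0..<Suc k])" for z :: "nat \<times> (nat \<Rightarrow> real)"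
  define g where "g xs y = ennreal ((\<Sum>j=1..length xs - 1. norm (real n powr (- 1/\<alpha>) *\<^sub>R (\<Sum>a<xs ! j. v ((f ^^ a) y))
      - real n powr (- 1/\<alpha>) *\<^sub>R (\<Sum>a<xs ! (j - 1). v ((f ^^ a) y))) powr p) powr (1/p))" for xs y
  have eq: "p_variation p (W \<alpha> f v n y) = (SUP xs\<in>\<Phi> ` unit_partitions. g xs y)" for y
  proof -
    have "(case z of (k, t) \<Rightarrow> ennreal ((\<Sum>j=1..k. norm (W \<alpha> f v n y (t j) - W \<alpha> f v n y (t (j - 1))) powr p) powr (1/p))) = g (\<Phi> z) y" for z
    proof -
      obtain k t where z: "z = (k, t)" by (cases z)
      have "(\<Phi> z) ! j = nat \<lfloor>real n * t j\<rfloor>" if "j \<le> k" for j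
        unfolding \<Phi>_def z using that by (simp add: nth_append del: upt_Suc)
      moreover have "length (\<Phi> z) - 1 = k" by (simp add: \<Phi>_def z)
      ultimately show ?thesis unfolding z g_def W_def by (auto intro!: arg_cong[where f = ennreal] arg_cong2[where f = "(powr)"] sum.cong)
    qed
    thus ?thesis unfolding p_variation_def by (simp add: image_image)
  qed
  have "g xs \<in> borel_measurable M" for xs unfolding g_def[abs_def] using S by measurable
  moreover have "countable (\<Phi> ` unit_partitions)" by (rule countableI_type)
  ultimately show ?thesis unfolding eq by (intro borel_measurable_SUP)
qed

text \<open>A drift \<open>cst\<close> would make the expectation of \<open>\<bar>S n - n * cst\<bar>\<close> grow linearly. Off a small
exceptional set it is of order \<open>n powr g\<close>, and the exceptional set contributes only a small multiple of \<open>n\<close>.\<close>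

lemma (in prob_space) bounded_fluctuations_imp_zero_drift:
  fixes S :: "nat \<Rightarrow> 'a \<Rightarrow> real"
  assumes int: "\<And>n. integrable M (S n)" and zero: "\<And>n. expectation (S n) = 0"
    and bound: "\<And>n y. y \<in> space M \<Longrightarrow> \<bar>S n y\<bar> \<le> real n * B" and S0: "\<And>y. S 0 y = 0"
    and b: "bounded_in_prob M (\<lambda>n y R. pvar_le p (\<lambda>l. S l y - real l * cst) n (R * real n powr g))"
    and g: "g < 1" and p: "0 < p" and B: "0 \<le> B"
  shows "cst = 0"
proof (rule ccontr)
  assume "cst \<noteq> 0"
  define K where "K = B + \<bar>cst\<bar>"
  have K: "0 < K" using \<open>cst \<noteq> 0\<close> B by (simp add: K_def)
  have "0 < \<bar>cst\<bar> / (4 * K)" using \<open>cst \<noteq> 0\<close> K by simp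
  then obtain R where R: "R > 0" "\<And>n. n \<ge> 1 \<Longrightarrow> \<exists>A\<in>sets M. measure M A \<le> \<bar>cst\<bar> / (4 * K) \<and>
      (\<forall>y\<in>space M - A. pvar_le p (\<lambda>l. S l y - real l * cst) n (R * real n powr g))"
    using b unfolding bounded_in_prob_def by blast
  have main: "3/4 * \<bar>cst\<bar> * real n \<le> R * real n powr g" if n: "1 \<le> n" for n
  proof -
    obtain A where A: "A \<in> sets M" "measure M A \<le> \<bar>cst\<bar> / (4 * K)"
      "\<forall>y\<in>space M - A. pvar_le p (\<lambda>l. S l y - real l * cst) n (R * real n powr g)"
      using R(2)[OF n] by blast
    have pt: "\<bar>S n y - real n * cst\<bar> \<le> R * real n powr g + real n * K * indicator A y" if y: "y \<in> space M" for y
    proof (cases "y \<in> A")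
      case True
      have "\<bar>S n y - real n * cst\<bar> \<le> \<bar>S n y\<bar> + real n * \<bar>cst\<bar>" 
        using abs_triangle_ineq4[of "S n y" "real n * cst"] by (simp add: abs_mult)
      also have "\<dots> \<le> real n * K" using bound[OF y, of n] by (simp add: K_def distrib_left)
      finally have "\<bar>S n y - real n * cst\<bar> \<le> real n * K" .
      moreover have "0 \<le> R * real n powr g" using R by simp
      ultimately show ?thesis using True by simp
    next
      case False
      have "\<bar>(S n y - real n * cst) - (S 0 y - real 0 * cst)\<bar> \<le> R * real n powr g"
        using A(3) y False p R by (intro pvar_le_single) auto
      thus ?thesis using False S0 by simp
    qed
    have iA: "integrable M (indicator A :: 'a \<Rightarrow> real)" using A by (intro integrable_real_indicator) (auto simp: emeasure_eq_measure)
    have eq: "(\<integral>y. S n y - real n * cst \<partial>M) = - (real n * cst)"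
      using int zero by (simp add: prob_space)
    have "real n * \<bar>cst\<bar> = \<bar>\<integral>y. S n y - real n * cst \<partial>M\<bar>" unfolding eq by (simp add: abs_mult)
    also have "\<dots> \<le> (\<integral>y. \<bar>S n y - real n * cst\<bar> \<partial>M)" by (rule integral_abs_bound)
    also have "\<dots> \<le> (\<integral>y. R * real n powr g + real n * K * indicator A y \<partial>M)"
    proof (rule integral_mono[OF _ _ pt])
      show "integrable M (\<lambda>y. \<bar>S n y - real n * cst\<bar>)" using int[of n] by simp
      show "integrable M (\<lambda>y. R * real n powr g + real n * K * indicator A y)" using iA by simp
    qed
    also have "\<dots> = R * real n powr g + real n * K * measure M A"
      using iA A sets.sets_into_space[OF A(1)] by (simp add: prob_space Int_absorb1 Int_absorb2)
    also have "\<dots> \<le> R * real n powr g + real n * K * (\<bar>cst\<bar> / (4 * K))"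
      using A K by (intro add_left_mono mult_left_mono) auto
    also have "real n * K * (\<bar>cst\<bar> / (4 * K)) = real n * \<bar>cst\<bar> / 4" using K by simp
    finally have "3/4 * (real n * \<bar>cst\<bar>) \<le> R * real n powr g" by linarith
    thus ?thesis by (simp add: mult_ac)
  qed
  define X where "X = R / (3/4 * \<bar>cst\<bar>)"
  have X: "0 < X" using R \<open>cst \<noteq> 0\<close> by (simp add: X_def)
  obtain n :: nat where n: "X powr (1/(1-g)) < real n" using reals_Archimedean2 by blast
  have n1: "1 \<le> n" using n X by (cases n) auto
  have "X = (X powr (1/(1-g))) powr (1 - g)" using X g by (simp add: powr_powr)
  also have "\<dots> < real n powr (1 - g)" using n g by (intro powr_less_mono2) auto
  also have "\<dots> = real n / real n powr g" using n1 by (simp add: powr_diff)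
  finally have "X * real n powr g < real n" using n1 by (simp add: pos_less_divide_eq)
  hence "3/4 * \<bar>cst\<bar> * (X * real n powr g) < 3/4 * \<bar>cst\<bar> * real n"
    using \<open>cst \<noteq> 0\<close> by (intro mult_strict_left_mono) auto
  moreover have "3/4 * \<bar>cst\<bar> * (X * real n powr g) = R * real n powr g"
    using \<open>cst \<noteq> 0\<close> by (simp add: X_def)
  ultimately show False using main[OF n1] by linarith
qed

lemma integral_invariant_iterate:
  fixes u :: "'a \<Rightarrow> real"
  assumes inv: "invariant_measure f M" and u: "u \<in> borel_measurable M"
  shows "(\<integral>y. u ((f ^^ j) y) \<partial>M) = (\<integral>y. u y \<partial>M)"
proof (induction j)
  case (Suc j)
  have f: "f \<in> M \<rightarrow>\<^sub>M M" "distr M M f = M" using inv by (auto simp: invariant_measure_def)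
  have fj: "(f ^^ j) \<in> M \<rightarrow>\<^sub>M M" by (induction j) (auto simp: comp_def id_def intro: measurable_compose[OF _ f(1)])
  have "(\<integral>y. u ((f ^^ Suc j) y) \<partial>M) = (\<integral>y. u ((f ^^ j) (f y)) \<partial>M)" by (simp add: funpow_swap1)
  also have "\<dots> = (\<integral>y. u ((f ^^ j) y) \<partial>distr M M f)"
    using f(1) measurable_compose[OF fj u] by (intro integral_distr[symmetric])
  finally show ?case using Suc f(2) by simp
qed simp

lemma tight_distr_if_bounded_in_prob:
  assumes P: "prob_space P" and X: "\<And>n. X n \<in> borel_measurable P" and X0: "\<And>n y. 0 \<le> X n y"
    and b: "bounded_in_prob P (\<lambda>n y R. X (n - 1) y \<le> R)"
  shows "tight (\<lambda>n. distr P borel (X n))"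
  unfolding tight_def
proof (intro conjI allI impI)
  interpret P: prob_space P by fact
  show "real_distribution (distr P borel (X n))" for n
    by (rule P.real_distribution_distr[OF X])
  fix \<epsilon> :: real assume "0 < \<epsilon>"
  hence "0 < \<epsilon> / 2" by simp
  then obtain R where R: "R > 0" "\<And>n. n \<ge> 1 \<Longrightarrow> \<exists>A\<in>sets P. measure P A \<le> \<epsilon> / 2 \<and> (\<forall>y\<in>space P - A. X (n - 1) y \<le> R)"
    using b unfolding bounded_in_prob_def by blast
  show "\<exists>a b. a < b \<and> (\<forall>n. 1 - \<epsilon> < measure (distr P borel (X n)) {a<..b})"
  proof (rule exI[of _ "-1"], rule exI[of _ R], intro conjI allI)
    show "-1 < R" using R by simp
    fix n
    obtain A where A: "A \<in> sets P" "measure P A \<le> \<epsilon> / 2" "\<forall>y\<in>space P - A. X n y \<le> R"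
      using R(2)[of "Suc n"] by auto
    have "1 - \<epsilon> < 1 - measure P A" using A(2) \<open>0 < \<epsilon>\<close> by linarith
    also have "\<dots> = measure P (space P - A)" using A(1) by (simp add: P.prob_compl)
    also have "\<dots> \<le> measure P (X n -` {-1<..R} \<inter> space P)"
    proof (rule P.finite_measure_mono)
      show "space P - A \<subseteq> X n -` {-1<..R} \<inter> space P" using A(3) less_le_trans[OF _ X0[of n], of "-1"] by auto
      show "X n -` {-1<..R} \<inter> space P \<in> sets P" using X by (intro measurable_sets) auto
    qed
    also have "\<dots> = measure (distr P borel (X n)) {-1<..R}" using X by (subst measure_distr) auto
    finally show "1 - \<epsilon> < measure (distr P borel (X n)) {-1<..R}" .
  qed
qed

theorem theorem1p3:
  fixes \<alpha> p :: real
    and f :: "real \<Rightarrow> real"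
    and v :: "real \<Rightarrow> real ^ 'd"
    and \<mu> P :: "real measure"
  assumes "1 < \<alpha>" and "\<alpha> < 2"
    and "f = map_I \<alpha> \<or> f = map_II \<alpha>"
    and "abs_cont_prob \<mu>" and "invariant_measure f \<mu>"
    and "holder_on {0..1} v"
    and "(LINT y|\<mu>. v y) = 0"
    and "abs_cont_prob P"
    and "p > \<alpha>"
  shows "(\<forall>n\<ge>1. \<forall>y\<in>{0..1}. p_variation p (W \<alpha> f v n y) < \<infinity>) \<and>
         tight (\<lambda>n. distr P borel (\<lambda>y. enn2real (p_variation p (W \<alpha> f v (Suc n) y))))"
proof
  have p1: "1 \<le> p" using assms by simp
  show "\<forall>n\<ge>1. \<forall>y\<in>{0..1}. p_variation p (W \<alpha> f v n y) < \<infinity>" using p_variation_W_finite[OF p1] by blast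
  define LB where "LB = restrict_space lborel {0..1::real}"
  obtain \<eta> C where \<eta>: "0 < \<eta>" "\<eta> \<le> 1" and C: "0 \<le> C"
    and hv: "\<forall>x\<in>{0..1}. \<forall>y\<in>{0..1}. dist (v x) (v y) \<le> C * dist x y powr \<eta>"
    using assms(6) unfolding holder_on_def by blast
  define w where "w i x = v (max 0 (min 1 x)) $ i" for i x
  note w = clamp_bound_holder[OF hv \<eta>(1) C, folded w_def]
  have w_v: "w i y = v y $ i" if "y \<in> {0..1}" for i y using that by (simp add: w_def)
  \<comment> \<open>\<open>p\<close>-variation decreases in \<open>p\<close>, so an exponent between \<open>\<alpha>\<close> and \<open>2\<close> suffices\<close>
  define q where "q = (\<alpha> + min p 2) / 2"
  have q: "\<alpha> < q" "q < 2" "q \<le> p" "1 \<le> q" using assms(1,2,9) by (auto simp: q_def min_def field_simps)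
  have f_unit: "f y \<in> {0..1}" if "y \<in> {0..1}" for y
    using assms(1,3) that map_I_unit[of \<alpha> y] map_II_unit[of \<alpha> y] by auto
  have f_iter: "(f ^^ j) y \<in> {0..1}" if "y \<in> {0..1}" for j y
    using that f_unit by (induction j) auto
  have ex: "\<exists>cst. bounded_in_prob LB (\<lambda>n y R. pvar_le q (\<lambda>l. (\<Sum>a<l. w i ((f ^^ a) y)) - real l * cst) n (R * real n powr (1/\<alpha>)))" for i
  proof -
    have q': "1/(1/\<alpha>) < q" using q by simp
    show ?thesis
      using assms(3)
    proof
      assume f: "f = map_I \<alpha>"
      show ?thesis unfolding LB_def f
        by (rule intermittent.bounded_in_prob_unit_interval[OF intermittent_map_I[OF assms(1,2)] w(3) w(2) w(1) C \<eta> q' q(2)])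
    next
      assume f: "f = map_II \<alpha>"
      show ?thesis unfolding LB_def f
        by (rule intermittent.bounded_in_prob_unit_interval[OF intermittent_map_II[OF assms(1,2)] w(3) w(2) w(1) C \<eta> q' q(2)])
    qed
  qed
  have f_borel: "f \<in> borel_measurable borel"
    using assms(3) intermittent.f_meas[OF intermittent_map_I[OF assms(1,2)]] intermittent.f_meas[OF intermittent_map_II[OF assms(1,2)]] by auto
  have LB_sets: "sets LB = sets (restrict_space borel {0..1})"
    unfolding LB_def by (rule sets_restrict_space_cong) simp
  have LB_finite: "finite_measure LB"
    by standard (simp add: LB_def space_restrict_space emeasure_restrict_space)
  have M_space: "space M = {0..1}" and M_prob: "prob_space M" and M_sets: "sets M = sets (restrict_space borel {0..1})"
    and M_ac: "absolutely_continuous LB M" if "abs_cont_prob M" for M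
    using that sets_eq_imp_space_eq[of M "restrict_space borel {0..1}"]
    by (auto simp: abs_cont_prob_def LB_def space_restrict_space)
  have M_bd: "bounded_in_prob M \<Phi>" if "abs_cont_prob M" "bounded_in_prob LB \<Phi>" for M \<Phi>
  proof (rule bounded_in_prob_abs_cont[OF LB_finite _ _ M_ac[OF that(1)] that(2)])
    show "finite_measure M" using M_prob[OF that(1)] by (rule prob_space.finite_measure)
    show "sets M = sets LB" using M_sets[OF that(1)] LB_sets by simp
  qed
  have M_f: "(f ^^ j) \<in> M \<rightarrow>\<^sub>M M" if "abs_cont_prob M" for M j
  proof -
    have "f \<in> restrict_space borel {0..1} \<rightarrow>\<^sub>M restrict_space borel {0..1}"
      using f_borel f_unit by (intro measurable_restrict_space3) auto
    hence f: "f \<in> M \<rightarrow>\<^sub>M M" using M_sets[OF that] by (simp cong: measurable_cong_sets)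
    show ?thesis by (induction j) (auto simp: comp_def id_def intro: measurable_compose[OF _ f])
  qed
  have M_w: "w i \<in> borel_measurable M" if "abs_cont_prob M" for M i
    using measurable_restrict_space1[OF w(3)[of i], of "{0..1}"] M_sets[OF that] by (simp cong: measurable_cong_sets)
  have M_v: "v \<in> borel_measurable M" if "abs_cont_prob M" for M
  proof (subst borel_measurable_euclidean_space, intro ballI)
    fix b :: "real ^ 'd" assume "b \<in> Basis"
    then obtain i where b: "b = axis i 1" by (auto simp: Basis_vec_def)
    have "(\<lambda>x. v x \<bullet> b) \<in> borel_measurable M \<longleftrightarrow> w i \<in> borel_measurable M"
      using w_v M_space[OF that] by (intro measurable_cong) (simp add: b inner_axis)
    thus "(\<lambda>x. v x \<bullet> b) \<in> borel_measurable M" using M_w[OF that] by simp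
  qed
  define B where "B = norm (v 0) + C"
  have B: "0 \<le> B" using C by (simp add: B_def)
  have zero: "cst = 0"
    if b: "bounded_in_prob LB (\<lambda>n y R. pvar_le q (\<lambda>l. (\<Sum>a<l. w i ((f ^^ a) y)) - real l * cst) n (R * real n powr (1/\<alpha>)))" for cst i
  proof -
    interpret \<mu>: prob_space \<mu> by (rule M_prob[OF assms(4)])
    have int_w: "integrable \<mu> (\<lambda>y. w i ((f ^^ a) y))" for a
      using w(2) measurable_compose[OF M_f[OF assms(4)] M_w[OF assms(4)]]
      by (intro \<mu>.integrable_const_bound[of _ "norm (v 0) + C"]) auto
    have int_v: "integrable \<mu> v"
    proof (rule \<mu>.integrable_const_bound[of _ "norm (v 0) + C"])
      have "norm (v y) \<le> norm (v 0) + C" if "y \<in> {0..1}" for y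
      proof -
        have "norm (v y - v 0) \<le> C * \<bar>y\<bar> powr \<eta>" using hv[rule_format, of y 0] that by (simp add: dist_norm)
        also have "\<dots> \<le> C * 1" using C \<eta> that powr_mono2[of \<eta> "\<bar>y\<bar>" 1] by (intro mult_left_mono) auto
        finally show ?thesis using norm_triangle_sub[of "v y" "v 0"] by simp
      qed
      thus "AE y in \<mu>. norm (v y) \<le> norm (v 0) + C" using M_space[OF assms(4)] by auto
    qed (rule M_v[OF assms(4)])
    have Ew: "(\<integral>y. w i y \<partial>\<mu>) = 0"
    proof -
      have "(\<integral>y. w i y \<partial>\<mu>) = (\<integral>y. v y $ i \<partial>\<mu>)"
        using w_v M_space[OF assms(4)] by (intro Bochner_Integration.integral_cong) auto
      also have "\<dots> = (\<integral>y. v y \<partial>\<mu>) $ i"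
        by (rule integral_bounded_linear[OF bounded_linear_vec_nth int_v])
      finally show ?thesis using assms(7) by simp
    qed
    show ?thesis
    proof (rule \<mu>.bounded_fluctuations_imp_zero_drift[where S = "\<lambda>l y. \<Sum>a<l. w i ((f ^^ a) y)"])
      show "integrable \<mu> (\<lambda>y. \<Sum>a<n. w i ((f ^^ a) y))" for n using int_w by simp
      show "(\<integral>y. (\<Sum>a<n. w i ((f ^^ a) y)) \<partial>\<mu>) = 0" for n
        using int_w integral_invariant_iterate[OF assms(5) M_w[OF assms(4)]] Ew
        by (simp add: Bochner_Integration.integral_sum)
      show "\<bar>\<Sum>a<n. w i ((f ^^ a) y)\<bar> \<le> real n * B" for n y
      proof -
        have "\<bar>\<Sum>a<n. w i ((f ^^ a) y)\<bar> \<le> (\<Sum>a<n. \<bar>w i ((f ^^ a) y)\<bar>)" by (rule sum_abs)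
        also have "\<dots> \<le> (\<Sum>a<n. B)" unfolding B_def by (intro sum_mono w(2))
        finally show ?thesis by simp
      qed
      show "bounded_in_prob \<mu> (\<lambda>n y R. pvar_le q (\<lambda>l. (\<Sum>a<l. w i ((f ^^ a) y)) - real l * cst) n (R * real n powr (1/\<alpha>)))"
        by (rule M_bd[OF assms(4) b])
    qed (use assms(1) q B in auto)
  qed
  have bd: "bounded_in_prob P (\<lambda>n y R. pvar_le q (\<lambda>l. \<Sum>a<l. w i ((f ^^ a) y)) n (R * real n powr (1/\<alpha>)))" for i
  proof -
    obtain cst where b: "bounded_in_prob LB (\<lambda>n y R. pvar_le q (\<lambda>l. (\<Sum>a<l. w i ((f ^^ a) y)) - real l * cst) n (R * real n powr (1/\<alpha>)))"
      using ex by blast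
    have c0: "cst = 0" by (rule zero[OF b])
    from M_bd[OF assms(8) b] show ?thesis unfolding c0 by simp
  qed
  interpret P: prob_space P by (rule M_prob[OF assms(8)])
  show "tight (\<lambda>n. distr P borel (\<lambda>y. enn2real (p_variation p (W \<alpha> f v (Suc n) y))))"
  proof (rule tight_distr_if_bounded_in_prob[OF P.prob_space_axioms])
    fix n
    have "(\<lambda>y. \<Sum>a<l. v ((f ^^ a) y)) \<in> borel_measurable P" for l
      by (intro borel_measurable_sum measurable_compose[OF M_f[OF assms(8)] M_v[OF assms(8)]])
    hence "(\<lambda>y. p_variation p (W \<alpha> f v (Suc n) y)) \<in> borel_measurable P" by (rule p_variation_W_measurable)
    thus "(\<lambda>y. enn2real (p_variation p (W \<alpha> f v (Suc n) y))) \<in> borel_measurable P" by measurable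
    show "0 \<le> enn2real (p_variation p (W \<alpha> f v (Suc n) y))" for y by simp
  next
    show "bounded_in_prob P (\<lambda>n y R. enn2real (p_variation p (W \<alpha> f v (Suc (n - 1)) y)) \<le> R)"
      unfolding bounded_in_prob_def
    proof (intro allI impI)
      fix \<epsilon> :: real assume "0 < \<epsilon>"
      define e where "e = \<epsilon> / real CARD('d)"
      have e: "0 < e" using \<open>0 < \<epsilon>\<close> by (simp add: e_def)
      have "\<forall>i. \<exists>R>0. \<forall>n\<ge>1. \<exists>A\<in>sets P. measure P A \<le> e \<and>
          (\<forall>y\<in>space P - A. pvar_le q (\<lambda>l. \<Sum>a<l. w i ((f ^^ a) y)) n (R * real n powr (1/\<alpha>)))"
        using bd e unfolding bounded_in_prob_def by blast
      from choice[OF this] obtain R where "\<forall>i. R i > 0 \<and> (\<forall>n\<ge>1. \<exists>A\<in>sets P. measure P A \<le> e \<and>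
          (\<forall>y\<in>space P - A. pvar_le q (\<lambda>l. \<Sum>a<l. w i ((f ^^ a) y)) n (R i * real n powr (1/\<alpha>))))" ..
      hence R0: "\<And>i. R i > 0" and R: "\<And>i n. n \<ge> 1 \<Longrightarrow> \<exists>A\<in>sets P. measure P A \<le> e \<and>
          (\<forall>y\<in>space P - A. pvar_le q (\<lambda>l. \<Sum>a<l. w i ((f ^^ a) y)) n (R i * real n powr (1/\<alpha>)))"
        by blast+
      define r where "r = (\<Sum>i\<in>UNIV. R i)"
      show "\<exists>R>0. \<forall>n\<ge>1. \<exists>A\<in>sets P. measure P A \<le> \<epsilon> \<and>
          (\<forall>y\<in>space P - A. enn2real (p_variation p (W \<alpha> f v (Suc (n - 1)) y)) \<le> R)"
      proof (intro exI[of _ r] conjI allI impI)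
        show "0 < r" unfolding r_def using R0 by (intro sum_pos) auto
        fix n :: nat assume n: "1 \<le> n"
        have "\<forall>i. \<exists>A. A \<in> sets P \<and> measure P A \<le> e \<and>
          (\<forall>y\<in>space P - A. pvar_le q (\<lambda>l. \<Sum>a<l. w i ((f ^^ a) y)) n (R i * real n powr (1/\<alpha>)))"
          using R[OF n] by blast
        from choice[OF this] obtain A where "\<forall>i. A i \<in> sets P \<and> measure P (A i) \<le> e \<and>
          (\<forall>y\<in>space P - A i. pvar_le q (\<lambda>l. \<Sum>a<l. w i ((f ^^ a) y)) n (R i * real n powr (1/\<alpha>)))" ..
        hence A: "\<And>i. A i \<in> sets P" "\<And>i. measure P (A i) \<le> e"
          "\<And>i y. y \<in> space P \<Longrightarrow> y \<notin> A i \<Longrightarrow> pvar_le q (\<lambda>l. \<Sum>a<l. w i ((f ^^ a) y)) n (R i * real n powr (1/\<alpha>))"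
          by blast+
        define U where "U = (\<Union>i\<in>UNIV. A i)"
        have U: "U \<in> sets P" unfolding U_def using A(1) by auto
        have "measure P U \<le> (\<Sum>i\<in>UNIV. measure P (A i))"
          unfolding U_def using A(1) by (intro P.finite_measure_subadditive_finite) auto
        also have "\<dots> \<le> (\<Sum>i\<in>(UNIV :: 'd set). e)" by (intro sum_mono A(2))
        also have "\<dots> = \<epsilon>" by (simp add: e_def)
        finally have mU: "measure P U \<le> \<epsilon>" .
        have "enn2real (p_variation p (W \<alpha> f v (Suc (n - 1)) y)) \<le> r" if y: "y \<in> space P - U" for y
        proof -
          have y01: "y \<in> {0..1}" using y M_space[OF assms(8)] by simp
          have pv: "pvar_le p (\<lambda>l. \<Sum>a<l. v ((f ^^ a) y) $ i) n (R i * real n powr (1/\<alpha>))" for i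
          proof -
            have "pvar_le q (\<lambda>l. \<Sum>a<l. w i ((f ^^ a) y)) n (R i * real n powr (1/\<alpha>))"
              using y by (intro A(3)) (auto simp: U_def)
            moreover have "(\<Sum>a<l. w i ((f ^^ a) y)) = (\<Sum>a<l. v ((f ^^ a) y) $ i)" for l
              by (intro sum.cong refl w_v f_iter y01)
            ultimately have pv_q: "pvar_le q (\<lambda>l. \<Sum>a<l. v ((f ^^ a) y) $ i) n (R i * real n powr (1/\<alpha>))" by simp
            show ?thesis
              by (rule pvar_le_exponent_mono[OF pv_q]) (use q R0[of i] in auto)
          qed
          have "p_variation p (W \<alpha> f v n y) \<le> ennreal (real n powr (- 1/\<alpha>) * (\<Sum>i\<in>UNIV. R i * real n powr (1/\<alpha>)))"
            using R0 by (intro p_variation_W_le p1 pv mult_nonneg_nonneg) (auto intro: less_imp_le)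
          also have "real n powr (- 1/\<alpha>) * (\<Sum>i\<in>UNIV. R i * real n powr (1/\<alpha>)) = (real n powr (- 1/\<alpha>) * real n powr (1/\<alpha>)) * r"
            by (simp add: r_def sum_distrib_right[symmetric] mult_ac)
          also have "real n powr (- 1/\<alpha>) * real n powr (1/\<alpha>) = 1" using n by (simp flip: powr_add)
          finally have "p_variation p (W \<alpha> f v n y) \<le> ennreal r" by simp
          moreover have "0 \<le> r" unfolding r_def using R0 by (intro sum_nonneg) (auto intro: less_imp_le)
          ultimately show ?thesis using n by (simp add: enn2real_leI)
        qed
        thus "\<exists>A\<in>sets P. measure P A \<le> \<epsilon> \<and>
          (\<forall>y\<in>space P - A. enn2real (p_variation p (W \<alpha> f v (Suc (n - 1)) y)) \<le> r)"
          using U mU by blast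
      qed
    qed
  qed
qed

end
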